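(* Let $A_1,A_2$ be self-adjoint $\zeta$-comparable operators (with spectral cuts $\theta=\pi/2$ and $\theta=3\pi/2$). Then $$\tilde\eta(A_1,A_2)=\frac1{2\pi i}\,\mathrm{LIM}_{\alpha\to\infty}\big(\log\det{}_F\mathcal S_{-i\alpha}-\log\det{}_F\mathcal S_{i\alpha}\big)+\frac12\,\zeta(A_1^2,A_2^2,0)\quad\mathrm{mod}\ (\mathbb Z),$$ where $\mathrm{LIM}_{\alpha\to\infty}$ of the difference is the difference of the regularized limits of $\log\det_F\mathcal S_\lambda$ in the sectors $\Lambda_-$ (along $\lambda=-i\alpha$) and $\Lambda_+$ (along $\lambda=i\alpha$), $\alpha\to+\infty$.
   Context: $H$ is a complex Hilbert space, and $A_1,A_2$ are self-adjoint on $H$ with spectrum meeting both $\mathbb R_+$ and $\mathbb R_-$. For $\theta\in[0,2\pi)$, $R_\theta=\{re^{i\theta}:r\ge0\}$ is a spectral cut for an invertible closed operator $A$ if for some $\delta,\varrho>0$ the resolvent $(A-\lambda)^{-1}$ is holomorphic on $\Lambda_\theta=\{z:|\arg z-\theta|<\delta\text{ or }|z|<\varrho\}$ with norm $O(|\lambda|^{-1})$ as $\lambda\to\infty$ there. Powers and logarithms associated with $R_\theta$ use $\theta-2\pi\le\arg<\theta$, so $\arg(-\lambda)$ is near $\theta-\pi$ for large $\lambda\in\Lambda_\theta$. $(A_1,A_2)$ is $\zeta$-comparable for $\theta$ if for $\lambda\in\Lambda_\theta$: (I) the relative resolvent is trace class with $\mathrm{Tr}((A_1-\lambda)^{-1}-(A_2-\lambda)^{-1})=-\frac{\partial}{\partial\lambda}\log\det_F\mathcal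 S_\lambda$, the scattering operator $\mathcal S_\lambda=\mathrm{Id}+W_\lambda$ acting on a Hilbert space $\mathcal H_\lambda\subseteq H$ with $W_\lambda$ trace class, $\det_F$ the Fredholm determinant; (II) as $\lambda\to\infty$ in $\Lambda_\theta$ this trace has an expansion $\sum_{j\ge0,j\neq J}\sum_{k=0}^1b_{j,k}(-\lambda)^{-\alpha_j}\log^k(-\lambda)+b_{J,0}(-\lambda)^{-1}$, $0<\alpha_0<\dots<\alpha_j\nearrow+\infty$, $\alpha_J=1$ (remainder after $j<N$ being $O(|\lambda|^{-\alpha_N+\epsilon})$ for every $\epsilon>0$ and large $N$). The two cuts are denoted $+$ ($\theta=\pi/2$) and $-$ ($\theta=3\pi/2$), with sectors $\Lambda_\pm$ and scattering operators $\mathcal S^\pm_\lambda$, chosen so that $\det_F\mathcal S^+_0=\det_F\mathcal S^-_0$; $\mathcal S_\lambda$ means $\mathcal S^\pm_\lambda$ for $\lambda\in\Lambda_\pm$. Logarithms of Fredholm determinants are ambiguous modulo $2\pi i\mathbb Z$. Regularized limit: for the cut $\theta$, $\log\det_F\mathcal S_\lambda$ has an expansion in $\Lambda_\theta$ in terms $(-\lambda)^{1-\alpha_j}\log^k(-\lambda)$ ($\alpha_j\ne1$), $\log(-\lambda)$ and a constant; $\mathrm{LIM}^\theta_{\lambda\to\infty}$ is the constant term. Relative eta function: $\eta(A_1,A_2,s)=\mathrm{Tr}(A_1|A_1|^{-s-1}-A_2|A_2|^{-s-1})$ for $\mathrm{Re}(s)\gg0$, continued meromorphically to $\mathbb C$;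 $\eta(A_1,A_2)$ is the constant term of its Laurent expansion at $s=0$, and $\tilde\eta(A_1,A_2)=\frac12\big(\eta(A_1,A_2)+\dim\mathrm{Ker}(A_1)-\dim\mathrm{Ker}(A_2)\big)$. $\zeta(A_1^2,A_2^2,0)$ is the value at $s=0$ of the meromorphic continuation of $\mathrm{Tr}((A_1^2)^{-s}-(A_2^2)^{-s})$ from $\mathrm{Re}(s)\gg0$ (powers with cut $R_\pi$). *)

theory Defs
  imports "HOL-Complex_Analysis.Complex_Analysis"
begin

section \<open>Complex Hilbert spaces\<close>

text \<open>The inner product is antilinear in its first and linear in its second argument.\<close>

class complex_hilbert = banach +
  fixes scaleC :: "complex \<Rightarrow> 'a \<Rightarrow> 'a" (infixr "*\<^sub>C" 75)
    and cinner :: "'a \<Rightarrow> 'a \<Rightarrow> complex"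
  assumes scaleC_add_right: "c *\<^sub>C (x + y) = c *\<^sub>C x + c *\<^sub>C y"
    and scaleC_add_left: "(c + d) *\<^sub>C x = c *\<^sub>C x + d *\<^sub>C x"
    and scaleC_scaleC: "c *\<^sub>C d *\<^sub>C x = (c * d) *\<^sub>C x"
    and scaleC_of_real: "complex_of_real r *\<^sub>C x = scaleR r x"
    and cinner_commute: "cinner x y = cnj (cinner y x)"
    and cinner_add_right: "cinner x (y + z) = cinner x y + cinner x z"
    and cinner_scaleC_right: "cinner x (c *\<^sub>C y) = c * cinner x y"
    and cinner_same: "cinner x x = complex_of_real ((norm x)\<^sup>2)"

instantiation complex :: complex_hilbert
begin

definition scaleC_complex :: "complex \<Rightarrow> complex \<Rightarrow> complex" where
  "scaleC_complex c x = c * x"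

definition cinner_complex :: "complex \<Rightarrow> complex \<Rightarrow> complex" where
  "cinner_complex x y = cnj x * y"

instance
proof
  fix x :: complex
  show "cinner x x = complex_of_real ((norm x)\<^sup>2)"
    unfolding cinner_complex_def by (metis complex_norm_square mult.commute)
qed (auto simp: scaleC_complex_def cinner_complex_def algebra_simps scaleR_conv_of_real)

end

global_interpretation cvector: vector_space "scaleC :: complex \<Rightarrow> 'a \<Rightarrow> 'a::complex_hilbert"
  defines csubspace = cvector.subspace
    and cspan = cvector.span
    and cdim = cvector.dim
proof
  fix x :: 'a
  show "1 *\<^sub>C x = x"
    using scaleC_of_real[of 1 x] by simp
qed (auto simp: scaleC_add_right scaleC_add_left scaleC_scaleC)

definition bounded_clinear :: "('h::complex_hilbert \<Rightarrow> 'h) \<Rightarrow> bool" where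
  "bounded_clinear T \<longleftrightarrow> bounded_linear T \<and> (\<forall>c x. T (c *\<^sub>C x) = c *\<^sub>C T x)"

definition orthonormal_basis :: "'h::complex_hilbert set \<Rightarrow> 'h set \<Rightarrow> bool" where
  "orthonormal_basis V E \<longleftrightarrow> E \<subseteq> V \<and>
     (\<forall>e\<in>E. \<forall>e'\<in>E. cinner e e' = (if e = e' then 1 else 0)) \<and> V \<subseteq> closure (cspan E)"

definition some_onb :: "'h::complex_hilbert set \<Rightarrow> 'h set" where
  "some_onb V = (SOME E. orthonormal_basis V E)"


section \<open>Trace class operators and Fredholm determinants\<close>

text \<open>
  Everything in this section is relative to a closed subspace \<open>V\<close>, regarded as a Hilbert space of
  its own; an operator on \<open>V\<close> is a function of which only the values on \<open>V\<close> are used.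
\<close>

definition closed_csubspace :: "'h::complex_hilbert set \<Rightarrow> bool" where
  "closed_csubspace V \<longleftrightarrow> csubspace V \<and> closed V"

text \<open>
  Trace class means nuclear: \<open>T = (\<Sum>n. \<langle>a\<^sub>n, \<cdot>\<rangle> b\<^sub>n)\<close> with \<open>(\<Sum>n. \<parallel>a\<^sub>n\<parallel> \<parallel>b\<^sub>n\<parallel>) < \<infinity>\<close>. This makes \<open>T\<close> a bounded
  linear map of \<open>V\<close> into \<open>V\<close>.
\<close>

definition trace_class_on :: "'h::complex_hilbert set \<Rightarrow> ('h \<Rightarrow> 'h) \<Rightarrow> bool" where
  "trace_class_on V T \<longleftrightarrow>
     (\<exists>a b :: nat \<Rightarrow> 'h. range a \<subseteq> V \<and> range b \<subseteq> V \<and>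
        summable (\<lambda>n. norm (a n) * norm (b n)) \<and>
        (\<forall>x\<in>V. (\<lambda>n. cinner (a n) x *\<^sub>C b n) sums T x))"

definition trace_on :: "'h::complex_hilbert set \<Rightarrow> ('h \<Rightarrow> 'h) \<Rightarrow> complex" where
  "trace_on V T = (\<Sum>\<^sub>\<infinity>e\<in>some_onb V. cinner e (T e))"

text \<open>The determinant of the matrix \<open>(\<langle>e, T e'\<rangle>)\<close> with \<open>e, e'\<close> ranging over the finite set \<open>F\<close>.\<close>

definition principal_minor :: "('h::complex_hilbert \<Rightarrow> 'h) \<Rightarrow> 'h set \<Rightarrow> complex" where
  "principal_minor T F =
     (\<Sum>p | p permutes F. of_int (sign p) * (\<Prod>e\<in>F. cinner e (T (p e))))"

text \<open>
  The Fredholm determinant of \<open>S = Id + W\<close>, \<open>W\<close> trace class, is \<open>(\<Sum>k. Tr (\<Lambda>\<^sup>k W))\<close>. In the orthonormal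
  basis of \<open>\<Lambda>\<^sup>k V\<close> induced by an orthonormal basis \<open>E\<close> of \<open>V\<close>, \<open>Tr (\<Lambda>\<^sup>k W)\<close> is the sum of the principal
  minors of \<open>W\<close> over the \<open>k\<close>-element subsets of \<open>E\<close> (the empty set contributes \<open>1\<close>).
\<close>

definition fredholm_det :: "'h::complex_hilbert set \<Rightarrow> ('h \<Rightarrow> 'h) \<Rightarrow> complex" where
  "fredholm_det V S =
     (\<Sum>\<^sub>\<infinity>F\<in>{F. finite F \<and> F \<subseteq> some_onb V}. principal_minor (\<lambda>x. S x - x) F)"


section \<open>Unbounded operators\<close>

text \<open>
  An unbounded operator is given by its graph; its domain is then \<^const>\<open>Domain\<close>, and the square of
  \<open>A\<close>, on its natural domain, is \<open>A O A\<close>.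
\<close>

type_synonym 'h graph = "('h \<times> 'h) set"

definition linear_operator :: "'h::complex_hilbert graph \<Rightarrow> bool" where
  "linear_operator A \<longleftrightarrow> single_valued A \<and> (0, 0) \<in> A \<and>
     (\<forall>x y x' y'. (x, y) \<in> A \<and> (x', y') \<in> A \<longrightarrow> (x + x', y + y') \<in> A) \<and>
     (\<forall>c x y. (x, y) \<in> A \<longrightarrow> (c *\<^sub>C x, c *\<^sub>C y) \<in> A)"

definition closed_operator :: "'h::complex_hilbert graph \<Rightarrow> bool" where
  "closed_operator A \<longleftrightarrow> linear_operator A \<and> closed A"

definition adjoint_graph :: "'h::complex_hilbert graph \<Rightarrow> 'h graph" where
  "adjoint_graph A = {(y, z). \<forall>(x, w)\<in>A. cinner w y = cinner x z}"

definition self_adjoint :: "'h::complex_hilbert graph \<Rightarrow> bool" where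
  "self_adjoint A \<longleftrightarrow> linear_operator A \<and> closure (Domain A) = UNIV \<and> adjoint_graph A = A"

definition op_apply :: "'h::complex_hilbert graph \<Rightarrow> 'h \<Rightarrow> 'h" where
  "op_apply A x = (THE y. (x, y) \<in> A)"

definition kernel_of :: "'h::complex_hilbert graph \<Rightarrow> 'h set" where
  "kernel_of A = {x. (x, 0) \<in> A}"

text \<open>\<open>(A - z)\<^sup>-\<^sup>1 x\<close> is the \<open>y\<close> with \<open>A y = x + z y\<close>.\<close>

definition resolvent :: "'h::complex_hilbert graph \<Rightarrow> complex \<Rightarrow> 'h \<Rightarrow> 'h" where
  "resolvent A z x = (THE y. (y, x + z *\<^sub>C y) \<in> A)"

definition resolvent_set :: "'h::complex_hilbert graph \<Rightarrow> complex set" where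
  "resolvent_set A =
     {z. (\<forall>x. \<exists>!y. (y, x + z *\<^sub>C y) \<in> A) \<and> bounded_clinear (resolvent A z)}"

definition spectrum :: "'h::complex_hilbert graph \<Rightarrow> complex set" where
  "spectrum A = - resolvent_set A"


section \<open>Spectral cuts and complex powers\<close>

definition cut_sector :: "real \<Rightarrow> real \<Rightarrow> real \<Rightarrow> complex set" where
  "cut_sector \<theta> \<delta> \<rho> = {z. (\<exists>t. \<bar>t - \<theta>\<bar> < \<delta> \<and> z = complex_of_real (norm z) * cis t) \<or> norm z < \<rho>}"

definition sector_infinity :: "real \<Rightarrow> real \<Rightarrow> real \<Rightarrow> complex filter" where
  "sector_infinity \<theta> \<delta> \<rho> = inf at_infinity (principal (cut_sector \<theta> \<delta> \<rho>))"

text \<open>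
  Holomorphy of an operator-valued function is expressed through its matrix elements; for functions
  with values in the bounded operators this is the same as holomorphy in the operator norm.
\<close>

definition spectral_cut :: "real \<Rightarrow> real \<Rightarrow> real \<Rightarrow> 'h::complex_hilbert graph \<Rightarrow> bool" where
  "spectral_cut \<theta> \<delta> \<rho> A \<longleftrightarrow> closed_operator A \<and> \<delta> > 0 \<and> \<rho> > 0 \<and>
     cut_sector \<theta> \<delta> \<rho> \<subseteq> resolvent_set A \<and>
     (\<forall>x y. (\<lambda>z. cinner x (resolvent A z y)) holomorphic_on cut_sector \<theta> \<delta> \<rho>) \<and>
     (\<lambda>z. onorm (resolvent A z)) \<in> O[sector_infinity \<theta> \<delta> \<rho>](\<lambda>z. inverse (norm z))"

text \<open>The argument and logarithm with \<open>\<theta> - 2\<pi> \<le> arg z < \<theta>\<close>.\<close>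

definition cut_Arg :: "real \<Rightarrow> complex \<Rightarrow> real" where
  "cut_Arg \<theta> z = \<theta> - 2 * pi + Arg2pi (z * cis (- \<theta>))"

definition cut_Ln :: "real \<Rightarrow> complex \<Rightarrow> complex" where
  "cut_Ln \<theta> z = complex_of_real (ln (norm z)) + \<i> * complex_of_real (cut_Arg \<theta> z)"

definition cut_power :: "real \<Rightarrow> complex \<Rightarrow> real \<Rightarrow> complex" where
  "cut_power \<theta> z a = exp (complex_of_real a * cut_Ln \<theta> z)"

lemma cut_Arg_bounds: "\<theta> - 2 * pi \<le> cut_Arg \<theta> z" "cut_Arg \<theta> z < \<theta>"
  using Arg2pi_ge_0[of "z * cis (- \<theta>)"] Arg2pi_lt_2pi[of "z * cis (- \<theta>)"]
  by (auto simp: cut_Arg_def)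

lemma cut_Arg_polar: "z = complex_of_real (norm z) * cis (cut_Arg \<theta> z)"
proof -
  have "z * cis (- \<theta>) = complex_of_real (norm z) * cis (Arg2pi (z * cis (- \<theta>)))"
    using Arg2pi_eq[of "z * cis (- \<theta>)"] by (simp add: norm_mult cis_conv_exp)
  hence "z * cis (- \<theta>) * cis (\<theta> - 2 * pi) =
      complex_of_real (norm z) * (cis (Arg2pi (z * cis (- \<theta>))) * cis (\<theta> - 2 * pi))"
    by simp
  moreover have "z * cis (- \<theta>) * cis (\<theta> - 2 * pi) = z"
    by (simp add: mult.assoc cis_mult) (simp add: cis.ctr complex_eq_iff)
  ultimately show ?thesis
    by (simp add: cut_Arg_def cis_mult add.commute)
qed

text \<open>
  \<open>A\<^sub>\<theta>\<^sup>-\<^sup>s = (i / 2\<pi>) \<integral>\<^sub>C \<lambda>\<^sup>-\<^sup>s (A - \<lambda>)\<^sup>-\<^sup>1 d\<lambda>\<close> for \<open>Re s > 0\<close>, applied to a vector. The contour \<open>C\<close> comes in from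
  infinity along \<open>r exp(i\<theta>)\<close>, runs clockwise once around the circle of radius \<open>\<rho>\<close> and returns to infinity
  along \<open>r exp(i(\<theta> - 2\<pi>))\<close>; \<open>\<lambda>\<^sup>-\<^sup>s\<close> is formed with the argument \<open>\<phi>\<close> that parametrizes \<open>C\<close>. The radius is
  any one for which the closed disc lies in the resolvent set (which exists when \<open>A\<close> is invertible).
\<close>

definition contour_integrand ::
  "'h::complex_hilbert graph \<Rightarrow> complex \<Rightarrow> 'h \<Rightarrow> real \<Rightarrow> real \<Rightarrow> 'h" where
  "contour_integrand A s x r \<phi> =
     exp (- s * (complex_of_real (ln r) + \<i> * complex_of_real \<phi>)) *\<^sub>C
       resolvent A (complex_of_real r * cis \<phi>) x"

definition neg_power :: "real \<Rightarrow> 'h::complex_hilbert graph \<Rightarrow> complex \<Rightarrow> 'h \<Rightarrow> 'h" where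
  "neg_power \<theta> A s x =
     (let \<rho> = (SOME \<rho>. \<rho> > 0 \<and> cball 0 \<rho> \<subseteq> resolvent_set A) in
      (\<i> / (2 * complex_of_real pi)) *\<^sub>C
        (- integral {\<rho>..} (\<lambda>r. cis \<theta> *\<^sub>C contour_integrand A s x r \<theta>)
         - integral {\<theta> - 2 * pi..\<theta>}
             (\<lambda>\<phi>. (\<i> * complex_of_real \<rho> * cis \<phi>) *\<^sub>C contour_integrand A s x \<rho> \<phi>)
         + integral {\<rho>..} (\<lambda>r. cis (\<theta> - 2 * pi) *\<^sub>C contour_integrand A s x r (\<theta> - 2 * pi))))"


section \<open>Comparable operators\<close>

definition log_branch_on :: "complex set \<Rightarrow> (complex \<Rightarrow> complex) \<Rightarrow> (complex \<Rightarrow> complex) \<Rightarrow> bool" where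
  "log_branch_on \<Lambda> f L \<longleftrightarrow> L holomorphic_on \<Lambda> \<and> (\<forall>z\<in>\<Lambda>. exp (L z) = f z)"

definition rel_resolvent_trace :: "'h::complex_hilbert graph \<Rightarrow> 'h graph \<Rightarrow> complex \<Rightarrow> complex" where
  "rel_resolvent_trace A\<^sub>1 A\<^sub>2 z = trace_on UNIV (\<lambda>x. resolvent A\<^sub>1 z x - resolvent A\<^sub>2 z x)"

definition expansion_exponents :: "(nat \<Rightarrow> real) \<Rightarrow> nat \<Rightarrow> bool" where
  "expansion_exponents \<alpha> J \<longleftrightarrow>
     0 < \<alpha> 0 \<and> strict_mono \<alpha> \<and> filterlim \<alpha> at_top sequentially \<and> \<alpha> J = 1"

definition has_trace_expansion :: "real \<Rightarrow> real \<Rightarrow> real \<Rightarrow> (complex \<Rightarrow> complex) \<Rightarrow> bool" where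
  "has_trace_expansion \<theta> \<delta> \<rho> f \<longleftrightarrow>
     (\<exists>\<alpha> J b. expansion_exponents \<alpha> J \<and>
        (\<forall>\<^sub>F N in sequentially. \<forall>\<epsilon>>0.
           (\<lambda>z. f z
                - ((\<Sum>j\<in>{..<N} - {J}. \<Sum>k\<le>1. b j k * cut_power \<theta> (- z) (- \<alpha> j) * cut_Ln \<theta> (- z) ^ k)
                   + b J 0 * cut_power \<theta> (- z) (- 1)))
             \<in> O[sector_infinity \<theta> \<delta> \<rho>](\<lambda>z. complex_of_real (norm z powr (- \<alpha> N + \<epsilon>)))))"

text \<open>
  \<open>H z\<close> is the space on which the scattering operator \<open>S z = Id + W z\<close> acts. As \<^const>\<open>cut_sector\<close> is star-shaped
  about \<open>0\<close>, asking for a branch of the logarithm on all of it is no restriction.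
\<close>

definition zeta_comparable ::
  "real \<Rightarrow> real \<Rightarrow> real \<Rightarrow> 'h::complex_hilbert graph \<Rightarrow> 'h graph \<Rightarrow>
     (complex \<Rightarrow> 'h set) \<Rightarrow> (complex \<Rightarrow> 'h \<Rightarrow> 'h) \<Rightarrow> bool" where
  "zeta_comparable \<theta> \<delta> \<rho> A\<^sub>1 A\<^sub>2 H S \<longleftrightarrow>
     spectral_cut \<theta> \<delta> \<rho> A\<^sub>1 \<and> spectral_cut \<theta> \<delta> \<rho> A\<^sub>2 \<and>
     (\<forall>z\<in>cut_sector \<theta> \<delta> \<rho>.
        trace_class_on UNIV (\<lambda>x. resolvent A\<^sub>1 z x - resolvent A\<^sub>2 z x) \<and>
        closed_csubspace (H z) \<and> trace_class_on (H z) (\<lambda>x. S z x - x)) \<and>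
     (\<exists>L. log_branch_on (cut_sector \<theta> \<delta> \<rho>) (\<lambda>z. fredholm_det (H z) (S z)) L \<and>
        (\<forall>z\<in>cut_sector \<theta> \<delta> \<rho>. rel_resolvent_trace A\<^sub>1 A\<^sub>2 z = - deriv L z)) \<and>
     has_trace_expansion \<theta> \<delta> \<rho> (rel_resolvent_trace A\<^sub>1 A\<^sub>2)"

text \<open>
  The regularized limit is the constant term \<open>c\<close>, which does not depend on the choice of the expansion.
\<close>

definition has_regularized_limit ::
  "real \<Rightarrow> real \<Rightarrow> real \<Rightarrow> (complex \<Rightarrow> complex) \<Rightarrow> complex \<Rightarrow> bool" where
  "has_regularized_limit \<theta> \<delta> \<rho> f c \<longleftrightarrow>
     (\<exists>\<alpha> J b m. expansion_exponents \<alpha> J \<and>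
        (\<forall>\<^sub>F N in sequentially. \<forall>\<epsilon>>0.
           (\<lambda>z. f z
                - ((\<Sum>j\<in>{..<N} - {J}. \<Sum>k\<le>1. b j k * cut_power \<theta> (- z) (1 - \<alpha> j) * cut_Ln \<theta> (- z) ^ k)
                   + m * cut_Ln \<theta> (- z) + c))
             \<in> O[sector_infinity \<theta> \<delta> \<rho>](\<lambda>z. complex_of_real (norm z powr (1 - \<alpha> N + \<epsilon>)))))"

definition LIM_reg :: "real \<Rightarrow> real \<Rightarrow> real \<Rightarrow> (complex \<Rightarrow> complex) \<Rightarrow> complex" where
  "LIM_reg \<theta> \<delta> \<rho> f = (THE c. has_regularized_limit \<theta> \<delta> \<rho> f c)"


section \<open>Relative zeta and eta functions\<close>

text \<open>\<open>F\<close> is a meromorphic continuation to the whole plane of \<open>Tr (T s)\<close>, defined for \<open>Re s\<close> large.\<close>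

definition continues_trace :: "(complex \<Rightarrow> complex) \<Rightarrow> (complex \<Rightarrow> 'h::complex_hilbert \<Rightarrow> 'h) \<Rightarrow> bool" where
  "continues_trace F T \<longleftrightarrow> F meromorphic_on UNIV \<and>
     (\<exists>\<sigma>. \<forall>s. Re s > \<sigma> \<longrightarrow> trace_class_on UNIV (T s) \<and> F s = trace_on UNIV (T s))"

definition rel_zeta_at_0 :: "real \<Rightarrow> 'h::complex_hilbert graph \<Rightarrow> 'h graph \<Rightarrow> complex" where
  "rel_zeta_at_0 \<theta> B\<^sub>1 B\<^sub>2 =
     (THE c. \<exists>F. continues_trace F (\<lambda>s x. neg_power \<theta> B\<^sub>1 s x - neg_power \<theta> B\<^sub>2 s x) \<and>
        F analytic_on {0} \<and> c = F 0)"

text \<open>\<open>A |A|\<^sup>-\<^sup>s\<^sup>-\<^sup>1\<close>, where \<open>|A| = (A\<^sup>2)\<^sup>1\<^sup>/\<^sup>2\<close>, so that \<open>|A|\<^sup>-\<^sup>s\<^sup>-\<^sup>1 = (A\<^sup>2)\<^sup>-\<^sup>(\<^sup>s\<^sup>+\<^sup>1\<^sup>)\<^sup>/\<^sup>2\<close> with the cut \<open>\<pi>\<close>.\<close>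

definition eta_operator :: "'h::complex_hilbert graph \<Rightarrow> complex \<Rightarrow> 'h \<Rightarrow> 'h" where
  "eta_operator A s x = op_apply A (neg_power pi (A O A) ((s + 1) / 2) x)"

definition rel_eta :: "'h::complex_hilbert graph \<Rightarrow> 'h graph \<Rightarrow> complex" where
  "rel_eta A\<^sub>1 A\<^sub>2 =
     (THE c. \<exists>F. continues_trace F (\<lambda>s x. eta_operator A\<^sub>1 s x - eta_operator A\<^sub>2 s x) \<and>
        c = fls_nth (laurent_expansion F 0) 0)"

definition rel_eta_tilde :: "'h::complex_hilbert graph \<Rightarrow> 'h graph \<Rightarrow> complex" where
  "rel_eta_tilde A\<^sub>1 A\<^sub>2 =
     (rel_eta A\<^sub>1 A\<^sub>2 + of_nat (cdim (kernel_of A\<^sub>1)) - of_nat (cdim (kernel_of A\<^sub>2))) / 2"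

end

theory Submission
  imports Defs
begin

text \<open>
  Write \<open>f(\<lambda>)\<close> for the trace of \<open>(A\<^sub>1 - \<lambda>)\<^sup>-\<^sup>1 - (A\<^sub>2 - \<lambda>)\<^sup>-\<^sup>1\<close>. In the two sectors \<open>f = -L\<^sub>\<plusminus>'\<close>, where \<open>L\<^sub>\<plusminus>\<close> are the
  logarithms of the determinants. As \<open>A\<^sup>2 - \<lambda>\<^sup>2 = (A - \<lambda>) (A + \<lambda>)\<close>, the contour integrals that define the
  powers of \<open>A\<^sup>2\<close>, with \<open>\<mu> = \<lambda>\<^sup>2\<close> running along the negative axis and around a circle of radius \<open>c\<^sup>2\<close>,
  express the zeta and eta functions through \<open>f\<close> on the imaginary axis and on the circle \<open>\<bar>\<lambda>\<bar> = c\<close>. With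
  \<open>\<phi>(r) = L\<^sub>+(i\<surd>r)\<close> and \<open>\<psi>(r) = L\<^sub>-(-i\<surd>r)\<close> the half-line parts are, for \<open>Re s\<close> large,
  \<open>(sin \<pi>s / \<pi>) \<integral> r\<^sup>-\<^sup>s (\<phi>' + \<psi>') dr\<close> and \<open>(i / \<pi>) cos(\<pi>s/2) \<integral> r\<^sup>-\<^sup>s\<^sup>/\<^sup>2 (\<phi>' - \<psi>') dr\<close>, integrated over \<open>r \<ge> c\<^sup>2\<close>.

  These Mellin transforms continue meromorphically because \<open>\<phi>\<close> and \<open>\<psi>\<close> have expansions in powers and
  logarithms of \<open>r\<close>. At the origin the transform of \<open>\<phi>'\<close> has a simple pole whose residue is the
  coefficient of \<open>log r\<close>, and its constant term is the constant term of \<open>\<phi>\<close> minus \<open>\<phi>(c\<^sup>2)\<close>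
  (\<open>mellin_transform_of_derivative\<close>). The sine keeps only the residues: if \<open>m\<^sub>\<plusminus>\<close> are the coefficients of
  \<open>log(-\<lambda>)\<close> in \<open>L\<^sub>\<plusminus>\<close>, the zeta value is \<open>(m\<^sub>+ + m\<^sub>-) / 2\<close>. The eta value is \<open>i / \<pi>\<close> times the difference of the
  constant terms, up to values of \<open>L\<^sub>\<plusminus>\<close> on the small circle, which cancel against the circle integral
  because \<open>f\<close> has a primitive on the disc (\<open>circle_values\<close>) --- except for the difference \<open>L\<^sub>+ - L\<^sub>-\<close>, a multiple of
  \<open>2\<pi>i\<close> by the normalization at \<open>0\<close>. Regularized limits refer to \<open>log(-\<lambda>) = log \<bar>\<lambda>\<bar> \<minusplus> i\<pi>/2\<close>; this shifts the
  constant terms by multiples of \<open>m\<^sub>\<plusminus>\<close> and produces the zeta term of the formula.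

  Two points need work beyond this computation. The trace must be exchanged with the contour
  integrals, although only pointwise trace class membership and the asymptotics of \<open>f\<close> are given. The
  identity \<open>R\<^sub>1(z) - R\<^sub>2(z) = (1 + h R\<^sub>1(z)) (R\<^sub>1(w) - R\<^sub>2(w)) (1 + h R\<^sub>2(z))\<close>, \<open>h = z - w\<close>, bounds the trace
  norm by its value at one point, and makes the relative resolvent continuous into the Banach space of
  nuclear operators (\<open>rel_res_continuous\<close>, \<open>rel_res_axis_bound\<close>). And the regularized limits must be
  shown to exist, by integrating the trace expansion in the sector (\<open>regularized_limit_exists\<close>), and to
  be unique, which follows from the uniqueness of the meromorphic continuation of the Mellin transform
  (\<open>log_expansion_unique\<close>).
\<close>

section \<open>Elementary geometry of complex Hilbert spaces\<close>

lemma scaleC_zero_right [simp]: "c *\<^sub>C (0::'h::complex_hilbert) = 0"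
  using scaleC_add_right[of c "0::'h" 0] by simp

lemma scaleC_minus_right: "c *\<^sub>C (- x) = - (c *\<^sub>C (x::'h::complex_hilbert))"
  using scaleC_add_right[of c "x" "-x"] by (simp add: minus_unique)

lemma scaleC_diff_right: "c *\<^sub>C (x - y) = c *\<^sub>C (x::'h::complex_hilbert) - c *\<^sub>C y"
  using scaleC_add_right[of c "x" "-y"] by (simp add: scaleC_minus_right)

lemma scaleC_zero_left [simp]: "0 *\<^sub>C (x::'h::complex_hilbert) = 0"
  using scaleC_of_real[of 0 x] by simp

lemma scaleC_one [simp]: "1 *\<^sub>C (x::'h::complex_hilbert) = x"
  using scaleC_of_real[of 1 x] by simp

lemma scaleC_minus_left: "(- c) *\<^sub>C (x::'h::complex_hilbert) = - (c *\<^sub>C x)"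
  using scaleC_add_left[of c "-c" x] by (simp add: minus_unique)

lemma scaleC_diff_left: "(c - d) *\<^sub>C (x::'h::complex_hilbert) = c *\<^sub>C x - d *\<^sub>C x"
  using scaleC_add_left[of c "-d" x] by (simp add: scaleC_minus_left)

lemma scaleR_scaleC: "r *\<^sub>R (x::'h::complex_hilbert) = complex_of_real r *\<^sub>C x"
  by (simp add: scaleC_of_real)

lemma cinner_add_left: "cinner (x + y) z = cinner x z + cinner (y::'h::complex_hilbert) z"
  by (metis cinner_add_right cinner_commute complex_cnj_add)

lemma cinner_scaleC_left: "cinner (c *\<^sub>C x) y = cnj c * cinner (x::'h::complex_hilbert) y"
  by (metis cinner_scaleC_right cinner_commute complex_cnj_mult)

lemma cinner_zero_right [simp]: "cinner (x::'h::complex_hilbert) 0 = 0"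
  using cinner_scaleC_right[of x 0 0] by simp

lemma cinner_zero_left [simp]: "cinner 0 (x::'h::complex_hilbert) = 0"
  using cinner_scaleC_left[of 0 0 x] by simp

lemma cinner_minus_right: "cinner x (- y) = - cinner (x::'h::complex_hilbert) y"
  using cinner_scaleC_right[of x "-1" y] by (simp add: scaleC_minus_left)

lemma cinner_minus_left: "cinner (- x) y = - cinner (x::'h::complex_hilbert) y"
  using cinner_scaleC_left[of "-1" x y] by (simp add: scaleC_minus_left)

lemma cinner_diff_right: "cinner x (y - z) = cinner (x::'h::complex_hilbert) y - cinner x z"
  using cinner_add_right[of x y "-z"] by (simp add: cinner_minus_right)

lemma cinner_sum_right: "cinner x (\<Sum>i\<in>I. f i) = (\<Sum>i\<in>I. cinner (x::'h::complex_hilbert) (f i))"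
  by (induction I rule: infinite_finite_induct) (simp_all add: cinner_add_right)

lemma cinner_self_eq_0 [simp]: "cinner x x = 0 \<longleftrightarrow> x = (0::'h::complex_hilbert)"
  by (simp add: cinner_same)

lemma norm_scaleC [simp]: "norm (c *\<^sub>C (x::'h::complex_hilbert)) = norm c * norm x"
proof -
  have "complex_of_real ((norm (c *\<^sub>C x))\<^sup>2) = cinner (c *\<^sub>C x) (c *\<^sub>C x)"
    by (simp add: cinner_same)
  also have "\<dots> = (c * cnj c) * cinner x x"
    by (simp add: cinner_scaleC_left cinner_scaleC_right)
  also have "\<dots> = complex_of_real ((norm c * norm x)\<^sup>2)"
    by (simp add: cinner_same complex_norm_square[symmetric] power_mult_distrib)
  finally have "(norm (c *\<^sub>C x))\<^sup>2 = (norm c * norm x)\<^sup>2"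
    using of_real_eq_iff by blast
  thus ?thesis by simp
qed

lemma cinner_Re_same: "Re (cinner x x) = (norm (x::'h::complex_hilbert))\<^sup>2"
  by (simp add: cinner_same)

lemma Re_cinner_add_self:
  "(norm (x + y))\<^sup>2 = (norm (x::'h::complex_hilbert))\<^sup>2 + (norm y)\<^sup>2 + 2 * Re (cinner x y)"
proof -
  have "cinner (x+y) (x+y) = cinner x x + cinner y y + (cinner x y + cnj (cinner x y))"
    by (simp add: cinner_add_left cinner_add_right cinner_commute[of y x])
  from arg_cong[OF this, of Re] show ?thesis by (simp add: cinner_Re_same)
qed

lemma norm_diff_square:
  "(norm (x - y))\<^sup>2 = (norm (x::'h::complex_hilbert))\<^sup>2 + (norm y)\<^sup>2 - 2 * Re (cinner x y)"
  using Re_cinner_add_self[of x "-y"] by (simp add: cinner_minus_right)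

lemma bessel_finite:
  fixes x :: "'h::complex_hilbert"
  assumes "finite F" and orth: "\<And>e e'. e \<in> F \<Longrightarrow> e' \<in> F \<Longrightarrow> cinner e e' = (if e = e' then 1 else 0)"
  shows "(norm (x - (\<Sum>e\<in>F. cinner e x *\<^sub>C e)))\<^sup>2 = (norm x)\<^sup>2 - (\<Sum>e\<in>F. (norm (cinner e x))\<^sup>2)"
    and "(norm (\<Sum>e\<in>F. cinner e x *\<^sub>C e))\<^sup>2 = (\<Sum>e\<in>F. (norm (cinner e x))\<^sup>2)"
proof -
  define y where "y = (\<Sum>e\<in>F. cinner e x *\<^sub>C e)"
  have expand: "cinner z y = (\<Sum>e\<in>F. cinner e x * cinner z e)" for z
    unfolding y_def by (simp add: cinner_sum_right cinner_scaleC_right)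
  have coeff: "cinner e y = cinner e x" if "e \<in> F" for e
  proof -
    have "cinner e y = (\<Sum>e'\<in>F. if e = e' then cinner e' x else 0)"
      unfolding expand by (intro sum.cong refl) (simp add: orth[OF that])
    thus ?thesis using assms(1) that by simp
  qed
  have self: "cinner e x * cnj (cinner e x) = complex_of_real ((norm (cinner e x))\<^sup>2)" for e
    by (rule complex_norm_square[symmetric])
  have xy: "cinner x y = (\<Sum>e\<in>F. complex_of_real ((norm (cinner e x))\<^sup>2))"
    unfolding expand by (intro sum.cong refl) (metis self cinner_commute)
  have "cinner y y = (\<Sum>e\<in>F. complex_of_real ((norm (cinner e x))\<^sup>2))"
    unfolding expand[of y] by (intro sum.cong refl) (metis self cinner_commute coeff)
  hence "complex_of_real ((norm y)\<^sup>2) = complex_of_real (\<Sum>e\<in>F. (norm (cinner e x))\<^sup>2)"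
    by (simp add: cinner_same)
  thus yy: "(norm y)\<^sup>2 = (\<Sum>e\<in>F. (norm (cinner e x))\<^sup>2)" using of_real_eq_iff by blast
  have "Re (cinner x y) = (\<Sum>e\<in>F. (norm (cinner e x))\<^sup>2)" unfolding xy by simp
  with yy show "(norm (x - y))\<^sup>2 = (norm x)\<^sup>2 - (\<Sum>e\<in>F. (norm (cinner e x))\<^sup>2)"
    by (simp add: norm_diff_square)
qed

lemma bessel_inequality:
  fixes x :: "'h::complex_hilbert"
  assumes "finite F" and "\<And>e e'. e \<in> F \<Longrightarrow> e' \<in> F \<Longrightarrow> cinner e e' = (if e = e' then 1 else 0)"
  shows "(\<Sum>e\<in>F. (norm (cinner e x))\<^sup>2) \<le> (norm x)\<^sup>2"
  using bessel_finite(1)[OF assms, of x] zero_le_power2[of "norm (x - (\<Sum>e\<in>F. cinner e x *\<^sub>C e))"]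
  by linarith

lemma cauchy_schwarz: "norm (cinner x y) \<le> norm x * norm (y::'h::complex_hilbert)"
proof (cases "x = 0")
  case False
  define r where "r = complex_of_real (norm x)"
  have r: "r \<noteq> 0" "norm r = norm x" using False by (auto simp: r_def)
  define e where "e = inverse r *\<^sub>C x"
  have x: "r *\<^sub>C e = x" using r by (simp add: e_def scaleC_scaleC)
  have "norm e = 1" using r False by (simp add: e_def norm_inverse)
  hence ee: "cinner e e = 1" by (simp add: cinner_same)
  have "(\<Sum>e\<in>{e}. (norm (cinner e y))\<^sup>2) \<le> (norm y)\<^sup>2"
    by (rule bessel_inequality) (auto simp: ee)
  hence "(norm (cinner e y))\<^sup>2 \<le> (norm y)\<^sup>2" by simp
  hence "norm (cinner e y) \<le> norm y" by (rule power2_le_imp_le) (rule norm_ge_zero)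
  moreover have "norm (cinner x y) = norm x * norm (cinner e y)"
    using cinner_scaleC_left[of r e y] by (simp add: x r norm_mult)
  ultimately show ?thesis by (simp add: mult_left_mono)
qed simp

lemma bounded_bilinear_cinner: "bounded_bilinear (cinner :: 'h::complex_hilbert \<Rightarrow> 'h \<Rightarrow> complex)"
proof
  show "\<exists>K. \<forall>a b. norm (cinner a (b::'h)) \<le> norm a * norm b * K"
    using cauchy_schwarz by (intro exI[of _ 1]) auto
qed (simp_all add: cinner_add_left cinner_add_right scaleR_scaleC[where 'h='h] cinner_scaleC_left cinner_scaleC_right scaleR_conv_of_real)

lemma bounded_bilinear_scaleC: "bounded_bilinear (scaleC :: complex \<Rightarrow> 'h::complex_hilbert \<Rightarrow> 'h)"
proof
  show "\<exists>K. \<forall>a b. norm (a *\<^sub>C (b::'h)) \<le> norm a * norm b * K"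
    by (intro exI[of _ 1]) auto
qed (simp_all add: scaleC_add_left scaleC_add_right scaleC_scaleC scaleR_scaleC[where 'h='h] scaleR_conv_of_real mult.commute)

interpretation cinner: bounded_bilinear "cinner :: 'h::complex_hilbert \<Rightarrow> 'h \<Rightarrow> complex"
  by (rule bounded_bilinear_cinner)

interpretation scaleC: bounded_bilinear "scaleC :: complex \<Rightarrow> 'h::complex_hilbert \<Rightarrow> 'h"
  by (rule bounded_bilinear_scaleC)

lemma cinner_eqI: "(\<And>y. cinner y x = cinner y x') \<Longrightarrow> x = (x'::'h::complex_hilbert)"
proof -
  assume "\<And>y. cinner y x = cinner y x'"
  hence "cinner (x - x') (x - x') = 0" by (simp add: cinner_diff_right[of "x - x'" x x'])
  thus "x = x'" by simp
qed

lemma bounded_clinear_scaleC: "bounded_clinear T \<Longrightarrow> T (c *\<^sub>C x) = c *\<^sub>C T x"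
  by (simp add: bounded_clinear_def)

lemma bounded_clinear_bounded_linear: "bounded_clinear T \<Longrightarrow> bounded_linear T"
  by (simp add: bounded_clinear_def)

section \<open>Existence of orthonormal bases\<close>

definition orthonormal :: "'h::complex_hilbert set \<Rightarrow> bool" where
  "orthonormal E \<longleftrightarrow> (\<forall>e\<in>E. \<forall>e'\<in>E. cinner e e' = (if e = e' then 1 else 0))"

text \<open>
  Finite subsets of \<open>E\<close> along which the Bessel sums approach their supremum give partial Fourier sums
  that form a Cauchy sequence. Its limit has the same coefficients as \<open>x\<close>, because a coefficient that
  the chosen subsets miss would push some Bessel sum beyond the supremum.
\<close>

lemma fourier_series_remainder_orthogonal:
  fixes x :: "'h::complex_hilbert"
  assumes E: "orthonormal E"
  shows "\<exists>y\<in>closure (cspan E). \<forall>e\<in>E. cinner e (x - y) = 0"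
proof -
  have orth: "cinner e e' = (if e = e' then 1 else 0)" if "e \<in> E" "e' \<in> E" for e e'
    using E that by (simp add: orthonormal_def)
  define g where "g = (\<lambda>F. \<Sum>e\<in>F. (norm (cinner e x))\<^sup>2)"
  define P where "P = (\<lambda>F. \<Sum>e\<in>F. cinner e x *\<^sub>C e)"
  have bess: "g F \<le> (norm x)\<^sup>2" if "finite F" "F \<subseteq> E" for F
    unfolding g_def using that by (intro bessel_inequality) (auto simp: orth subset_iff)
  define s where "s = (SUP F\<in>{F. finite F \<and> F \<subseteq> E}. g F)"
  have bdd: "bdd_above (g ` {F. finite F \<and> F \<subseteq> E})" using bess by (auto intro!: bdd_aboveI)
  have gle: "g F \<le> s" if "finite F" "F \<subseteq> E" for F
    unfolding s_def using bdd that by (intro cSUP_upper) auto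
  have "\<exists>F. finite F \<and> F \<subseteq> E \<and> s - 1 / Suc n < g F" for n
  proof -
    have "s - 1 / Suc n < s" by simp
    then obtain F where "F \<in> {F. finite F \<and> F \<subseteq> E}" "s - 1 / Suc n < g F"
      unfolding s_def using less_cSUP_iff[OF _ bdd] by blast
    thus ?thesis by auto
  qed
  then obtain F0 where F0: "\<And>n. finite (F0 n)" "\<And>n. F0 n \<subseteq> E" "\<And>n::nat. s - 1 / Suc n < g (F0 n)"
    by metis
  define F where "F = (\<lambda>n. \<Union>k\<le>n. F0 k)"
  have F: "finite (F n)" "F n \<subseteq> E" for n using F0 by (auto simp: F_def)
  have Fmono: "F m \<subseteq> F n" if "m \<le> n" for m n using that by (force simp: F_def)
  have gmono: "g A \<le> g B" if "A \<subseteq> B" "finite B" for A B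
    unfolding g_def using that by (intro sum_mono2) auto
  have gF: "s - 1 / Suc n < g (F n)" for n
  proof -
    have "F0 n \<subseteq> F n" by (auto simp: F_def)
    thus ?thesis using F0(3)[of n] gmono[of "F0 n" "F n"] F(1)[of n] by linarith
  qed
  have Pdiff: "(norm (P B - P A))\<^sup>2 = g B - g A" if "A \<subseteq> B" "finite B" "B \<subseteq> E" for A B
  proof -
    have "P B - P A = (\<Sum>e\<in>B - A. cinner e x *\<^sub>C e)"
      unfolding P_def using that by (simp add: sum_diff)
    hence "(norm (P B - P A))\<^sup>2 = g (B - A)"
      unfolding g_def using that bessel_finite(2)[of "B - A" x] by (auto simp: orth subset_iff)
    also have "\<dots> = g B - g A" unfolding g_def using that by (simp add: sum_diff)
    finally show ?thesis .
  qed
  have "Cauchy (\<lambda>n. P (F n))"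
  proof (rule metric_CauchyI)
    fix \<epsilon> :: real assume "\<epsilon> > 0"
    hence "0 < \<epsilon>\<^sup>2" by simp
    then obtain M :: nat where M: "1 / Suc M < \<epsilon>\<^sup>2" by (rule nat_approx_posE)
    have *: "norm (P (F n) - P (F m)) < \<epsilon>" if "M \<le> m" "m \<le> n" for m n
    proof -
      have "(norm (P (F n) - P (F m)))\<^sup>2 = g (F n) - g (F m)" using that by (intro Pdiff Fmono F)
      also have "\<dots> \<le> s - g (F M)" using gle[OF F, of n] gmono[OF Fmono F(1), of M m] that by auto
      also have "\<dots> < \<epsilon>\<^sup>2" using gF[of M] M by linarith
      finally show ?thesis using \<open>\<epsilon> > 0\<close> by (simp add: power2_less_imp_less)
    qed
    show "\<exists>M. \<forall>m\<ge>M. \<forall>n\<ge>M. dist (P (F m)) (P (F n)) < \<epsilon>"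
      by (intro exI[of _ M] allI impI) (metis * dist_norm norm_minus_commute nle_le)
  qed
  then obtain y where y: "(\<lambda>n. P (F n)) \<longlonglongrightarrow> y" using Cauchy_convergent convergent_def by blast
  have "P (F n) \<in> cspan E" for n
    unfolding P_def using F(2)[of n]
    by (intro cvector.span_sum cvector.span_scale cvector.span_base) auto
  hence "y \<in> closure (cspan E)"
    using y unfolding closure_sequential by (intro exI[of _ "\<lambda>n. P (F n)"]) simp
  moreover have "cinner e (x - y) = 0" if e: "e \<in> E" for e
  proof -
    have bound: "norm (cinner e x - cinner e (P (F n))) \<le> sqrt (1 / Suc n)" for n
    proof (cases "e \<in> F n")
      case True
      have "cinner e (P (F n)) = (\<Sum>e'\<in>F n. if e = e' then cinner e' x else 0)"
        unfolding P_def cinner_sum_right cinner_scaleC_right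
        using e F(2)[of n] by (intro sum.cong) (auto simp: orth subset_iff)
      also have "\<dots> = cinner e x" using True F by simp
      finally show ?thesis by simp
    next
      case False
      have "cinner e (P (F n)) = (\<Sum>e'\<in>F n. 0)"
        unfolding P_def cinner_sum_right cinner_scaleC_right
        using e F(2)[of n] False by (intro sum.cong) (auto simp: orth subset_iff)
      hence z: "cinner e (P (F n)) = 0" by simp
      have "g (insert e (F n)) \<le> s" using e F by (intro gle) auto
      moreover have "g (insert e (F n)) = (norm (cinner e x))\<^sup>2 + g (F n)"
        unfolding g_def using False F by simp
      ultimately have "(norm (cinner e x))\<^sup>2 \<le> 1 / Suc n" using gF[of n] by linarith
      thus ?thesis using z real_le_rsqrt by auto
    qed
    have "(\<lambda>n. sqrt (1 / real (Suc n))) \<longlonglongrightarrow> 0"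
      using tendsto_real_sqrt[OF LIMSEQ_inverse_real_of_nat] by (simp add: inverse_eq_divide)
    hence "(\<lambda>n. cinner e x - cinner e (P (F n))) \<longlonglongrightarrow> 0"
      by (rule Lim_null_comparison[rotated]) (use bound in auto)
    moreover have "(\<lambda>n. cinner e x - cinner e (P (F n))) \<longlonglongrightarrow> cinner e x - cinner e y"
      by (intro tendsto_intros cinner.tendsto y)
    ultimately have "0 = cinner e x - cinner e y" by (rule LIMSEQ_unique)
    thus ?thesis by (simp add: cinner_diff_right)
  qed
  ultimately show ?thesis by blast
qed

text \<open>
  By Zorn's lemma there is a maximal orthonormal set. A vector outside the closure of its span would
  differ from its Fourier sum, and the normalized difference could be added to the set.
\<close>

lemma orthonormal_basis_exists: "\<exists>E. orthonormal_basis (UNIV :: 'h::complex_hilbert set) E"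
proof -
  have "\<exists>M\<in>{E::'h set. orthonormal E}. \<forall>X\<in>{E. orthonormal E}. M \<subseteq> X \<longrightarrow> X = M"
  proof (rule subset_Zorn_nonempty)
    show "{E::'h set. orthonormal E} \<noteq> {}" by (auto simp: orthonormal_def intro!: exI[of _ "{}"])
  next
    fix \<C> :: "'h set set" assume C: "\<C> \<noteq> {}" "subset.chain {E. orthonormal E} \<C>"
    have "\<exists>X\<in>\<C>. e \<in> X \<and> e' \<in> X" if "e \<in> \<Union>\<C>" "e' \<in> \<Union>\<C>" for e e'
      using C(2) that unfolding subset_chain_def by (metis UnionE subsetD)
    thus "\<Union>\<C> \<in> {E. orthonormal E}" using C(2) unfolding orthonormal_def subset_chain_def by (smt (verit) CollectD subsetD mem_Collect_eq)
  qed
  then obtain E :: "'h set" where E: "orthonormal E" and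
    max: "\<And>X. orthonormal X \<Longrightarrow> E \<subseteq> X \<Longrightarrow> X = E" by auto
  have "x \<in> closure (cspan E)" for x
  proof -
    obtain y where y: "y \<in> closure (cspan E)" "\<And>e. e \<in> E \<Longrightarrow> cinner e (x - y) = 0"
      using fourier_series_remainder_orthogonal[OF E, of x] by blast
    have "x = y"
    proof (rule ccontr)
      assume "x \<noteq> y"
      define u where "u = complex_of_real (1 / norm (x - y)) *\<^sub>C (x - y)"
      have "norm u = 1" using \<open>x \<noteq> y\<close> by (simp add: u_def norm_divide)
      hence uu: "cinner u u = 1" by (simp add: cinner_same)
      have eu: "cinner e u = 0" "cinner u e = 0" if "e \<in> E" for e
      proof -
        show "cinner e u = 0" using y(2)[OF that] by (simp add: u_def cinner_scaleC_right)
        thus "cinner u e = 0" using cinner_commute[of u e] by simp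
      qed
      have "orthonormal (insert u E)"
        using E uu eu unfolding orthonormal_def by (metis insert_iff)
      hence "insert u E = E" by (rule max) (rule subset_insertI)
      hence "u \<in> E" by blast
      hence "cinner u u = 0" by (rule eu)
      thus False using uu by simp
    qed
    thus ?thesis using y by simp
  qed
  hence "orthonormal_basis UNIV E"
    using E by (simp add: orthonormal_basis_def orthonormal_def subset_iff)
  thus ?thesis by (rule exI)
qed

lemma some_onb_orthonormal: "orthonormal (some_onb (UNIV :: 'h::complex_hilbert set))"
proof -
  have "orthonormal_basis (UNIV :: 'h set) (some_onb UNIV)"
    unfolding some_onb_def by (rule someI_ex[OF orthonormal_basis_exists])
  thus ?thesis unfolding orthonormal_basis_def orthonormal_def by (elim conjE)
qed

text \<open>
  The Cauchy--Schwarz inequality for sums, combined with Bessel's inequality in both arguments. It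
  bounds the contribution of a rank one operator to the trace in any orthonormal system.
\<close>

lemma bessel_mixed:
  fixes a b :: "'h::complex_hilbert"
  assumes "orthonormal E" "finite F" "F \<subseteq> E"
  shows "(\<Sum>e\<in>F. norm (cinner a e) * norm (cinner e b)) \<le> norm a * norm b"
proof -
  have orth: "cinner e e' = (if e = e' then 1 else 0)" if "e \<in> F" "e' \<in> F" for e e'
    using assms(1) subsetD[OF assms(3) that(1)] subsetD[OF assms(3) that(2)]
    unfolding orthonormal_def by blast
  have L2: "L2_set (\<lambda>e. norm (cinner e x)) F \<le> norm x" for x
    unfolding L2_set_def by (intro real_le_lsqrt sum_nonneg bessel_inequality[OF assms(2) orth]) auto
  have sym: "norm (cinner a e) = norm (cinner e a)" for e
    by (subst cinner_commute) (rule complex_mod_cnj)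
  have "(\<Sum>e\<in>F. norm (cinner a e) * norm (cinner e b)) =
        (\<Sum>e\<in>F. \<bar>norm (cinner e a)\<bar> * \<bar>norm (cinner e b)\<bar>)"
    unfolding sym abs_norm_cancel ..
  also have "\<dots> \<le> L2_set (\<lambda>e. norm (cinner e a)) F * L2_set (\<lambda>e. norm (cinner e b)) F"
    by (rule L2_set_mult_ineq)
  also have "\<dots> \<le> norm a * norm b" by (intro mult_mono L2 L2_set_nonneg norm_ge_zero)
  finally show ?thesis .
qed

section \<open>The Banach space of nuclear operators\<close>

text \<open>
  The trace identities below need integrals of operator valued functions that converge in the trace
  norm. Trace class operators are therefore made into a Banach space, normed by the infimum of
  \<open>\<Sum>n. \<parallel>a\<^sub>n\<parallel> \<parallel>b\<^sub>n\<parallel>\<close> over all representations \<open>\<Sum>n. \<langle>a\<^sub>n, \<cdot>\<rangle> b\<^sub>n\<close>.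
\<close>

definition nuclear_rep :: "('h::complex_hilbert \<Rightarrow> 'h) \<Rightarrow> (nat \<Rightarrow> 'h) \<Rightarrow> (nat \<Rightarrow> 'h) \<Rightarrow> bool" where
  "nuclear_rep T a b \<longleftrightarrow> summable (\<lambda>n. norm (a n) * norm (b n)) \<and>
     (\<forall>x. (\<lambda>n. cinner (a n) x *\<^sub>C b n) sums T x)"

definition rep_mass :: "(nat \<Rightarrow> 'h::complex_hilbert) \<Rightarrow> (nat \<Rightarrow> 'h) \<Rightarrow> real" where
  "rep_mass a b = (\<Sum>n. norm (a n) * norm (b n))"

lemma trace_class_iff_rep: "trace_class_on UNIV T \<longleftrightarrow> (\<exists>a b. nuclear_rep T a b)"
  by (simp add: trace_class_on_def nuclear_rep_def)

lemma rep_mass_nonneg: "nuclear_rep T a b \<Longrightarrow> 0 \<le> rep_mass a b"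
  by (simp add: nuclear_rep_def rep_mass_def suminf_nonneg)

lemma norm_rank_one_le: "norm (cinner a x *\<^sub>C b) \<le> norm a * norm b * norm (x::'h::complex_hilbert)"
proof -
  have "norm (cinner a x) * norm b \<le> (norm a * norm x) * norm b"
    by (rule mult_right_mono[OF cauchy_schwarz norm_ge_zero])
  thus ?thesis by (simp add: mult_ac)
qed

text \<open>
  A countable family of representations is merged into a single one by enumerating the index pairs;
  this one fact yields both the triangle inequality and the completeness of the nuclear norm.
\<close>

lemma nuclear_rep_countable_sum:
  fixes T :: "nat \<Rightarrow> 'h::complex_hilbert \<Rightarrow> 'h"
  assumes rep: "\<And>k. nuclear_rep (T k) (a k) (b k)" and mass: "(\<lambda>k. rep_mass (a k) (b k)) sums M"
  shows "\<exists>S a' b'. (\<forall>x. (\<lambda>k. T k x) sums S x) \<and> nuclear_rep S a' b' \<and> rep_mass a' b' = M"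
proof -
  define f where "f = (\<lambda>(k, n). norm (a k n) * norm (b k n))"
  have inner: "((\<lambda>n. f (k, n)) has_sum rep_mass (a k) (b k)) UNIV" for k
    using rep[of k] unfolding f_def nuclear_rep_def rep_mass_def
    by (intro sums_nonneg_imp_has_sum) (simp_all add: summable_sums)
  have outer: "((\<lambda>k. rep_mass (a k) (b k)) has_sum M) UNIV"
    by (rule sums_nonneg_imp_has_sum[OF mass]) (rule rep_mass_nonneg[OF rep])
  have fsum: "f summable_on UNIV \<times> UNIV"
    by (rule summable_on_SigmaI[OF inner]) (use outer in \<open>auto simp: summable_on_def f_def\<close>)
  have ftot: "(f has_sum M) (UNIV \<times> UNIV)"
    by (rule has_sum_SigmaI[OF inner outer fsum])
  define a' where "a' = (\<lambda>m. a (fst (prod_decode m)) (snd (prod_decode m)))"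
  define b' where "b' = (\<lambda>m. b (fst (prod_decode m)) (snd (prod_decode m)))"
  have bij: "bij_betw prod_decode UNIV (UNIV \<times> UNIV)" using bij_prod_decode by simp
  have "((\<lambda>m. f (prod_decode m)) has_sum M) UNIV"
    using has_sum_reindex_bij_betw[OF bij, of f M] ftot by simp
  hence mass': "(\<lambda>m. norm (a' m) * norm (b' m)) sums M"
    by (simp add: has_sum_imp_sums f_def a'_def b'_def case_prod_unfold)
  have "\<exists>y. (\<lambda>k. T k x) sums y \<and> (\<lambda>m. cinner (a' m) x *\<^sub>C b' m) sums y" for x
  proof -
    define g where "g = (\<lambda>(k, n). cinner (a k n) x *\<^sub>C b k n)"
    have "(\<lambda>p. f p * norm x) summable_on UNIV \<times> UNIV"
      using fsum by (rule summable_on_cmult_left)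
    hence abs: "(\<lambda>p. norm (g p)) summable_on UNIV \<times> UNIV"
      by (rule Infinite_Sum.abs_summable_on_comparison_test')
         (auto simp: g_def f_def intro: norm_rank_one_le[simplified])
    hence gs: "g summable_on UNIV \<times> UNIV" by (rule abs_summable_summable)
    then obtain y where y: "(g has_sum y) (UNIV \<times> UNIV)" by (auto simp: summable_on_def)
    have "((\<lambda>n. g (k, n)) has_sum T k x) UNIV" for k
    proof (rule norm_summable_imp_has_sum)
      have "summable (\<lambda>n. norm (a k n) * norm (b k n) * norm x)"
        using rep[of k] by (auto simp: nuclear_rep_def intro: summable_mult2)
      thus "summable (\<lambda>n. norm (g (k, n)))"
        by (rule summable_comparison_test') (simp add: g_def norm_rank_one_le[simplified])
      show "(\<lambda>n. g (k, n)) sums T k x" using rep[of k] by (simp add: g_def nuclear_rep_def)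
    qed
    hence "((\<lambda>k. T k x) has_sum y) UNIV" by (rule has_sum_SigmaD[OF y])
    moreover have "((\<lambda>m. g (prod_decode m)) has_sum y) UNIV"
      using has_sum_reindex_bij_betw[OF bij, of g y] y by simp
    ultimately show ?thesis
      by (intro exI[of _ y] conjI)
         (simp_all add: has_sum_imp_sums g_def a'_def b'_def case_prod_unfold)
  qed
  then obtain S where S: "\<And>x. (\<lambda>k. T k x) sums S x" "\<And>x. (\<lambda>m. cinner (a' m) x *\<^sub>C b' m) sums S x"
    by metis
  have "nuclear_rep S a' b'" using S(2) mass' by (auto simp: nuclear_rep_def sums_iff)
  moreover have "rep_mass a' b' = M" using mass' by (simp add: rep_mass_def sums_iff)
  ultimately show ?thesis using S(1) by blast
qed

lemma nuclear_rep_zero: "nuclear_rep (\<lambda>x. 0::'h::complex_hilbert) (\<lambda>_. 0) (\<lambda>_. 0)"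
  by (simp add: nuclear_rep_def)

lemma nuclear_rep_add:
  fixes T T' :: "'h::complex_hilbert \<Rightarrow> 'h"
  assumes "nuclear_rep T a b" "nuclear_rep T' a' b'"
  shows "\<exists>c d. nuclear_rep (\<lambda>x. T x + T' x) c d \<and> rep_mass c d = rep_mass a b + rep_mass a' b'"
proof -
  define TT where "TT = (\<lambda>k::nat. if k = 0 then T else if k = 1 then T' else (\<lambda>x. 0))"
  define A where "A = (\<lambda>k::nat. if k = 0 then a else if k = 1 then a' else (\<lambda>_. 0))"
  define B where "B = (\<lambda>k::nat. if k = 0 then b else if k = 1 then b' else (\<lambda>_. 0))"
  have rep: "nuclear_rep (TT k) (A k) (B k)" for k
    using assms nuclear_rep_zero[where 'h='h] by (simp add: TT_def A_def B_def)
  have fin: "f sums (f 0 + f 1)" if "\<And>k. k \<notin> {0, 1} \<Longrightarrow> f k = 0" for f :: "nat \<Rightarrow> 'b::real_normed_vector"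
    using sums_finite[of "{0, 1}" f] that by simp
  have "(\<lambda>k. rep_mass (A k) (B k)) sums (rep_mass (A 0) (B 0) + rep_mass (A 1) (B 1))"
    by (rule fin) (simp add: A_def B_def rep_mass_def)
  hence "(\<lambda>k. rep_mass (A k) (B k)) sums (rep_mass a b + rep_mass a' b')"
    by (simp add: A_def B_def)
  from nuclear_rep_countable_sum[of TT A B, OF rep this] obtain S c d where
    S: "\<And>x. (\<lambda>k. TT k x) sums S x" "nuclear_rep S c d" "rep_mass c d = rep_mass a b + rep_mass a' b'"
    by auto
  have "S x = T x + T' x" for x
  proof -
    have "(\<lambda>k. TT k x) sums (TT 0 x + TT 1 x)" by (rule fin) (simp add: TT_def)
    hence "(\<lambda>k. TT k x) sums (T x + T' x)" by (simp add: TT_def)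
    thus ?thesis using S(1) sums_unique2 by metis
  qed
  hence "S = (\<lambda>x. T x + T' x)" by (rule ext)
  thus ?thesis using S by metis
qed

text \<open>
  \<open>P \<langle>a, Q \<cdot>\<rangle> b = \<langle>Q' a, \<cdot>\<rangle> (P b)\<close> when \<open>Q'\<close> is adjoint to \<open>Q\<close>, so bounded factors act on a representation
  term by term.
\<close>

lemma nuclear_rep_sandwich:
  fixes T :: "'h::complex_hilbert \<Rightarrow> 'h"
  assumes rep: "nuclear_rep T a b" and P: "bounded_clinear P"
    and adj: "\<And>x y. cinner x (Q y) = cinner (Q' x) y"
    and bP: "\<And>x. norm (P x) \<le> p * norm x" and bQ: "\<And>x. norm (Q' x) \<le> q * norm x" and p: "0 \<le> p"
  shows "nuclear_rep (\<lambda>x. P (T (Q x))) (\<lambda>n. Q' (a n)) (\<lambda>n. P (b n))"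
    and "rep_mass (\<lambda>n. Q' (a n)) (\<lambda>n. P (b n)) \<le> p * q * rep_mass a b"
proof -
  have le: "norm (Q' (a n)) * norm (P (b n)) \<le> p * q * (norm (a n) * norm (b n))" for n
  proof -
    have "norm (Q' (a n)) * norm (P (b n)) \<le> (q * norm (a n)) * (p * norm (b n))"
      by (rule mult_mono[OF bQ bP]) (use bQ[of "a n"] norm_ge_zero[of "Q' (a n)"] in linarith, simp)
    thus ?thesis by (simp add: mult_ac)
  qed
  have sa: "summable (\<lambda>n. p * q * (norm (a n) * norm (b n)))"
    using rep by (auto simp: nuclear_rep_def intro: summable_mult)
  have sb: "summable (\<lambda>n. norm (Q' (a n)) * norm (P (b n)))"
    by (rule summable_comparison_test'[OF sa]) (simp add: le)
  show "nuclear_rep (\<lambda>x. P (T (Q x))) (\<lambda>n. Q' (a n)) (\<lambda>n. P (b n))"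
    unfolding nuclear_rep_def
  proof (intro conjI allI sb)
    fix x
    have "(\<lambda>n. cinner (a n) (Q x) *\<^sub>C b n) sums T (Q x)" using rep by (simp add: nuclear_rep_def)
    from bounded_linear.sums[OF bounded_clinear_bounded_linear[OF P] this]
    show "(\<lambda>n. cinner (Q' (a n)) x *\<^sub>C P (b n)) sums P (T (Q x))"
      by (simp add: bounded_clinear_scaleC[OF P] adj)
  qed
  have "rep_mass (\<lambda>n. Q' (a n)) (\<lambda>n. P (b n)) \<le> (\<Sum>n. p * q * (norm (a n) * norm (b n)))"
    unfolding rep_mass_def by (rule suminf_le[OF le sb sa])
  also have "\<dots> = p * q * rep_mass a b"
    using rep unfolding rep_mass_def nuclear_rep_def by (intro suminf_mult) simp
  finally show "rep_mass (\<lambda>n. Q' (a n)) (\<lambda>n. P (b n)) \<le> p * q * rep_mass a b" .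
qed

lemma bounded_clinear_cscale: "bounded_clinear (\<lambda>x::'h::complex_hilbert. c *\<^sub>C x)"
  unfolding bounded_clinear_def
  by (auto simp: scaleC.bounded_linear_right scaleC_scaleC mult.commute)

lemma nuclear_rep_cscale:
  assumes "nuclear_rep T a b"
  shows "nuclear_rep (\<lambda>x. c *\<^sub>C T x) a (\<lambda>n. c *\<^sub>C b n)"
    and "rep_mass a (\<lambda>n. c *\<^sub>C b n) \<le> norm c * rep_mass a b"
  using nuclear_rep_sandwich[OF assms bounded_clinear_cscale[of c], of "\<lambda>x. x" "\<lambda>x. x" "norm c" 1]
  by simp_all

typedef (overloaded) 'h nuclear = "{T :: 'h::complex_hilbert \<Rightarrow> 'h. trace_class_on UNIV T}"
  morphisms nuc_apply Nuc
proof
  show "(\<lambda>x. 0) \<in> {T :: 'h \<Rightarrow> 'h. trace_class_on UNIV T}"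
    using nuclear_rep_zero trace_class_iff_rep by blast
qed

lemma nuclear_eqI: "(\<And>x. nuc_apply A x = nuc_apply B x) \<Longrightarrow> A = B"
  by (simp add: nuc_apply_inject[symmetric] ext)

lemma nuc_apply_Nuc: "nuclear_rep T a b \<Longrightarrow> nuc_apply (Nuc T) = T"
  by (rule Nuc_inverse) (auto simp: trace_class_iff_rep)

lemma nuclear_has_rep: "\<exists>a b. nuclear_rep (nuc_apply N) a b"
  using nuc_apply[of N] by (simp add: trace_class_iff_rep)

definition nscale :: "complex \<Rightarrow> 'h::complex_hilbert nuclear \<Rightarrow> 'h nuclear" where
  "nscale c N = Nuc (\<lambda>x. c *\<^sub>C nuc_apply N x)"

lemma nuc_apply_nscale [simp]: "nuc_apply (nscale c N) x = c *\<^sub>C nuc_apply N x"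
proof -
  obtain a b where "nuclear_rep (nuc_apply N) a b" using nuclear_has_rep by blast
  from nuc_apply_Nuc[OF nuclear_rep_cscale(1)[OF this]] show ?thesis by (simp add: nscale_def)
qed

instantiation nuclear :: (complex_hilbert) real_normed_vector
begin

definition zero_nuclear :: "'a nuclear" where "zero_nuclear = Nuc (\<lambda>x. 0)"
definition plus_nuclear :: "'a nuclear \<Rightarrow> 'a nuclear \<Rightarrow> 'a nuclear" where
  "plus_nuclear A B = Nuc (\<lambda>x. nuc_apply A x + nuc_apply B x)"
definition uminus_nuclear :: "'a nuclear \<Rightarrow> 'a nuclear" where "uminus_nuclear A = nscale (-1) A"
definition minus_nuclear :: "'a nuclear \<Rightarrow> 'a nuclear \<Rightarrow> 'a nuclear" where
  "minus_nuclear A B = A + (- B)"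
definition scaleR_nuclear :: "real \<Rightarrow> 'a nuclear \<Rightarrow> 'a nuclear" where
  "scaleR_nuclear r A = nscale (complex_of_real r) A"
definition norm_nuclear :: "'a nuclear \<Rightarrow> real" where
  "norm_nuclear A = Inf {rep_mass a b |a b. nuclear_rep (nuc_apply A) a b}"
definition sgn_nuclear :: "'a nuclear \<Rightarrow> 'a nuclear" where
  "sgn_nuclear A = inverse (norm A) *\<^sub>R A"
definition dist_nuclear :: "'a nuclear \<Rightarrow> 'a nuclear \<Rightarrow> real" where
  "dist_nuclear A B = norm (A - B)"
definition uniformity_nuclear :: "('a nuclear \<times> 'a nuclear) filter" where
  "uniformity_nuclear = (INF e\<in>{0<..}. principal {(x, y). dist x y < e})"
definition open_nuclear :: "'a nuclear set \<Rightarrow> bool" where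
  "open_nuclear U \<longleftrightarrow> (\<forall>x\<in>U. eventually (\<lambda>(x', y). x' = x \<longrightarrow> y \<in> U) uniformity)"

lemma nuc_apply_zero: "nuc_apply (0::'a nuclear) x = 0"
  using nuc_apply_Nuc[OF nuclear_rep_zero, where 'a='a] by (simp add: zero_nuclear_def)

lemma nuc_apply_add: "nuc_apply (A + B :: 'a nuclear) x = nuc_apply A x + nuc_apply B x"
proof -
  obtain a b where "nuclear_rep (nuc_apply A) a b" using nuclear_has_rep by blast
  moreover obtain a' b' where "nuclear_rep (nuc_apply B) a' b'" using nuclear_has_rep by blast
  ultimately obtain c d where "nuclear_rep (\<lambda>x. nuc_apply A x + nuc_apply B x) c d"
    using nuclear_rep_add by blast
  from nuc_apply_Nuc[OF this] show ?thesis by (simp add: plus_nuclear_def)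
qed

lemma nuc_norm_le: "nuclear_rep (nuc_apply (A::'a nuclear)) a b \<Longrightarrow> norm A \<le> rep_mass a b"
  unfolding norm_nuclear_def
  by (rule cInf_lower) (auto intro!: bdd_belowI[of _ 0] simp: rep_mass_nonneg)

lemma nuc_norm_approx:
  fixes A :: "'a nuclear"
  assumes "\<epsilon> > 0"
  shows "\<exists>a b. nuclear_rep (nuc_apply A) a b \<and> rep_mass a b < norm A + \<epsilon>"
proof -
  have "{rep_mass a b |a b. nuclear_rep (nuc_apply A) a b} \<noteq> {}" using nuclear_has_rep[of A] by blast
  from cInf_lessD[OF this, of "norm A + \<epsilon>"] assms show ?thesis by (auto simp: norm_nuclear_def)
qed

lemma nuc_norm_leI:
  fixes A :: "'a nuclear"
  assumes "\<And>\<epsilon>. \<epsilon> > 0 \<Longrightarrow> \<exists>a b. nuclear_rep (nuc_apply A) a b \<and> rep_mass a b < K + \<epsilon>"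
  shows "norm A \<le> K"
proof (rule field_le_epsilon)
  fix \<epsilon> :: real assume "\<epsilon> > 0"
  then obtain a b where "nuclear_rep (nuc_apply A) a b" "rep_mass a b < K + \<epsilon>" using assms by blast
  thus "norm A \<le> K + \<epsilon>" using nuc_norm_le by fastforce
qed

lemma nuc_norm_nonneg: "0 \<le> norm (A::'a nuclear)"
  unfolding norm_nuclear_def using nuclear_has_rep[of A]
  by (intro cInf_greatest) (auto simp: rep_mass_nonneg)

lemma norm_nuc_apply_le: "norm (nuc_apply (A::'a nuclear) x) \<le> norm A * norm x"
proof -
  have *: "norm (nuc_apply A x) \<le> rep_mass a b * norm x" if "nuclear_rep (nuc_apply A) a b" for a b
  proof -
    have s: "summable (\<lambda>n. norm (a n) * norm (b n) * norm x)"
      using that by (auto simp: nuclear_rep_def intro: summable_mult2)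
    have s': "summable (\<lambda>n. norm (cinner (a n) x *\<^sub>C b n))"
      by (rule summable_comparison_test'[OF s]) (simp add: norm_rank_one_le[simplified])
    have "nuc_apply A x = (\<Sum>n. cinner (a n) x *\<^sub>C b n)"
      using that by (simp add: nuclear_rep_def sums_iff)
    also have "norm \<dots> \<le> (\<Sum>n. norm (cinner (a n) x *\<^sub>C b n))" by (rule summable_norm[OF s'])
    also have "\<dots> \<le> (\<Sum>n. norm (a n) * norm (b n) * norm x)"
      by (rule suminf_le[OF norm_rank_one_le s' s])
    also have "\<dots> = rep_mass a b * norm x"
      using that unfolding rep_mass_def nuclear_rep_def by (intro suminf_mult2[symmetric]) simp
    finally show ?thesis .
  qed
  show ?thesis
  proof (rule field_le_epsilon)
    fix \<epsilon> :: real assume e: "\<epsilon> > 0"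
    have e': "\<epsilon> / (norm x + 1) > 0" using e by (simp add: add_nonneg_pos)
    obtain a b where ab: "nuclear_rep (nuc_apply A) a b" "rep_mass a b < norm A + \<epsilon> / (norm x + 1)"
      using nuc_norm_approx[OF e'] by blast
    have "rep_mass a b * norm x \<le> (norm A + \<epsilon> / (norm x + 1)) * norm x"
      using ab(2) by (intro mult_right_mono) auto
    also have "\<dots> = norm A * norm x + \<epsilon> * (norm x / (norm x + 1))" by (simp add: algebra_simps)
    also have "\<epsilon> * (norm x / (norm x + 1)) \<le> \<epsilon> * 1"
      using e by (intro mult_left_mono) (auto simp: divide_simps add_nonneg_pos)
    finally show "norm (nuc_apply A x) \<le> norm A * norm x + \<epsilon>" using *[OF ab(1)] by simp
  qed
qed

lemma norm_nscale_le: "norm (nscale c (A::'a nuclear)) \<le> norm c * norm A"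
proof (rule field_le_epsilon)
  fix \<epsilon> :: real assume e: "\<epsilon> > 0"
  have e': "\<epsilon> / (norm c + 1) > 0" using e by (simp add: add_nonneg_pos)
  obtain a b where ab: "nuclear_rep (nuc_apply A) a b" "rep_mass a b < norm A + \<epsilon> / (norm c + 1)"
    using nuc_norm_approx[OF e'] by blast
  have "nuclear_rep (nuc_apply (nscale c A)) a (\<lambda>n. c *\<^sub>C b n)"
    using nuclear_rep_cscale(1)[OF ab(1), of c] by (simp add: nuclear_rep_def)
  hence "norm (nscale c A) \<le> rep_mass a (\<lambda>n. c *\<^sub>C b n)" by (rule nuc_norm_le)
  also have "\<dots> \<le> norm c * rep_mass a b" by (rule nuclear_rep_cscale(2)[OF ab(1)])
  also have "\<dots> \<le> norm c * (norm A + \<epsilon> / (norm c + 1))" using ab(2) by (intro mult_left_mono) auto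
  also have "\<dots> = norm c * norm A + \<epsilon> * (norm c / (norm c + 1))" by (simp add: algebra_simps)
  also have "\<epsilon> * (norm c / (norm c + 1)) \<le> \<epsilon> * 1"
    using e by (intro mult_left_mono) (auto simp: divide_simps add_nonneg_pos)
  finally show "norm (nscale c A) \<le> norm c * norm A + \<epsilon>" by simp
qed

lemma nuc_apply_uminus: "nuc_apply (- A :: 'a nuclear) x = - nuc_apply A x"
  by (simp add: uminus_nuclear_def scaleC_minus_left)

lemma nuc_apply_minus: "nuc_apply (A - B :: 'a nuclear) x = nuc_apply A x - nuc_apply B x"
  by (simp add: minus_nuclear_def nuc_apply_add nuc_apply_uminus)

lemma nuc_apply_scaleR: "nuc_apply (r *\<^sub>R A :: 'a nuclear) x = r *\<^sub>R nuc_apply A x"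
  by (simp add: scaleR_nuclear_def scaleC_of_real)

instance
proof
  fix A B C :: "'a nuclear" and r s :: real
  show "A + B + C = A + (B + C)" by (rule nuclear_eqI) (simp add: nuc_apply_add)
  show "A + B = B + A" by (rule nuclear_eqI) (simp add: nuc_apply_add)
  show "0 + A = A" by (rule nuclear_eqI) (simp add: nuc_apply_add nuc_apply_zero)
  show "- A + A = 0" by (rule nuclear_eqI) (simp add: nuc_apply_add nuc_apply_zero nuc_apply_uminus)
  show "A - B = A + - B" by (simp add: minus_nuclear_def)
  show "r *\<^sub>R (A + B) = r *\<^sub>R A + r *\<^sub>R B"
    by (rule nuclear_eqI) (simp add: nuc_apply_add nuc_apply_scaleR scaleR_right_distrib)
  show "(r + s) *\<^sub>R A = r *\<^sub>R A + s *\<^sub>R A"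
    by (rule nuclear_eqI) (simp add: nuc_apply_add nuc_apply_scaleR scaleR_left_distrib)
  show "r *\<^sub>R s *\<^sub>R A = (r * s) *\<^sub>R A" by (rule nuclear_eqI) (simp add: nuc_apply_scaleR)
  show "1 *\<^sub>R A = A" by (rule nuclear_eqI) (simp add: nuc_apply_scaleR)
  show "dist A B = norm (A - B)" by (rule dist_nuclear_def)
  show "sgn A = inverse (norm A) *\<^sub>R A" by (rule sgn_nuclear_def)
  show "uniformity = (INF e\<in>{0<..}. principal {(x :: 'a nuclear, y). dist x y < e})"
    by (rule uniformity_nuclear_def)
  show "open U \<longleftrightarrow> (\<forall>x\<in>U. eventually (\<lambda>(x', y). x' = x \<longrightarrow> y \<in> U) uniformity)" for U :: "'a nuclear set"
    by (rule open_nuclear_def)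
  show "norm A = 0 \<longleftrightarrow> A = 0"
  proof
    assume "norm A = 0"
    hence "nuc_apply A x = 0" for x using norm_nuc_apply_le[of A x] by simp
    thus "A = 0" by (intro nuclear_eqI) (simp add: nuc_apply_zero)
  next
    assume "A = 0"
    hence "nuclear_rep (nuc_apply A) (\<lambda>_. 0) (\<lambda>_. 0)" by (simp add: nuclear_rep_def nuc_apply_zero)
    hence "norm A \<le> 0" using nuc_norm_le[of A "\<lambda>_. 0" "\<lambda>_. 0"] by (simp add: rep_mass_def)
    thus "norm A = 0" using nuc_norm_nonneg[of A] by simp
  qed
  show "norm (A + B) \<le> norm A + norm B"
  proof (rule nuc_norm_leI)
    fix \<epsilon> :: real assume "\<epsilon> > 0"
    hence e: "\<epsilon> / 2 > 0" by simp
    obtain a b where ab: "nuclear_rep (nuc_apply A) a b" "rep_mass a b < norm A + \<epsilon> / 2"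
      using nuc_norm_approx[OF e] by blast
    obtain a' b' where ab': "nuclear_rep (nuc_apply B) a' b'" "rep_mass a' b' < norm B + \<epsilon> / 2"
      using nuc_norm_approx[OF e] by blast
    obtain c d where cd: "nuclear_rep (\<lambda>x. nuc_apply A x + nuc_apply B x) c d"
        "rep_mass c d = rep_mass a b + rep_mass a' b'"
      using nuclear_rep_add[OF ab(1) ab'(1)] by blast
    have "nuclear_rep (nuc_apply (A + B)) c d" using cd(1) by (simp add: nuclear_rep_def nuc_apply_add)
    moreover have "rep_mass c d < norm A + norm B + \<epsilon>" using cd(2) ab(2) ab'(2) by linarith
    ultimately show "\<exists>a b. nuclear_rep (nuc_apply (A + B)) a b \<and> rep_mass a b < norm A + norm B + \<epsilon>"
      by blast
  qed
  show "norm (r *\<^sub>R A) = \<bar>r\<bar> * norm A"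
  proof (cases "r = 0")
    case True
    have "r *\<^sub>R A = nscale 0 A" by (simp add: scaleR_nuclear_def True)
    hence "norm (r *\<^sub>R A) \<le> 0" using norm_nscale_le[of 0 A] by simp
    thus ?thesis using True nuc_norm_nonneg[of "r *\<^sub>R A"] by simp
  next
    case False
    have up: "norm (t *\<^sub>R B) \<le> \<bar>t\<bar> * norm B" for t and B :: "'a nuclear"
      using norm_nscale_le[of "complex_of_real t" B] by (simp add: scaleR_nuclear_def)
    have "inverse r *\<^sub>R r *\<^sub>R A = A" using False by (intro nuclear_eqI) (simp add: nuc_apply_scaleR)
    hence "norm A \<le> \<bar>inverse r\<bar> * norm (r *\<^sub>R A)" using up[of "inverse r" "r *\<^sub>R A"] by simp
    hence "\<bar>r\<bar> * norm A \<le> norm (r *\<^sub>R A)" using False by (simp add: field_simps abs_inverse)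
    thus ?thesis using up[of r A] by simp
  qed
qed

end

lemma bounded_linear_nuc_apply: "bounded_linear (\<lambda>A. nuc_apply A (x::'h::complex_hilbert))"
  by (rule bounded_linear_intro[of _ "norm x"])
     (simp_all add: nuc_apply_add nuc_apply_scaleR norm_nuc_apply_le)

lemma bounded_bilinear_nscale: "bounded_bilinear (nscale :: complex \<Rightarrow> 'h::complex_hilbert nuclear \<Rightarrow> 'h nuclear)"
proof
  show "\<exists>K. \<forall>c A. norm (nscale c (A :: 'h nuclear)) \<le> norm c * norm A * K"
    by (intro exI[of _ 1]) (simp add: norm_nscale_le)
qed (rule nuclear_eqI, simp add: nuc_apply_add nuc_apply_scaleR scaleC_add_left scaleC_add_right
      scaleC_scaleC scaleR_scaleC[where 'h='h] scaleR_conv_of_real mult.commute)+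

interpretation nscale: bounded_bilinear "nscale :: complex \<Rightarrow> 'h::complex_hilbert nuclear \<Rightarrow> 'h nuclear"
  by (rule bounded_bilinear_nscale)

text \<open>
  Representations of the terms that are optimal up to \<open>\<epsilon> / 2\<^sup>k\<^sup>+\<^sup>1\<close> are merged. The pointwise sum does not
  depend on \<open>\<epsilon>\<close>, so the norm estimate survives \<open>\<epsilon> \<rightarrow> 0\<close>.
\<close>

lemma nuclear_series_converges:
  fixes f :: "nat \<Rightarrow> 'h::complex_hilbert nuclear"
  assumes "summable (\<lambda>k. norm (f k))"
  shows "\<exists>S. (\<forall>x. (\<lambda>k. nuc_apply (f k) x) sums nuc_apply S x) \<and> norm S \<le> (\<Sum>k. norm (f k))"
proof -
  have ex: "\<exists>S. (\<forall>x. (\<lambda>k. nuc_apply (f k) x) sums nuc_apply S x) \<and> norm S \<le> (\<Sum>k. norm (f k)) + \<epsilon>"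
    if e: "\<epsilon> > 0" for \<epsilon>
  proof -
    have "\<exists>a b. nuclear_rep (nuc_apply (f k)) a b \<and> rep_mass a b < norm (f k) + \<epsilon> * (1/2) ^ Suc k" for k
      using e by (intro nuc_norm_approx) simp
    then obtain a b where ab: "\<And>k. nuclear_rep (nuc_apply (f k)) (a k) (b k)"
      "\<And>k. rep_mass (a k) (b k) < norm (f k) + \<epsilon> * (1/2) ^ Suc k" by metis
    have tot: "(\<lambda>k. norm (f k) + \<epsilon> * (1/2) ^ Suc k) sums ((\<Sum>k. norm (f k)) + \<epsilon> * 1)"
      by (intro sums_add summable_sums assms sums_mult power_half_series)
    have sm: "summable (\<lambda>k. rep_mass (a k) (b k))"
      using rep_mass_nonneg[OF ab(1)] ab(2)
      by (intro summable_comparison_test'[OF sums_summable[OF tot], of 0]) (simp add: less_imp_le)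
    obtain S a' b' where S: "\<And>x. (\<lambda>k. nuc_apply (f k) x) sums S x" "nuclear_rep S a' b'"
      "rep_mass a' b' = (\<Sum>k. rep_mass (a k) (b k))"
      using nuclear_rep_countable_sum[OF ab(1) summable_sums[OF sm]] by blast
    have NS: "nuc_apply (Nuc S) = S" by (rule nuc_apply_Nuc[OF S(2)])
    have "norm (Nuc S) \<le> (\<Sum>k. rep_mass (a k) (b k))" using nuc_norm_le[of "Nuc S" a' b'] S NS by simp
    also have "\<dots> \<le> (\<Sum>k. norm (f k) + \<epsilon> * (1/2) ^ Suc k)"
      by (rule suminf_le[OF less_imp_le[OF ab(2)] sm sums_summable[OF tot]])
    also have "\<dots> = (\<Sum>k. norm (f k)) + \<epsilon>" using tot by (simp add: sums_iff)
    finally show ?thesis using S(1) NS by (intro exI[of _ "Nuc S"]) simp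
  qed
  obtain S where S: "\<And>x. (\<lambda>k. nuc_apply (f k) x) sums nuc_apply S x" using ex[of 1] by auto
  have "norm S \<le> (\<Sum>k. norm (f k)) + \<epsilon>" if e: "\<epsilon> > 0" for \<epsilon>
  proof -
    obtain S' where S': "\<And>x. (\<lambda>k. nuc_apply (f k) x) sums nuc_apply S' x"
      "norm S' \<le> (\<Sum>k. norm (f k)) + \<epsilon>" using ex[OF e] by auto
    have "S = S'" by (rule nuclear_eqI) (rule sums_unique2[OF S S'(1)])
    thus ?thesis using S'(2) by simp
  qed
  hence "norm S \<le> (\<Sum>k. norm (f k))" by (rule field_le_epsilon)
  thus ?thesis using S by blast
qed

instance nuclear :: (complex_hilbert) banach
proof
  fix X :: "nat \<Rightarrow> 'a nuclear"
  assume X: "Cauchy X"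
  have step: "\<exists>n>m. \<forall>i\<ge>n. \<forall>j\<ge>n. norm (X i - X j) < (1/2) ^ k" for k m :: nat
  proof -
    have "\<exists>M. \<forall>i\<ge>M. \<forall>j\<ge>M. norm (X i - X j) < (1/2) ^ k" by (rule CauchyD[OF X]) simp
    then obtain M where M: "\<And>i j. i \<ge> M \<Longrightarrow> j \<ge> M \<Longrightarrow> norm (X i - X j) < (1/2) ^ k" by blast
    show ?thesis
    proof (intro exI[of _ "max M (Suc m)"] conjI allI impI)
      show "m < max M (Suc m)" by simp
      show "norm (X i - X j) < (1/2) ^ k" if "max M (Suc m) \<le> i" "max M (Suc m) \<le> j" for i j
        by (rule M) (use that in simp_all)
    qed
  qed
  \<comment> \<open>A subsequence with increments below a geometric sequence turns completeness into the convergence of an absolutely convergent series.\<close>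
  define r where "r = rec_nat (SOME n. \<forall>i\<ge>n. \<forall>j\<ge>n. norm (X i - X j) < (1/2) ^ 0)
    (\<lambda>k m. SOME n. n > m \<and> (\<forall>i\<ge>n. \<forall>j\<ge>n. norm (X i - X j) < (1/2) ^ Suc k))"
  have r0: "\<forall>i\<ge>r 0. \<forall>j\<ge>r 0. norm (X i - X j) < (1/2) ^ 0"
  proof -
    have "\<exists>n. \<forall>i\<ge>n. \<forall>j\<ge>n. norm (X i - X j) < (1/2) ^ 0"
      using step[where k=0 and m=0] by (elim exE conjE) (rule exI)
    from someI_ex[OF this] show ?thesis by (simp add: r_def)
  qed
  have rS: "r (Suc k) > r k \<and> (\<forall>i\<ge>r (Suc k). \<forall>j\<ge>r (Suc k). norm (X i - X j) < (1/2) ^ Suc k)" for k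
    using someI_ex[OF step[where k="Suc k" and m="r k"]] by (simp add: r_def)
  have mono: "strict_mono r" using rS by (simp add: strict_mono_Suc_iff)
  have close: "norm (X i - X j) < (1/2) ^ k" if "i \<ge> r k" "j \<ge> r k" for i j k
  proof (cases k)
    case 0 thus ?thesis using r0 that by blast
  next
    case (Suc l) thus ?thesis using rS[of l] that by blast
  qed
  define f where "f = (\<lambda>k. X (r (Suc k)) - X (r k))"
  have fle: "norm (f k) \<le> (1/2) ^ k" for k
    unfolding f_def using close[where i="r (Suc k)" and j="r k" and k=k] rS[of k] by (simp add: less_imp_le)
  have fs: "summable (\<lambda>k. norm (f (k + n)))" for n
  proof (rule summable_comparison_test')
    show "summable (\<lambda>k. (1/2::real) ^ n * (1/2) ^ k)" by (intro summable_mult summable_geometric) simp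
    show "norm (norm (f (k + n))) \<le> (1/2) ^ n * (1/2) ^ k" for k
      using fle[of "k + n"] by (simp add: power_add mult.commute)
  qed
  have tail: "(\<Sum>k. norm (f (k + n))) \<le> 2 * (1/2) ^ n" for n
  proof -
    have "(\<Sum>k. norm (f (k + n))) \<le> (\<Sum>k. (1/2) ^ n * (1/2) ^ k)"
    proof (rule suminf_le[OF _ fs])
      show "norm (f (k + n)) \<le> (1/2) ^ n * (1/2) ^ k" for k
        using fle[of "k + n"] by (simp add: power_add mult.commute)
    qed (intro summable_mult summable_geometric, simp)
    also have "\<dots> = (1/2) ^ n * 2" by (subst suminf_mult) (simp_all add: suminf_geometric summable_geometric)
    finally show ?thesis by simp
  qed
  have tele: "(\<Sum>k<n. f k) = X (r n) - X (r 0)" for n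
    unfolding f_def by (rule sum_lessThan_telescope)
  obtain S where S: "\<And>x. (\<lambda>k. nuc_apply (f k) x) sums nuc_apply S x"
    using nuclear_series_converges[OF fs[of 0]] by auto
  have est: "norm (X (r 0) + S - X (r n)) \<le> 2 * (1/2) ^ n" for n
  proof -
    obtain S' where S': "\<And>x. (\<lambda>k. nuc_apply (f (k + n)) x) sums nuc_apply S' x"
      "norm S' \<le> (\<Sum>k. norm (f (k + n)))"
      using nuclear_series_converges[OF fs[of n]] by auto
    have "X (r 0) + S - X (r n) = S'"
    proof (rule nuclear_eqI)
      fix x
      have "(\<lambda>k. nuc_apply (f (k + n)) x) sums (nuc_apply S x - (\<Sum>k<n. nuc_apply (f k) x))"
        by (rule sums_split_initial_segment[OF S])
      also have "(\<Sum>k<n. nuc_apply (f k) x) = nuc_apply (\<Sum>k<n. f k) x"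
        by (rule linear_sum[OF bounded_linear.linear[OF bounded_linear_nuc_apply], symmetric])
      finally have "nuc_apply S' x = nuc_apply S x - nuc_apply (X (r n) - X (r 0)) x"
        using sums_unique2[OF S'(1)] tele by simp
      thus "nuc_apply (X (r 0) + S - X (r n)) x = nuc_apply S' x"
        by (simp add: nuc_apply_add nuc_apply_minus)
    qed
    thus ?thesis using S'(2) tail[of n] by simp
  qed
  have "(\<lambda>n. 2 * (1/2::real) ^ n) \<longlonglongrightarrow> 2 * 0"
    by (intro tendsto_mult tendsto_const LIMSEQ_power_zero) simp
  hence "(\<lambda>n. X (r 0) + S - X (r n)) \<longlonglongrightarrow> 0"
    by (intro Lim_null_comparison[OF always_eventually, OF allI, OF est]) simp
  hence "(\<lambda>n. X (r 0) + S - (X (r 0) + S - X (r n))) \<longlonglongrightarrow> X (r 0) + S - 0"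
    by (intro tendsto_diff tendsto_const)
  hence "(X \<circ> r) \<longlonglongrightarrow> X (r 0) + S" by (simp add: o_def)
  hence "X \<longlonglongrightarrow> X (r 0) + S" by (rule Cauchy_converges_subseq[OF X mono])
  thus "convergent X" by (rule convergentI)
qed

section \<open>The trace as a bounded functional\<close>

definition ntrace :: "'h::complex_hilbert nuclear \<Rightarrow> complex" where
  "ntrace N = trace_on UNIV (nuc_apply N)"

text \<open>
  The bound comes from Bessel's inequality and is uniform over finite subsets of the basis. The trace is thereby a bounded functional and commutes with integrals
  of nuclear operators.
\<close>

lemma trace_partial_sums_bounded:
  fixes N :: "'h::complex_hilbert nuclear"
  assumes F: "finite F" "F \<subseteq> some_onb (UNIV :: 'h set)"
  shows "(\<Sum>e\<in>F. norm (cinner e (nuc_apply N e))) \<le> norm N"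
proof (rule field_le_epsilon)
  fix \<epsilon> :: real assume e: "\<epsilon> > 0"
  obtain a b where ab: "nuclear_rep (nuc_apply N) a b" "rep_mass a b < norm N + \<epsilon>"
    using nuc_norm_approx[OF e] by blast
  have sab: "summable (\<lambda>n. norm (a n) * norm (b n))" using ab(1) by (simp add: nuclear_rep_def)
  have le: "norm (cinner (a n) e) * norm (cinner e (b n)) \<le> norm (a n) * norm (b n)" if "e \<in> F" for n e
    using bessel_mixed[OF some_onb_orthonormal, of "{e}" "a n" "b n"] that F by auto
  have sF: "summable (\<lambda>n. norm (cinner (a n) e) * norm (cinner e (b n)))" if "e \<in> F" for e
    by (rule summable_comparison_test'[OF sab]) (use le[OF that] in simp)
  have one: "norm (cinner e (nuc_apply N e)) \<le> (\<Sum>n. norm (cinner (a n) e) * norm (cinner e (b n)))"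
    if "e \<in> F" for e
  proof -
    have "(\<lambda>n. cinner (a n) e *\<^sub>C b n) sums nuc_apply N e" using ab(1) by (simp add: nuclear_rep_def)
    from bounded_linear.sums[OF cinner.bounded_linear_right this, of e]
    have "(\<lambda>n. cinner (a n) e * cinner e (b n)) sums cinner e (nuc_apply N e)"
      by (simp add: cinner_scaleC_right)
    hence "cinner e (nuc_apply N e) = (\<Sum>n. cinner (a n) e * cinner e (b n))" by (simp add: sums_iff)
    also have "norm \<dots> \<le> (\<Sum>n. norm (cinner (a n) e * cinner e (b n)))"
      by (rule summable_norm) (use sF[OF that] in \<open>simp add: norm_mult\<close>)
    finally show ?thesis by (simp add: norm_mult)
  qed
  have "(\<Sum>e\<in>F. norm (cinner e (nuc_apply N e)))
        \<le> (\<Sum>e\<in>F. \<Sum>n. norm (cinner (a n) e) * norm (cinner e (b n)))"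
    by (rule sum_mono[OF one])
  also have "\<dots> = (\<Sum>n. \<Sum>e\<in>F. norm (cinner (a n) e) * norm (cinner e (b n)))"
    by (rule suminf_sum[symmetric]) (rule sF)
  also have "\<dots> \<le> rep_mass a b"
    unfolding rep_mass_def
    by (rule suminf_le[OF bessel_mixed[OF some_onb_orthonormal F] summable_sum[OF sF] sab])
  finally show "(\<Sum>e\<in>F. norm (cinner e (nuc_apply N e))) \<le> norm N + \<epsilon>" using ab(2) by linarith
qed

lemma trace_abs_summable:
  fixes N :: "'h::complex_hilbert nuclear"
  shows "(\<lambda>e. norm (cinner e (nuc_apply N e))) summable_on some_onb UNIV"
  by (rule nonneg_bdd_above_summable_on)
     (auto intro!: bdd_aboveI[of _ "norm N"] trace_partial_sums_bounded)

lemma norm_ntrace_le: "norm (ntrace N) \<le> norm N"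
proof -
  have "norm (ntrace N) \<le> (\<Sum>\<^sub>\<infinity>e\<in>some_onb UNIV. norm (cinner e (nuc_apply N e)))"
    unfolding ntrace_def trace_on_def by (rule norm_infsum_bound[OF trace_abs_summable])
  also have "\<dots> \<le> norm N"
    by (rule infsum_le_finite_sums[OF trace_abs_summable trace_partial_sums_bounded])
  finally show ?thesis .
qed

lemma ntrace_add: "ntrace (A + B) = ntrace A + ntrace B"
  unfolding ntrace_def trace_on_def
  by (simp add: nuc_apply_add cinner_add_right infsum_add abs_summable_summable[OF trace_abs_summable])

lemma ntrace_nscale: "ntrace (nscale c A) = c * ntrace A"
  unfolding ntrace_def trace_on_def
  by (simp add: cinner_scaleC_right infsum_cmult_right')

lemma bounded_linear_ntrace: "bounded_linear ntrace"
proof (rule bounded_linear_intro[of _ 1])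
  show "ntrace (r *\<^sub>R A) = r *\<^sub>R ntrace A" for r and A :: "'a nuclear"
    by (simp add: scaleR_nuclear_def ntrace_nscale scaleR_conv_of_real)
qed (simp_all add: ntrace_add norm_ntrace_le)

lemma nuclear_sandwich:
  fixes N :: "'h::complex_hilbert nuclear"
  assumes P: "bounded_clinear P" and adj: "\<And>x y. cinner x (Q y) = cinner (Q' x) y"
    and bP: "\<And>x. norm (P x) \<le> p * norm x" and bQ: "\<And>x. norm (Q' x) \<le> q * norm x"
    and pq: "0 \<le> p" "0 \<le> q"
  shows "\<exists>N'. (\<forall>x. nuc_apply N' x = P (nuc_apply N (Q x))) \<and> norm N' \<le> p * q * norm N"
proof -
  have rep: "nuclear_rep (\<lambda>x. P (nuc_apply N (Q x))) (\<lambda>n. Q' (a n)) (\<lambda>n. P (b n))"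
    "rep_mass (\<lambda>n. Q' (a n)) (\<lambda>n. P (b n)) \<le> p * q * rep_mass a b"
    if "nuclear_rep (nuc_apply N) a b" for a b
    using nuclear_rep_sandwich[OF that P adj bP bQ pq(1)] by auto
  obtain a0 b0 where "nuclear_rep (nuc_apply N) a0 b0" using nuclear_has_rep by blast
  from nuc_apply_Nuc[OF rep(1)[OF this]]
  have N': "nuc_apply (Nuc (\<lambda>x. P (nuc_apply N (Q x)))) = (\<lambda>x. P (nuc_apply N (Q x)))" .
  have "norm (Nuc (\<lambda>x. P (nuc_apply N (Q x)))) \<le> p * q * norm N + \<epsilon>" if e: "\<epsilon> > 0" for \<epsilon>
  proof -
    have e': "\<epsilon> / (p * q + 1) > 0" using e pq by (simp add: add_nonneg_pos)
    obtain a b where ab: "nuclear_rep (nuc_apply N) a b" "rep_mass a b < norm N + \<epsilon> / (p * q + 1)"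
      using nuc_norm_approx[OF e'] by blast
    have "norm (Nuc (\<lambda>x. P (nuc_apply N (Q x)))) \<le> rep_mass (\<lambda>n. Q' (a n)) (\<lambda>n. P (b n))"
      by (rule nuc_norm_le) (simp add: N' rep(1)[OF ab(1)])
    also have "\<dots> \<le> p * q * rep_mass a b" by (rule rep(2)[OF ab(1)])
    also have "\<dots> \<le> p * q * (norm N + \<epsilon> / (p * q + 1))"
      using ab(2) pq by (intro mult_left_mono) auto
    also have "\<dots> = p * q * norm N + \<epsilon> * ((p * q) / (p * q + 1))" by (simp add: algebra_simps)
    also have "\<epsilon> * ((p * q) / (p * q + 1)) \<le> \<epsilon> * 1"
      using e pq by (intro mult_left_mono) (auto simp: divide_simps add_nonneg_pos)
    finally show ?thesis by simp
  qed
  hence "norm (Nuc (\<lambda>x. P (nuc_apply N (Q x)))) \<le> p * q * norm N" by (rule field_le_epsilon)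
  thus ?thesis using N' by (intro exI[of _ "Nuc (\<lambda>x. P (nuc_apply N (Q x)))"]) simp
qed

section \<open>Resolvents of self-adjoint operators and of their squares\<close>

lemma bounded_clinear_resolvent: "z \<in> resolvent_set A \<Longrightarrow> bounded_clinear (resolvent A z)"
  by (simp add: resolvent_set_def)

lemma resolvent_linear:
  assumes "z \<in> resolvent_set A"
  shows "resolvent A z (x + y) = resolvent A z x + resolvent A z y"
    and "resolvent A z (x - y) = resolvent A z x - resolvent A z y"
    and "resolvent A z (c *\<^sub>C x) = c *\<^sub>C resolvent A z x"
    and "resolvent A z 0 = 0"
  using bounded_clinear_resolvent[OF assms]
  by (simp_all add: bounded_clinear_def bounded_linear.linear linear_add linear_diff linear_0)

lemma resolvent_graph: "z \<in> resolvent_set A \<Longrightarrow> (resolvent A z x, x + z *\<^sub>C resolvent A z x) \<in> A"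
  unfolding resolvent_def by (rule theI') (simp add: resolvent_set_def)

lemma resolvent_eqI:
  assumes "z \<in> resolvent_set A" "(y, x + z *\<^sub>C y) \<in> A"
  shows "resolvent A z x = y"
proof -
  have "\<exists>!y. (y, x + z *\<^sub>C y) \<in> A" using assms(1) by (simp add: resolvent_set_def)
  thus ?thesis using assms(2) resolvent_graph[OF assms(1), of x] by blast
qed

lemma resolvent_identity:
  assumes z: "z \<in> resolvent_set A" and w: "w \<in> resolvent_set A"
  shows "resolvent A z x - resolvent A w x = (z - w) *\<^sub>C resolvent A z (resolvent A w x)"
proof -
  let ?u = "resolvent A w x"
  have "(?u, (x + w *\<^sub>C ?u - z *\<^sub>C ?u) + z *\<^sub>C ?u) \<in> A" using resolvent_graph[OF w, of x] by simp
  from resolvent_eqI[OF z this]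
  have "resolvent A z x + (w *\<^sub>C resolvent A z ?u - z *\<^sub>C resolvent A z ?u) = ?u"
    by (simp add: resolvent_linear[OF z] add_diff_eq)
  thus ?thesis by (simp add: scaleC_diff_left algebra_simps)
qed

lemma resolvent_commute:
  assumes z: "z \<in> resolvent_set A" and w: "w \<in> resolvent_set A"
  shows "resolvent A z (resolvent A w x) = resolvent A w (resolvent A z x)"
proof (cases "z = w")
  case False
  have "(z - w) *\<^sub>C resolvent A z (resolvent A w x) = - ((w - z) *\<^sub>C resolvent A w (resolvent A z x))"
    by (simp flip: resolvent_identity[OF z w] resolvent_identity[OF w z])
  hence "(z - w) *\<^sub>C resolvent A z (resolvent A w x) = (z - w) *\<^sub>C resolvent A w (resolvent A z x)"
    by (simp flip: scaleC_minus_left)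
  hence "inverse (z - w) *\<^sub>C (z - w) *\<^sub>C resolvent A z (resolvent A w x) =
         inverse (z - w) *\<^sub>C (z - w) *\<^sub>C resolvent A w (resolvent A z x)" by simp
  thus ?thesis using False by (simp add: scaleC_scaleC)
qed simp

lemma resolvent_bound_ex:
  assumes "z \<in> resolvent_set A"
  shows "\<exists>K>0. \<forall>x. norm (resolvent A z x) \<le> K * norm x"
  using bounded_linear.pos_bounded[OF bounded_clinear_bounded_linear[OF bounded_clinear_resolvent[OF assms]]]
  by (simp add: mult.commute)

text \<open>
  In \<open>R(z) = R(w) + (z - w) R(w) R(z)\<close> the last term is at most half of \<open>R(z)\<close> when \<open>\<bar>z - w\<bar> \<le> 1 / (2 K)\<close>,
  and can be absorbed on the left.
\<close>

lemma resolvent_local_bound: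
  assumes w: "w \<in> resolvent_set A" and K: "K > 0" "\<And>x. norm (resolvent A w x) \<le> K * norm x"
    and z: "z \<in> resolvent_set A" "norm (z - w) \<le> 1 / (2 * K)"
  shows "norm (resolvent A z x) \<le> 2 * K * norm x"
proof -
  have "resolvent A z x = resolvent A w x + (z - w) *\<^sub>C resolvent A w (resolvent A z x)"
    using resolvent_identity[OF z(1) w, of x] resolvent_commute[OF z(1) w, of x] by (simp add: algebra_simps)
  hence "norm (resolvent A z x) \<le> norm (resolvent A w x) + norm ((z - w) *\<^sub>C resolvent A w (resolvent A z x))"
    by (metis norm_triangle_ineq)
  also have "\<dots> \<le> K * norm x + 1 / (2 * K) * (K * norm (resolvent A z x))"
    unfolding norm_scaleC using z(2) K by (intro add_mono mult_mono) auto
  also have "1 / (2 * K) * (K * norm (resolvent A z x)) = norm (resolvent A z x) / 2" using K(1) by simp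
  finally show ?thesis by linarith
qed

lemma resolvent_continuous_on: "continuous_on (resolvent_set A) (\<lambda>z. resolvent A z x)"
  unfolding continuous_on_def
proof
  fix w assume w: "w \<in> resolvent_set A"
  obtain K where K: "K > 0" "\<And>x. norm (resolvent A w x) \<le> K * norm x" using resolvent_bound_ex[OF w] by blast
  have "((\<lambda>z. resolvent A z x - resolvent A w x) \<longlongrightarrow> 0) (at w within resolvent_set A)"
  proof (rule Lim_null_comparison)
    have "\<forall>\<^sub>F z in at w within resolvent_set A. dist z w < 1 / (2 * K)"
      using K by (intro tendstoD tendsto_ident_at) auto
    moreover have "\<forall>\<^sub>F z in at w within resolvent_set A. z \<in> resolvent_set A"
      by (simp add: eventually_at_filter)
    ultimately show "\<forall>\<^sub>F z in at w within resolvent_set A.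
        norm (resolvent A z x - resolvent A w x) \<le> norm (z - w) * (2 * K * (K * norm x))"
    proof eventually_elim
      case (elim z)
      have "norm (resolvent A z (resolvent A w x)) \<le> 2 * K * norm (resolvent A w x)"
        using elim by (intro resolvent_local_bound[OF w K]) (auto simp: dist_norm)
      also have "\<dots> \<le> 2 * K * (K * norm x)" using K by (intro mult_left_mono) auto
      finally show ?case
        using resolvent_identity[OF elim(2) w, of x] by (simp add: mult_left_mono)
    qed
    have "((\<lambda>z. norm (z - w) * (2 * K * (K * norm x))) \<longlongrightarrow> norm (w - w) * (2 * K * (K * norm x)))
        (at w within resolvent_set A)"
      by (intro tendsto_intros)
    thus "((\<lambda>z. norm (z - w) * (2 * K * (K * norm x))) \<longlongrightarrow> 0) (at w within resolvent_set A)" by simp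
  qed
  thus "((\<lambda>z. resolvent A z x) \<longlongrightarrow> resolvent A w x) (at w within resolvent_set A)"
    by (rule LIM_zero_cancel)
qed

text \<open>
  The difference quotient of \<open>R\<close> at \<open>w\<close> is \<open>R(w) R(z)\<close> by the resolvent identity, which converges by the
  continuity of \<open>R\<close>.
\<close>

lemma resolvent_weakly_holomorphic:
  assumes U: "open U" "U \<subseteq> resolvent_set A"
  shows "(\<lambda>z. cinner y (resolvent A z x)) holomorphic_on U"
proof (rule holomorphic_onI)
  fix w assume wU: "w \<in> U"
  hence w: "w \<in> resolvent_set A" using U by blast
  have "((\<lambda>z. cinner y (resolvent A w (resolvent A z x))) \<longlongrightarrow> cinner y (resolvent A w (resolvent A w x))) (at w within U)"
  proof (intro bounded_linear.tendsto[OF cinner.bounded_linear_right]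
      bounded_linear.tendsto[OF bounded_clinear_bounded_linear[OF bounded_clinear_resolvent[OF w]]])
    show "((\<lambda>z. resolvent A z x) \<longlongrightarrow> resolvent A w x) (at w within U)"
      using continuous_on_subset[OF resolvent_continuous_on U(2)] wU by (auto simp: continuous_on_def)
  qed
  moreover have "\<forall>\<^sub>F z in at w within U. cinner y (resolvent A w (resolvent A z x)) =
      (cinner y (resolvent A z x) - cinner y (resolvent A w x)) / (z - w)"
    unfolding eventually_at_filter
  proof (rule always_eventually, intro allI impI)
    fix z assume z: "z \<noteq> w" "z \<in> U"
    hence zr: "z \<in> resolvent_set A" using U by blast
    have "cinner y (resolvent A z x) - cinner y (resolvent A w x) = (z - w) * cinner y (resolvent A w (resolvent A z x))"
      using resolvent_identity[OF zr w, of x] resolvent_commute[OF zr w, of x]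
      by (simp flip: cinner_diff_right add: cinner_scaleC_right)
    thus "cinner y (resolvent A w (resolvent A z x)) =
      (cinner y (resolvent A z x) - cinner y (resolvent A w x)) / (z - w)" using z by simp
  qed
  ultimately have "((\<lambda>z. (cinner y (resolvent A z x) - cinner y (resolvent A w x)) / (z - w))
      \<longlongrightarrow> cinner y (resolvent A w (resolvent A w x))) (at w within U)"
    by (rule Lim_transform_eventually)
  hence "((\<lambda>z. cinner y (resolvent A z x)) has_field_derivative cinner y (resolvent A w (resolvent A w x))) (at w within U)"
    by (simp add: has_field_derivative_iff)
  thus "(\<lambda>z. cinner y (resolvent A z x)) field_differentiable at w within U"
    by (auto simp: field_differentiable_def)
qed

lemma bounded_clinear_compose:
  "bounded_clinear S \<Longrightarrow> bounded_clinear T \<Longrightarrow> bounded_clinear (\<lambda>x. S (T x))"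
  by (simp add: bounded_clinear_def bounded_linear_compose)

text \<open>\<open>A\<^sup>2 - \<lambda>\<^sup>2 = (A - \<lambda>) (A + \<lambda>)\<close>, also as unbounded operators on their natural domains.\<close>

lemma resolvent_square:
  assumes A: "linear_operator A" and l: "l \<in> resolvent_set A" and ml: "- l \<in> resolvent_set A"
  shows "l\<^sup>2 \<in> resolvent_set (A O A)"
    and "resolvent (A O A) (l\<^sup>2) x = resolvent A l (resolvent A (- l) x)"
    and "(resolvent (A O A) (l\<^sup>2) x, resolvent A (- l) x + l *\<^sub>C resolvent (A O A) (l\<^sup>2) x) \<in> A"
proof -
  have add: "(x + x', y + y') \<in> A" if "(x, y) \<in> A" "(x', y') \<in> A" for x y x' y'
    using A that by (simp add: linear_operator_def)
  have sc: "(c *\<^sub>C x, c *\<^sub>C y) \<in> A" if "(x, y) \<in> A" for c x y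
    using A that by (simp add: linear_operator_def)
  define R where "R = (\<lambda>x. resolvent A l (resolvent A (- l) x))"
  have g1: "(R x, resolvent A (- l) x + l *\<^sub>C R x) \<in> A" for x
    unfolding R_def by (rule resolvent_graph[OF l])
  have g2: "(resolvent A (- l) x + l *\<^sub>C R x, x + l\<^sup>2 *\<^sub>C R x) \<in> A" for x
    using add[OF resolvent_graph[OF ml, of x] sc[OF g1[of x], of l]]
    by (simp add: scaleC_add_right scaleC_minus_left scaleC_scaleC power2_eq_square)
  have ex: "(R x, x + l\<^sup>2 *\<^sub>C R x) \<in> A O A" for x using g1 g2 by blast
  have un: "y = R x" if yA: "(y, x + l\<^sup>2 *\<^sub>C y) \<in> A O A" for x y
  proof -
    obtain w where w: "(y, w) \<in> A" "(w, x + l\<^sup>2 *\<^sub>C y) \<in> A"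
      using yA by (rule relcompEpair)
    have "(w + (- l) *\<^sub>C y, (x + l\<^sup>2 *\<^sub>C y) + (- l) *\<^sub>C w) \<in> A" by (rule add[OF w(2) sc[OF w(1)]])
    moreover have "(x + l\<^sup>2 *\<^sub>C y) + (- l) *\<^sub>C w = x + (- l) *\<^sub>C (w + (- l) *\<^sub>C y)"
      by (simp add: scaleC_diff_right scaleC_minus_left scaleC_scaleC power2_eq_square)
    ultimately have "resolvent A (- l) x = w + (- l) *\<^sub>C y"
      by (intro resolvent_eqI[OF ml]) (simp only:)
    hence "w = resolvent A (- l) x + l *\<^sub>C y" by (simp add: scaleC_minus_left)
    thus ?thesis unfolding R_def using w(1) by (intro resolvent_eqI[OF l, symmetric]) simp
  qed
  have Req: "resolvent (A O A) (l\<^sup>2) = R"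
    unfolding resolvent_def by (intro ext the_equality ex un)
  show "l\<^sup>2 \<in> resolvent_set (A O A)"
    unfolding resolvent_set_def mem_Collect_eq Req
  proof (intro conjI allI)
    show "\<exists>!y. (y, x + l\<^sup>2 *\<^sub>C y) \<in> A O A" for x using ex[of x] un by (rule ex1I)
    show "bounded_clinear R"
      unfolding R_def
      by (rule bounded_clinear_compose[OF bounded_clinear_resolvent[OF l] bounded_clinear_resolvent[OF ml]])
  qed
  show "resolvent (A O A) (l\<^sup>2) x = resolvent A l (resolvent A (- l) x)" by (simp add: Req R_def)
  show "(resolvent (A O A) (l\<^sup>2) x, resolvent A (- l) x + l *\<^sub>C resolvent (A O A) (l\<^sup>2) x) \<in> A"
    unfolding Req by (rule g1)
qed

lemma resolvent_square_partial_fractions: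
  assumes A: "linear_operator A" and l: "l \<in> resolvent_set A" and ml: "- l \<in> resolvent_set A" and "l \<noteq> 0"
  shows "resolvent (A O A) (l\<^sup>2) x = (1 / (2 * l)) *\<^sub>C (resolvent A l x - resolvent A (- l) x)"
    and "(resolvent (A O A) (l\<^sup>2) x, (1 / 2) *\<^sub>C (resolvent A l x + resolvent A (- l) x)) \<in> A"
proof -
  have *: "resolvent A l x - resolvent A (- l) x = (2 * l) *\<^sub>C resolvent (A O A) (l\<^sup>2) x"
    using resolvent_identity[OF l ml, of x] by (simp add: resolvent_square(2)[OF A l ml])
  thus "resolvent (A O A) (l\<^sup>2) x = (1 / (2 * l)) *\<^sub>C (resolvent A l x - resolvent A (- l) x)"
    using \<open>l \<noteq> 0\<close> by (simp add: scaleC_scaleC)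
  have "l *\<^sub>C resolvent (A O A) (l\<^sup>2) x = (1 / 2) *\<^sub>C (resolvent A l x - resolvent A (- l) x)"
    unfolding * by (simp add: scaleC_scaleC)
  moreover have "v + (1 / 2) *\<^sub>C (u - v) = (1 / 2) *\<^sub>C (u + v)" for u v :: 'a
  proof -
    have "v = (1 / 2) *\<^sub>C (v + v)" by (simp flip: scaleC_add_left add: scaleC_add_right)
    hence "v + (1 / 2) *\<^sub>C (u - v) = (1 / 2) *\<^sub>C ((v + v) + (u - v))"
      unfolding scaleC_add_right[of _ "v + v"] by simp
    thus ?thesis by (simp add: add.commute)
  qed
  ultimately show "(resolvent (A O A) (l\<^sup>2) x, (1 / 2) *\<^sub>C (resolvent A l x + resolvent A (- l) x)) \<in> A"
    using resolvent_square(3)[OF A l ml, of x] by metis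
qed

lemma self_adjoint_symmetric:
  assumes "self_adjoint A" "(x, w) \<in> A" "(y, z) \<in> A"
  shows "cinner w y = cinner x z"
proof -
  have "(y, z) \<in> adjoint_graph A" using assms by (simp add: self_adjoint_def)
  thus ?thesis using assms(2) unfolding adjoint_graph_def by blast
qed

lemma resolvent_adjoint:
  assumes sa: "self_adjoint A" and z: "z \<in> resolvent_set A" "cnj z \<in> resolvent_set A"
  shows "cinner a (resolvent A z x) = cinner (resolvent A (cnj z) a) x"
  using self_adjoint_symmetric[OF sa resolvent_graph[OF z(2), of a] resolvent_graph[OF z(1), of x]]
  by (simp add: cinner_add_left cinner_add_right cinner_scaleC_left cinner_scaleC_right)

text \<open>
  The imaginary part of \<open>\<langle>u, (A - it) u\<rangle>\<close> is \<open>-t \<parallel>u\<parallel>\<^sup>2\<close> because \<open>\<langle>u, A u\<rangle>\<close> is real.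
\<close>

lemma resolvent_imaginary_bound:
  assumes sa: "self_adjoint A" and z: "\<i> * complex_of_real t \<in> resolvent_set A" and "t \<noteq> 0"
  shows "norm (resolvent A (\<i> * complex_of_real t) x) \<le> (1 / \<bar>t\<bar>) * norm x"
proof -
  let ?u = "resolvent A (\<i> * complex_of_real t) x"
  have "cinner x ?u - \<i> * t * cinner ?u ?u = cinner ?u x + \<i> * t * cinner ?u ?u"
    using self_adjoint_symmetric[OF sa resolvent_graph[OF z, of x] resolvent_graph[OF z, of x]]
    by (simp add: cinner_add_left cinner_add_right cinner_scaleC_left cinner_scaleC_right)
  hence "2 * \<i> * complex_of_real t * cinner ?u ?u = cinner x ?u - cinner ?u x" by (simp add: algebra_simps)
  moreover have "norm (2 * \<i> * complex_of_real t * cinner ?u ?u) = 2 * \<bar>t\<bar> * (norm ?u)\<^sup>2"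
    by (simp add: cinner_same norm_mult norm_power)
  ultimately have "2 * \<bar>t\<bar> * (norm ?u)\<^sup>2 = norm (cinner x ?u - cinner ?u x)" by simp
  also have "\<dots> \<le> norm x * norm ?u + norm ?u * norm x"
    by (rule order_trans[OF norm_triangle_ineq4 add_mono[OF cauchy_schwarz cauchy_schwarz]])
  finally have "\<bar>t\<bar> * (norm ?u * norm ?u) \<le> norm x * norm ?u"
    by (simp add: power2_eq_square mult.commute)
  hence *: "(\<bar>t\<bar> * norm ?u) * norm ?u \<le> norm x * norm ?u" by (simp only: mult.assoc)
  show ?thesis
  proof (cases "norm ?u = 0")
    case False
    hence "\<bar>t\<bar> * norm ?u \<le> norm x" using * by (simp add: mult_le_cancel_right)
    thus ?thesis using \<open>t \<noteq> 0\<close> by (simp add: field_simps)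
  qed (simp add: zero_le_divide_iff)
qed

section \<open>The relative resolvent as a nuclear operator valued function\<close>

text \<open>
  The square roots of the points on the contours: a keyhole around the negative axis in the \<open>\<mu>\<close>-plane
  corresponds to the imaginary axis and a circle in the \<open>\<lambda>\<close>-plane, \<open>\<mu> = \<lambda>\<^sup>2\<close>. Negation enters through
  \<open>A\<^sup>2 - \<lambda>\<^sup>2 = (A - \<lambda>) (A + \<lambda>)\<close>, conjugation through adjoints of resolvents.
\<close>

definition axis_disc :: "real \<Rightarrow> complex set" where
  "axis_disc \<rho> = {z. Re z = 0 \<or> norm z < \<rho>}"

lemma axis_disc_closed: "z \<in> axis_disc \<rho> \<Longrightarrow> - z \<in> axis_disc \<rho>" "z \<in> axis_disc \<rho> \<Longrightarrow> cnj z \<in> axis_disc \<rho>"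
  by (auto simp: axis_disc_def)

locale nuclear_pair =
  fixes A\<^sub>1 A\<^sub>2 :: "'h::complex_hilbert graph" and \<rho> :: real
  assumes sa1: "self_adjoint A\<^sub>1" and sa2: "self_adjoint A\<^sub>2" and rho_pos: "\<rho> > 0"
    and res1: "axis_disc \<rho> \<subseteq> resolvent_set A\<^sub>1" and res2: "axis_disc \<rho> \<subseteq> resolvent_set A\<^sub>2"
    and diff_trace_class:
      "\<And>z. z \<in> axis_disc \<rho> \<Longrightarrow> trace_class_on UNIV (\<lambda>x. resolvent A\<^sub>1 z x - resolvent A\<^sub>2 z x)"
begin

definition rel_res :: "complex \<Rightarrow> 'h nuclear" where
  "rel_res z = Nuc (\<lambda>x. resolvent A\<^sub>1 z x - resolvent A\<^sub>2 z x)"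

lemma zero_in_axis_disc: "0 \<in> axis_disc \<rho>"
  by (simp add: axis_disc_def)

lemma nuc_apply_rel_res:
  "z \<in> axis_disc \<rho> \<Longrightarrow> nuc_apply (rel_res z) x = resolvent A\<^sub>1 z x - resolvent A\<^sub>2 z x"
  unfolding rel_res_def by (subst Nuc_inverse) (simp_all add: diff_trace_class)

lemma ntrace_rel_res: "z \<in> axis_disc \<rho> \<Longrightarrow> ntrace (rel_res z) = rel_resolvent_trace A\<^sub>1 A\<^sub>2 z"
proof -
  assume "z \<in> axis_disc \<rho>"
  hence "nuc_apply (rel_res z) = (\<lambda>x. resolvent A\<^sub>1 z x - resolvent A\<^sub>2 z x)"
    by (intro ext nuc_apply_rel_res)
  thus ?thesis by (simp add: ntrace_def rel_resolvent_trace_def)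
qed

text \<open>
  With \<open>h = z - w\<close>, \<open>R\<^sub>1(z) - R\<^sub>2(z) = (1 + h R\<^sub>1(z)) (R\<^sub>1(w) - R\<^sub>2(w)) (1 + h R\<^sub>2(z))\<close>. So the nuclear norm of
  the relative resolvent is controlled by operator norms of resolvents and its value at one point.
\<close>

lemma rel_res_diff_bound:
  assumes z: "z \<in> axis_disc \<rho>" and w: "w \<in> axis_disc \<rho>"
    and k1: "0 \<le> k1" "\<And>x. norm (resolvent A\<^sub>1 z x) \<le> k1 * norm x"
    and k2: "0 \<le> k2" "\<And>x. norm (resolvent A\<^sub>2 (cnj z) x) \<le> k2 * norm x"
  shows "norm (rel_res z - rel_res w) \<le>
    norm (z - w) * (k1 + k2 + norm (z - w) * (k1 * k2)) * norm (rel_res w)"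
proof -
  define h where "h = z - w"
  have z1: "z \<in> resolvent_set A\<^sub>1" and w1: "w \<in> resolvent_set A\<^sub>1" using z w res1 by auto
  have z2: "z \<in> resolvent_set A\<^sub>2" and w2: "w \<in> resolvent_set A\<^sub>2" using z w res2 by auto
  have cz: "cnj z \<in> resolvent_set A\<^sub>2" using axis_disc_closed(2)[OF z] res2 by auto
  have bid: "bounded_clinear (\<lambda>x::'h. x)" using bounded_clinear_cscale[of 1] by simp
  note b1 = bounded_clinear_resolvent[OF z1]
  note adj2 = resolvent_adjoint[OF sa2 z2 cz]
  have "\<exists>P. (\<forall>x. nuc_apply P x = resolvent A\<^sub>1 z (nuc_apply (rel_res w) x)) \<and>
      norm P \<le> k1 * 1 * norm (rel_res w)"
    by (rule nuclear_sandwich[where Q'="\<lambda>x. x", OF b1 refl k1(2) _ k1(1)]) simp_all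
  then obtain P where P: "\<And>x. nuc_apply P x = resolvent A\<^sub>1 z (nuc_apply (rel_res w) x)"
    "norm P \<le> k1 * 1 * norm (rel_res w)" by metis
  have "\<exists>Q. (\<forall>x. nuc_apply Q x = nuc_apply (rel_res w) (resolvent A\<^sub>2 z x)) \<and>
      norm Q \<le> 1 * k2 * norm (rel_res w)"
    by (rule nuclear_sandwich[OF bid adj2 _ k2(2) _ k2(1)]) simp_all
  then obtain Q where Q: "\<And>x. nuc_apply Q x = nuc_apply (rel_res w) (resolvent A\<^sub>2 z x)"
    "norm Q \<le> 1 * k2 * norm (rel_res w)" by metis
  have "\<exists>S. (\<forall>x. nuc_apply S x = resolvent A\<^sub>1 z (nuc_apply (rel_res w) (resolvent A\<^sub>2 z x))) \<and>
      norm S \<le> k1 * k2 * norm (rel_res w)"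
    by (rule nuclear_sandwich[OF b1 adj2 k1(2) k2(2) k1(1) k2(1)])
  then obtain S where S: "\<And>x. nuc_apply S x = resolvent A\<^sub>1 z (nuc_apply (rel_res w) (resolvent A\<^sub>2 z x))"
    "norm S \<le> k1 * k2 * norm (rel_res w)" by metis
  have "rel_res z - rel_res w = nscale h (P + Q + nscale h S)"
  proof (rule nuclear_eqI)
    fix x
    have e1: "resolvent A\<^sub>1 z y = resolvent A\<^sub>1 w y + h *\<^sub>C resolvent A\<^sub>1 z (resolvent A\<^sub>1 w y)" for y
      using resolvent_identity[OF z1 w1, of y] by (simp add: h_def algebra_simps)
    have e2: "resolvent A\<^sub>2 z x = resolvent A\<^sub>2 w x + h *\<^sub>C resolvent A\<^sub>2 w (resolvent A\<^sub>2 z x)"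
      using resolvent_identity[OF z2 w2, of x] resolvent_commute[OF z2 w2, of x]
      by (simp add: h_def algebra_simps)
    define u v p q where "u = resolvent A\<^sub>1 w x" and "v = resolvent A\<^sub>2 w x"
      and "p = resolvent A\<^sub>1 w (resolvent A\<^sub>2 z x)" and "q = resolvent A\<^sub>2 w (resolvent A\<^sub>2 z x)"
    define r where "r = resolvent A\<^sub>1 z"
    note lin = resolvent_linear[OF z1, folded r_def]
    have rz: "r (resolvent A\<^sub>2 z x) = p + h *\<^sub>C r p" using e1[of "resolvent A\<^sub>2 z x"] by (simp add: p_def r_def)
    have rz': "r (resolvent A\<^sub>2 z x) = r v + h *\<^sub>C r q"
      using arg_cong[OF e2, of r] by (simp only: lin v_def q_def)
    have d1: "r x - u = h *\<^sub>C r u"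
      unfolding r_def u_def by (rule iffD2[OF diff_eq_eq]) (use e1[of x] in \<open>simp only: add.commute\<close>)
    have d2: "resolvent A\<^sub>2 z x - v = h *\<^sub>C q"
      unfolding q_def v_def by (rule iffD2[OF diff_eq_eq]) (use e2 in \<open>simp only: add.commute\<close>)
    have "nuc_apply (nscale h (P + Q + nscale h S)) x = h *\<^sub>C (r (u - v) + (p - q) + h *\<^sub>C r (p - q))"
      by (simp add: nuc_apply_add P(1) Q(1) S(1) nuc_apply_rel_res[OF w] r_def u_def v_def p_def q_def)
    also have "\<dots> = h *\<^sub>C (r u + ((p + h *\<^sub>C r p) - (r v + h *\<^sub>C r q)) - q)"
      by (simp add: lin scaleC_diff_right algebra_simps)
    also have "\<dots> = h *\<^sub>C (r u - q)" using rz rz' by simp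
    also have "\<dots> = (r x - u) - (resolvent A\<^sub>2 z x - v)"
      by (simp only: d1 d2 scaleC_diff_right)
    also have "\<dots> = nuc_apply (rel_res z - rel_res w) x"
      by (simp add: nuc_apply_minus nuc_apply_rel_res[OF z] nuc_apply_rel_res[OF w] r_def u_def v_def)
    finally show "nuc_apply (rel_res z - rel_res w) x = nuc_apply (nscale h (P + Q + nscale h S)) x" ..
  qed
  also have "norm \<dots> \<le> norm h * norm (P + Q + nscale h S)" by (rule norm_nscale_le)
  also have "\<dots> \<le> norm h * ((k1 + k2 + norm h * (k1 * k2)) * norm (rel_res w))"
  proof (rule mult_left_mono)
    have "norm (nscale h S) \<le> norm h * (k1 * k2 * norm (rel_res w))"
      by (rule order_trans[OF norm_nscale_le mult_left_mono[OF S(2) norm_ge_zero]])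
    moreover have "norm (P + Q + nscale h S) \<le> norm P + norm Q + norm (nscale h S)"
      by (rule order_trans[OF norm_triangle_ineq add_right_mono[OF norm_triangle_ineq]])
    ultimately show "norm (P + Q + nscale h S) \<le> (k1 + k2 + norm h * (k1 * k2)) * norm (rel_res w)"
      using P(2) Q(2) by (simp add: algebra_simps)
  qed simp
  finally show ?thesis by (simp add: h_def mult.assoc)
qed

lemma rel_res_continuous: "continuous_on (axis_disc \<rho>) rel_res"
  unfolding continuous_on_def
proof
  fix w assume w: "w \<in> axis_disc \<rho>"
  have w1: "w \<in> resolvent_set A\<^sub>1" and w2: "cnj w \<in> resolvent_set A\<^sub>2"
    using w axis_disc_closed(2)[OF w] res1 res2 by auto
  obtain K1 where K1: "K1 > 0" "\<And>x. norm (resolvent A\<^sub>1 w x) \<le> K1 * norm x"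
    using resolvent_bound_ex[OF w1] by blast
  obtain K2 where K2: "K2 > 0" "\<And>x. norm (resolvent A\<^sub>2 (cnj w) x) \<le> K2 * norm x"
    using resolvent_bound_ex[OF w2] by blast
  let ?F = "at w within axis_disc \<rho>"
  let ?b = "\<lambda>z. norm (z - w) * (2 * K1 + 2 * K2 + norm (z - w) * (2 * K1 * (2 * K2))) * norm (rel_res w)"
  have "((\<lambda>z. rel_res z - rel_res w) \<longlongrightarrow> 0) ?F"
  proof (rule Lim_null_comparison)
    have p: "1 / (2 * K1) > 0" "1 / (2 * K2) > 0" using K1(1) K2(1) by simp_all
    have "\<forall>\<^sub>F z in ?F. dist z w < 1 / (2 * K1)" by (rule tendstoD[OF tendsto_ident_at p(1)])
    moreover have "\<forall>\<^sub>F z in ?F. dist z w < 1 / (2 * K2)" by (rule tendstoD[OF tendsto_ident_at p(2)])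
    moreover have "\<forall>\<^sub>F z in ?F. z \<in> axis_disc \<rho>" by (simp add: eventually_at_filter)
    ultimately show "\<forall>\<^sub>F z in ?F. norm (rel_res z - rel_res w) \<le> ?b z"
    proof eventually_elim
      case (elim z)
      have cz: "norm (cnj z - cnj w) \<le> 1 / (2 * K2)"
        using elim(2) by (simp add: dist_norm flip: complex_cnj_diff)
      show ?case
      proof (rule rel_res_diff_bound[OF elim(3) w])
        show "norm (resolvent A\<^sub>1 z x) \<le> 2 * K1 * norm x" for x
          using elim res1 by (intro resolvent_local_bound[OF w1 K1]) (auto simp: dist_norm)
        show "norm (resolvent A\<^sub>2 (cnj z) x) \<le> 2 * K2 * norm x" for x
          using axis_disc_closed(2)[OF elim(3)] res2 cz by (intro resolvent_local_bound[OF w2 K2]) auto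
      qed (use K1 K2 in auto)
    qed
    have "(?b \<longlongrightarrow> norm (w - w) * (2 * K1 + 2 * K2 + norm (w - w) * (2 * K1 * (2 * K2))) * norm (rel_res w)) ?F"
      by (intro tendsto_intros)
    thus "(?b \<longlongrightarrow> 0) ?F" by simp
  qed
  thus "(rel_res \<longlongrightarrow> rel_res w) ?F" by (rule LIM_zero_cancel)
qed

text \<open>
  Here \<open>\<bar>h\<bar> = \<bar>t\<bar>\<close> and both resolvents are bounded by \<open>1 / \<bar>t\<bar>\<close>, so the factors \<open>1 + h R\<close> stay bounded and
  the nuclear norm does not grow along the imaginary axis.
\<close>

lemma rel_res_axis_bound: "norm (rel_res (\<i> * complex_of_real t)) \<le> 4 * norm (rel_res 0)"
proof (cases "t = 0")
  case False
  have z: "\<i> * complex_of_real t \<in> axis_disc \<rho>" and cz: "cnj (\<i> * complex_of_real t) = \<i> * complex_of_real (- t)"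
    by (simp_all add: axis_disc_def)
  have k1: "norm (resolvent A\<^sub>1 (\<i> * complex_of_real t) x) \<le> (1 / \<bar>t\<bar>) * norm x" for x
    using z res1 False by (intro resolvent_imaginary_bound[OF sa1]) auto
  have k2: "norm (resolvent A\<^sub>2 (cnj (\<i> * complex_of_real t)) x) \<le> (1 / \<bar>t\<bar>) * norm x" for x
    using resolvent_imaginary_bound[OF sa2, of "- t" x] axis_disc_closed(2)[OF z] res2 False
    unfolding cz by auto
  have "norm (rel_res (\<i> * complex_of_real t) - rel_res 0) \<le>
    norm (\<i> * complex_of_real t - 0) * (1 / \<bar>t\<bar> + 1 / \<bar>t\<bar> + norm (\<i> * complex_of_real t - 0) * (1 / \<bar>t\<bar> * (1 / \<bar>t\<bar>))) * norm (rel_res 0)"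
    by (rule rel_res_diff_bound[OF z zero_in_axis_disc _ k1 _ k2]) simp_all
  also have "\<dots> = 3 * norm (rel_res 0)" using False by (simp add: norm_mult field_simps)
  finally show ?thesis using norm_triangle_sub[of "rel_res (\<i> * complex_of_real t)" "rel_res 0"] by linarith
qed simp

end

section \<open>Improper integrals with values in a Banach space\<close>

lemma improper_has_integral:
  fixes f :: "real \<Rightarrow> 'a::banach"
  assumes int: "\<And>R. f integrable_on {c..R}" and lim: "((\<lambda>R. integral {c..R} f) \<longlongrightarrow> I) at_top"
  shows "(f has_integral I) {c..}"
  unfolding has_integral_alt'[of f]
proof (intro conjI allI impI)
  have inter: "{c..} \<inter> cbox a b = {max c a..b}" for a b :: real by auto
  show "(\<lambda>x. if x \<in> {c..} then f x else 0) integrable_on cbox a b" for a b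
    unfolding integrable_restrict_Int inter
    by (rule integrable_subinterval_real[OF int[of b]]) auto
  fix e :: real assume "e > 0"
  then obtain N where N: "\<And>R. R \<ge> N \<Longrightarrow> dist (integral {c..R} f) I < e"
    using tendstoD[OF lim \<open>e > 0\<close>] unfolding eventually_at_top_linorder by metis
  define B where "B = max \<bar>c\<bar> \<bar>N\<bar> + 1"
  show "\<exists>B>0. \<forall>a b. ball 0 B \<subseteq> cbox a b \<longrightarrow>
          norm (integral (cbox a b) (\<lambda>x. if x \<in> {c..} then f x else 0) - I) < e"
  proof (intro exI[of _ B] conjI allI impI)
    show "B > 0" by (simp add: B_def)
    fix a b :: real assume sub: "ball 0 B \<subseteq> cbox a b"
    have "c \<in> ball 0 B" "N \<in> ball 0 B" by (simp_all add: B_def)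
    hence "c \<in> cbox a b" "N \<in> cbox a b" using sub by auto
    hence ab: "a \<le> c" "N \<le> b" by auto
    have "integral (cbox a b) (\<lambda>x. if x \<in> {c..} then f x else 0) = integral {c..b} f"
      unfolding integral_restrict_Int inter using ab by (simp add: max_def)
    thus "norm (integral (cbox a b) (\<lambda>x. if x \<in> {c..} then f x else 0) - I) < e"
      using N[OF ab(2)] by (simp add: dist_norm)
  qed
qed

text \<open>
  Convergence follows from the Cauchy criterion for the integrals over \<open>[c, R]\<close>. The tail estimate gives
  the local uniformity in parameters that holomorphy of Mellin transforms rests on.
\<close>

lemma power_dominated_improper_integral:
  fixes f :: "real \<Rightarrow> 'a::banach"
  assumes c: "c > 0" and p: "p > 1" and cont: "continuous_on {c..} f"
    and bnd: "\<And>t. t \<ge> c \<Longrightarrow> norm (f t) \<le> K * t powr (- p)"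
  shows "f integrable_on {c..}"
    and "\<And>R. R \<ge> c \<Longrightarrow> norm (integral {c..} f - integral {c..R} f) \<le> K * (R powr (1 - p) / (p - 1))"
proof -
  define G where "G = (\<lambda>R. integral {c..R} f)"
  define \<tau> where "\<tau> = (\<lambda>R. K * (R powr (1 - p) / (p - 1)))"
  have K: "K \<ge> 0"
  proof -
    have "0 \<le> K * c powr (- p)" using order_trans[OF norm_ge_zero bnd[of c]] by simp
    thus ?thesis using c by (simp add: zero_le_mult_iff)
  qed
  have int: "f integrable_on {a..b}" if "a \<ge> c" for a b
    using that by (intro integrable_continuous_interval continuous_on_subset[OF cont]) auto
  have dom: "((\<lambda>t. K * t powr (- p)) has_integral \<tau> R) {R..}" if "R \<ge> c" for R
    using has_integral_mult_right[OF has_integral_powr_to_inf[of "- p" R], of K] p c that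
    by (simp add: \<tau>_def divide_minus_right[symmetric] minus_divide_right)
  have step: "norm (G R' - G R) \<le> \<tau> R" if "c \<le> R" "R \<le> R'" for R R'
  proof -
    have "G R + integral {R..R'} f = G R'"
      unfolding G_def using that int by (intro Henstock_Kurzweil_Integration.integral_combine) auto
    hence "G R' - G R = integral {R..R'} f" by (simp add: algebra_simps)
    also have "norm \<dots> \<le> integral {R..R'} (\<lambda>t. K * t powr (- p))"
    proof (rule integral_norm_bound_integral[OF int])
      show "(\<lambda>t. K * t powr (- p)) integrable_on {R..R'}"
        using that c by (intro integrable_continuous_interval continuous_intros) auto
      show "norm (f t) \<le> K * t powr (- p)" if "t \<in> {R..R'}" for t
        using bnd that \<open>c \<le> R\<close> by auto
    qed (use that in auto)
    also have "\<dots> \<le> integral {R..} (\<lambda>t. K * t powr (- p))"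
    proof (rule integral_subset_le)
      show "(\<lambda>t. K * t powr (- p)) integrable_on {R..R'}"
        using that c by (intro integrable_continuous_interval continuous_intros) auto
      show "(\<lambda>t. K * t powr (- p)) integrable_on {R..}"
        using dom[OF that(1)] by (rule has_integral_integrable)
    qed (use K in auto)
    also have "\<dots> = \<tau> R" using dom[OF that(1)] by (rule integral_unique)
    finally show ?thesis .
  qed
  have tau0: "(\<tau> \<longlongrightarrow> 0) at_top"
  proof -
    have "((\<lambda>R::real. R powr (1 - p)) \<longlongrightarrow> 0) at_top"
      using p by (intro tendsto_neg_powr filterlim_ident) auto
    from tendsto_mult[OF tendsto_const[of K] tendsto_divide[OF this tendsto_const[of "p - 1"]]]
    show ?thesis using p by (simp add: \<tau>_def)
  qed
  define X where "X = (\<lambda>n::nat. G (c + real n))"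
  have seq: "filterlim (\<lambda>n::nat. c + real n) at_top sequentially"
    by (rule filterlim_tendsto_add_at_top[OF tendsto_const filterlim_real_sequentially])
  have "Cauchy X"
  proof (rule metric_CauchyI)
    fix e :: real assume "e > 0"
    have "((\<lambda>n. \<tau> (c + real n)) \<longlonglongrightarrow> 0)" by (rule filterlim_compose[OF tau0 seq])
    hence "\<forall>\<^sub>F n in sequentially. dist (\<tau> (c + real n)) 0 < e / 2" by (rule tendstoD) (use \<open>e > 0\<close> in simp)
    then obtain M where M: "\<bar>\<tau> (c + real M)\<bar> < e / 2"
      unfolding eventually_sequentially by auto
    have near: "dist (X n) (X M) < e / 2" if "n \<ge> M" for n
      using step[of "c + real M" "c + real n"] M that by (simp add: X_def dist_norm)
    show "\<exists>M. \<forall>m\<ge>M. \<forall>n\<ge>M. dist (X m) (X n) < e"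
      by (intro exI[of _ M] allI impI dist_triangle_half_l[OF near near])
  qed
  then obtain I where I: "X \<longlonglongrightarrow> I" using Cauchy_convergent convergentD by blast
  have est: "norm (I - G R) \<le> \<tau> R" if R: "R \<ge> c" for R
  proof (rule Lim_norm_ubound[of sequentially])
    show "(\<lambda>n. X n - G R) \<longlonglongrightarrow> I - G R" by (intro tendsto_diff I tendsto_const)
    have "\<forall>\<^sub>F n in sequentially. c + real n \<ge> R" using seq unfolding filterlim_at_top by blast
    thus "\<forall>\<^sub>F n in sequentially. norm (X n - G R) \<le> \<tau> R"
      by eventually_elim (use step[OF R] in \<open>simp add: X_def\<close>)
  qed simp
  have "((\<lambda>R. G R - I) \<longlongrightarrow> 0) at_top"
  proof (rule Lim_null_comparison[OF _ tau0])
    show "\<forall>\<^sub>F R in at_top. norm (G R - I) \<le> \<tau> R"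
      using eventually_ge_at_top[of c] by eventually_elim (use est norm_minus_commute in metis)
  qed
  hence "(G \<longlongrightarrow> I) at_top" by (rule LIM_zero_cancel)
  hence "(f has_integral I) {c..}"
    unfolding G_def by (intro improper_has_integral) (use int in auto)
  thus "f integrable_on {c..}"
    and "\<And>R. R \<ge> c \<Longrightarrow> norm (integral {c..} f - integral {c..R} f) \<le> K * (R powr (1 - p) / (p - 1))"
    using est by (auto simp: integrable_on_def integral_unique G_def \<tau>_def)
qed

lemma half_line_integral_split:
  fixes f :: "real \<Rightarrow> 'a::banach"
  assumes "d \<le> d'" "f integrable_on {d..d'}" "f integrable_on {d'..}"
  shows "integral {d..} f = integral {d..d'} f + integral {d'..} f"
proof -
  have "(f has_integral (integral {d..d'} f + integral {d'..} f)) ({d..d'} \<union> {d'..})"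
  proof (rule has_integral_Un)
    have "{d..d'} \<inter> {d'..} = {d'}" using assms(1) by auto
    thus "negligible ({d..d'} \<inter> {d'..})" by simp
  qed (use assms in \<open>auto simp: integrable_integral\<close>)
  moreover have "{d..d'} \<union> {d'..} = {d..}" using assms(1) by auto
  ultimately show ?thesis by (simp add: integral_unique)
qed

section \<open>The keyhole contour\<close>

text \<open>
  The contour integral behind complex powers with the cut along the negative axis, for functions
  valued in any Banach space with a complex scalar multiplication \<open>sm\<close>. It is used for vectors, for
  nuclear operators and for complex numbers, the three being linked by linear maps.
\<close>

definition ray_integrand ::
  "(complex \<Rightarrow> 'b \<Rightarrow> 'b) \<Rightarrow> complex \<Rightarrow> (complex \<Rightarrow> 'b) \<Rightarrow> real \<Rightarrow> real \<Rightarrow> 'b" where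
  "ray_integrand sm s G \<theta> r =
     sm (cis \<theta>) (sm (exp (- s * (complex_of_real (ln r) + \<i> * complex_of_real \<theta>))) (G (complex_of_real r * cis \<theta>)))"

definition circle_integrand ::
  "(complex \<Rightarrow> 'b \<Rightarrow> 'b) \<Rightarrow> complex \<Rightarrow> (complex \<Rightarrow> 'b) \<Rightarrow> real \<Rightarrow> real \<Rightarrow> 'b" where
  "circle_integrand sm s G d \<phi> =
     sm (\<i> * complex_of_real d * cis \<phi>)
       (sm (exp (- s * (complex_of_real (ln d) + \<i> * complex_of_real \<phi>))) (G (complex_of_real d * cis \<phi>)))"

definition keyhole ::
  "(complex \<Rightarrow> 'b \<Rightarrow> 'b) \<Rightarrow> real \<Rightarrow> complex \<Rightarrow> (complex \<Rightarrow> 'b::banach) \<Rightarrow> 'b" where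
  "keyhole sm d s G = sm (\<i> / (2 * complex_of_real pi))
     (- integral {d..} (ray_integrand sm s G pi)
      - integral {- pi..pi} (circle_integrand sm s G d)
      + integral {d..} (ray_integrand sm s G (- pi)))"

text \<open>
  Boundedness along the ray makes the integrals converge for \<open>Re s > 1\<close>. Identities between
  meromorphic continuations only have to be checked for large \<open>Re s\<close>, so \<open>Re s \<ge> 2\<close> is assumed below.
\<close>

definition keyhole_admissible :: "real \<Rightarrow> (complex \<Rightarrow> 'b::banach) \<Rightarrow> bool" where
  "keyhole_admissible d G \<longleftrightarrow> d > 0 \<and> continuous_on {d..} (\<lambda>r. G (- complex_of_real r)) \<and>
     continuous_on {- pi..pi} (\<lambda>\<phi>. G (complex_of_real d * cis \<phi>)) \<and>
     (\<exists>K. \<forall>r\<ge>d. norm (G (- complex_of_real r)) \<le> K)"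

lemma cis_minus_pi [simp]: "cis (- pi) = -1"
  by (simp add: complex_eq_iff)

lemma norm_exp_log_le:
  assumes "0 < d" "d \<le> r" "2 \<le> Re s" "\<bar>\<theta>\<bar> \<le> pi"
  shows "norm (exp (- s * (complex_of_real (ln r) + \<i> * complex_of_real \<theta>)))
         \<le> exp (\<bar>Im s\<bar> * pi) * d powr (2 - Re s) * r powr (- 2)"
proof -
  have "norm (exp (- s * (complex_of_real (ln r) + \<i> * complex_of_real \<theta>))) = exp (Im s * \<theta>) * r powr (- Re s)"
    using assms by (simp add: powr_def flip: exp_add)
  also have "\<dots> \<le> exp (\<bar>Im s\<bar> * pi) * (d powr (2 - Re s) * r powr (- 2))"
  proof (rule mult_mono)
    have "Im s * \<theta> \<le> \<bar>Im s\<bar> * \<bar>\<theta>\<bar>" by (metis abs_ge_self abs_mult)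
    also have "\<dots> \<le> \<bar>Im s\<bar> * pi" using assms by (intro mult_left_mono) auto
    finally show "exp (Im s * \<theta>) \<le> exp (\<bar>Im s\<bar> * pi)" by simp
    have "r powr (- Re s) = r powr (2 - Re s) * r powr (- 2)" by (simp flip: powr_add)
    also have "\<dots> \<le> d powr (2 - Re s) * r powr (- 2)"
      using assms by (intro mult_right_mono powr_mono2') auto
    finally show "r powr (- Re s) \<le> d powr (2 - Re s) * r powr (- 2)" .
  qed auto
  finally show ?thesis by (simp add: mult.assoc)
qed

lemma keyhole_integrable:
  assumes sm: "bounded_bilinear sm" and G: "keyhole_admissible d G" and s: "2 \<le> Re s"
  shows "ray_integrand sm s G pi integrable_on {d..}"
    and "ray_integrand sm s G (- pi) integrable_on {d..}"
    and "circle_integrand sm s G d integrable_on {- pi..pi}"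
proof -
  have d: "d > 0" and cr: "continuous_on {d..} (\<lambda>r. G (- complex_of_real r))"
    and cc: "continuous_on {- pi..pi} (\<lambda>\<phi>. G (complex_of_real d * cis \<phi>))"
    using G by (simp_all add: keyhole_admissible_def)
  obtain K where K: "\<And>r. r \<ge> d \<Longrightarrow> norm (G (- complex_of_real r)) \<le> K"
    using G by (auto simp: keyhole_admissible_def)
  obtain B where B: "B > 0" "\<And>a b. norm (sm a b) \<le> norm a * norm b * B"
    using bounded_bilinear.pos_bounded[OF sm] by auto
  have ray: "ray_integrand sm s G \<theta> integrable_on {d..}" if th: "\<bar>\<theta>\<bar> \<le> pi" "cis \<theta> = -1" for \<theta>
  proof (rule power_dominated_improper_integral(1)[OF d, where p=2])
    define C where "C = exp (\<bar>Im s\<bar> * pi) * d powr (2 - Re s)"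
    have C: "C \<ge> 0" by (simp add: C_def)
    show "continuous_on {d..} (ray_integrand sm s G \<theta>)"
      unfolding ray_integrand_def th using d cr
      by (intro bounded_bilinear.continuous_on[OF sm] continuous_intros) auto
    show "norm (ray_integrand sm s G \<theta> r) \<le> (C * K * B * B) * r powr (- 2)" if r: "r \<ge> d" for r
    proof -
      have K0: "K \<ge> 0" using order_trans[OF norm_ge_zero K[OF r]] .
      have e: "norm (exp (- s * (complex_of_real (ln r) + \<i> * complex_of_real \<theta>))) \<le> C * r powr (- 2)"
        unfolding C_def by (rule norm_exp_log_le[OF d r s th(1)])
      have "norm (ray_integrand sm s G \<theta> r) \<le> norm (sm (exp (- s * (complex_of_real (ln r) + \<i> * complex_of_real \<theta>))) (G (- complex_of_real r))) * B"
        unfolding ray_integrand_def using B(2)[of "cis \<theta>"] by (simp add: th)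
      also have "\<dots> \<le> (norm (exp (- s * (complex_of_real (ln r) + \<i> * complex_of_real \<theta>))) * norm (G (- complex_of_real r)) * B) * B"
        using B(1) by (intro mult_right_mono B(2)) auto
      also have "\<dots> \<le> ((C * r powr (- 2)) * K * B) * B"
        using B(1) K[OF r] K0 C by (intro mult_right_mono mult_mono[OF e]) auto
      finally show ?thesis by (simp add: mult_ac)
    qed
  qed simp
  show "ray_integrand sm s G pi integrable_on {d..}" by (rule ray) auto
  show "ray_integrand sm s G (- pi) integrable_on {d..}" by (rule ray) auto
  show "circle_integrand sm s G d integrable_on {- pi..pi}"
    unfolding circle_integrand_def using cc
    by (intro integrable_continuous_interval bounded_bilinear.continuous_on[OF sm] continuous_intros)
qed

lemma keyhole_linear:
  assumes sm: "bounded_bilinear sm" and G: "keyhole_admissible d G" and s: "2 \<le> Re s"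
    and f: "bounded_linear f" and hom: "\<And>c v. f (sm c v) = sm' c (f v)"
  shows "f (keyhole sm d s G) = keyhole sm' d s (\<lambda>\<mu>. f (G \<mu>))"
proof -
  note int = keyhole_integrable[OF sm G s]
  have ray: "f \<circ> ray_integrand sm s G \<theta> = ray_integrand sm' s (\<lambda>\<mu>. f (G \<mu>)) \<theta>" for \<theta>
    by (rule ext) (simp add: ray_integrand_def hom)
  have circ: "f \<circ> circle_integrand sm s G d = circle_integrand sm' s (\<lambda>\<mu>. f (G \<mu>)) d"
    by (rule ext) (simp add: circle_integrand_def hom)
  note l = bounded_linear.linear[OF f]
  show ?thesis
    unfolding keyhole_def hom linear_add[OF l] linear_diff[OF l] linear_neg[OF l]
    by (simp only: integral_linear[OF int(1) f, symmetric] integral_linear[OF int(2) f, symmetric]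
          integral_linear[OF int(3) f, symmetric] ray circ)
qed

lemma keyhole_diff:
  assumes sm: "bounded_bilinear sm" and G: "keyhole_admissible d G" and G': "keyhole_admissible d G'"
    and s: "2 \<le> Re s"
  shows "keyhole sm d s G - keyhole sm d s G' = keyhole sm d s (\<lambda>\<mu>. G \<mu> - G' \<mu>)"
proof -
  note int = keyhole_integrable[OF sm G s] and int' = keyhole_integrable[OF sm G' s]
  interpret sm: bounded_bilinear sm by (rule sm)
  have ray: "ray_integrand sm s (\<lambda>\<mu>. G \<mu> - G' \<mu>) \<theta> = (\<lambda>r. ray_integrand sm s G \<theta> r - ray_integrand sm s G' \<theta> r)" for \<theta>
    by (rule ext) (simp add: ray_integrand_def sm.diff_right)
  have circ: "circle_integrand sm s (\<lambda>\<mu>. G \<mu> - G' \<mu>) d = (\<lambda>\<phi>. circle_integrand sm s G d \<phi> - circle_integrand sm s G' d \<phi>)"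
    by (rule ext) (simp add: circle_integrand_def sm.diff_right)
  show ?thesis
    unfolding keyhole_def ray circ integral_diff[OF int(1) int'(1)] integral_diff[OF int(2) int'(2)]
      integral_diff[OF int(3) int'(3)] sm.diff_right[symmetric]
    by (rule arg_cong[where f="sm _"]) simp
qed

lemma keyhole_cong:
  assumes "\<And>r. r \<ge> d \<Longrightarrow> G (- complex_of_real r) = G' (- complex_of_real r)"
    and "\<And>\<phi>. \<phi> \<in> {- pi..pi} \<Longrightarrow> G (complex_of_real d * cis \<phi>) = G' (complex_of_real d * cis \<phi>)"
  shows "keyhole sm d s G = keyhole sm d s G'"
proof -
  have "integral {d..} (ray_integrand sm s G pi) = integral {d..} (ray_integrand sm s G' pi)"
    by (rule integral_cong) (simp add: ray_integrand_def assms(1))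
  moreover have "integral {d..} (ray_integrand sm s G (- pi)) = integral {d..} (ray_integrand sm s G' (- pi))"
    by (rule integral_cong) (simp add: ray_integrand_def assms(1))
  moreover have "integral {- pi..pi} (circle_integrand sm s G d) = integral {- pi..pi} (circle_integrand sm s G' d)"
    by (rule integral_cong) (simp add: circle_integrand_def assms(2))
  ultimately show ?thesis by (simp add: keyhole_def)
qed

text \<open>
  In the coordinate \<open>w = log \<mu>\<close> the two contours differ by the boundary of a rectangle on which the
  integrand \<open>e\<^sup>(\<^sup>1\<^sup>-\<^sup>s\<^sup>)\<^sup>w g(e\<^sup>w)\<close> has a primitive; all pieces are increments of that primitive.
\<close>

lemma keyhole_radius_independent:
  fixes g :: "complex \<Rightarrow> complex"
  assumes d: "d \<le> d'" and cont: "continuous_on (cball 0 d') g" and hol: "g holomorphic_on ball 0 d'"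
    and G: "keyhole_admissible d g" and G': "keyhole_admissible d' g" and s: "2 \<le> Re s"
  shows "keyhole (*) d s g = keyhole (*) d' s g"
proof -
  note bb = bounded_bilinear_mult[where 'a=complex]
  note int = keyhole_integrable[OF bb G s] and int' = keyhole_integrable[OF bb G' s]
  have d0: "d > 0" and d0': "d' > 0" using G G' by (simp_all add: keyhole_admissible_def)
  define v where "v = (\<lambda>w. exp (w - s * w) * g (exp w))"
  define S where "S = {w. Re w \<le> ln d'}"
  have expS: "exp w \<in> cball 0 d'" if "w \<in> S" for w
  proof -
    have "exp (Re w) \<le> exp (ln d')" using that by (simp add: S_def)
    thus ?thesis using d0' by simp
  qed
  have intS: "exp w \<in> ball 0 d'" if "w \<in> interior S" for w
  proof -
    have "interior S = {w. Re w < ln d'}" using interior_halfspace_le[of "1::complex" "ln d'"] by (simp add: S_def)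
    hence "exp (Re w) < exp (ln d')" using that by simp
    thus ?thesis using d0' by simp
  qed
  have contv: "continuous_on S v"
    unfolding v_def by (intro continuous_intros continuous_on_compose2[OF cont]) (use expS in auto)
  have fd: "v field_differentiable at w" if "w \<in> interior S - {}" for w
  proof -
    have "(\<lambda>w. exp (w - s * w) * g (exp w)) holomorphic_on interior S"
      by (intro holomorphic_intros holomorphic_on_compose_gen[OF _ hol, unfolded o_def]) (use intS in auto)
    thus ?thesis
      unfolding v_def using that by (intro holomorphic_on_imp_differentiable_at[OF _ open_interior]) auto
  qed
  have conv: "convex S" unfolding S_def by (rule convex_halfspace_Re_le)
  obtain V where V: "\<And>w. w \<in> S \<Longrightarrow> (V has_field_derivative v w) (at w within S)"
    using holomorphic_convex_primitive[OF conv _ contv fd] by blast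
  have ray: "(ray_integrand (*) s g \<theta> has_integral
      (V (complex_of_real (ln d') + \<i> * complex_of_real \<theta>) - V (complex_of_real (ln d) + \<i> * complex_of_real \<theta>))) {d..d'}"
    if "cis \<theta> = -1" for \<theta>
  proof -
    define \<gamma> where "\<gamma> = (\<lambda>r::real. complex_of_real (ln r) + \<i> * complex_of_real \<theta>)"
    have "(ray_integrand (*) s g \<theta> has_integral ((V \<circ> \<gamma>) d' - (V \<circ> \<gamma>) d)) {d..d'}"
    proof (rule fundamental_theorem_of_calculus[OF d])
      fix r assume r: "r \<in> {d..d'}"
      hence r0: "r > 0" using d0 by auto
      have "\<gamma> ` {d..d'} \<subseteq> S" using d0 by (auto simp: S_def \<gamma>_def)
      hence DV: "(V has_field_derivative v (\<gamma> r)) (at (\<gamma> r) within \<gamma> ` {d..d'})"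
        by (rule DERIV_subset[OF V, rotated]) (use r d0 in \<open>auto simp: S_def \<gamma>_def\<close>)
      have "((\<lambda>r. complex_of_real (ln r)) has_vector_derivative complex_of_real (inverse r)) (at r within {d..d'})"
        using r0 by (intro has_vector_derivative_of_real)
          (auto intro!: derivative_eq_intros simp: has_real_derivative_iff_has_vector_derivative[symmetric] inverse_eq_divide)
      hence "(\<gamma> has_vector_derivative (complex_of_real (inverse r) + 0)) (at r within {d..d'})"
        unfolding \<gamma>_def by (intro has_vector_derivative_add has_vector_derivative_const)
      from field_vector_diff_chain_within[OF this DV]
      have VD: "((V \<circ> \<gamma>) has_vector_derivative complex_of_real (inverse r) * v (\<gamma> r)) (at r within {d..d'})" by simp
      have gr: "complex_of_real (ln r) + \<i> * complex_of_real \<theta> = \<gamma> r" by (simp add: \<gamma>_def)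
      have "exp (\<gamma> r) = complex_of_real r * cis \<theta>"
        using r0 by (simp add: \<gamma>_def exp_add cis_conv_exp exp_of_real)
      hence eq: "complex_of_real (inverse r) * v (\<gamma> r) = ray_integrand (*) s g \<theta> r"
        using r0 by (simp add: v_def ray_integrand_def exp_diff exp_minus gr divide_simps mult.assoc)
      show "((V \<circ> \<gamma>) has_vector_derivative ray_integrand (*) s g \<theta> r) (at r within {d..d'})"
        using VD unfolding eq .
    qed
    thus ?thesis by (simp add: \<gamma>_def)
  qed
  have circ: "integral {- pi..pi} (circle_integrand (*) s g e) =
      V (complex_of_real (ln e) + \<i> * complex_of_real pi) - V (complex_of_real (ln e) + \<i> * complex_of_real (- pi))"
    if e: "0 < e" "e \<le> d'" for e
  proof -
    define \<gamma> where "\<gamma> = (\<lambda>\<phi>::real. complex_of_real (ln e) + \<i> * complex_of_real \<phi>)"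
    have "(circle_integrand (*) s g e has_integral ((V \<circ> \<gamma>) pi - (V \<circ> \<gamma>) (- pi))) {- pi..pi}"
    proof (rule fundamental_theorem_of_calculus)
      show "- pi \<le> pi" by simp
      fix \<phi> :: real assume \<phi>: "\<phi> \<in> {- pi..pi}"
      have "\<gamma> ` {- pi..pi} \<subseteq> S" using e by (auto simp: S_def \<gamma>_def)
      hence DV: "(V has_field_derivative v (\<gamma> \<phi>)) (at (\<gamma> \<phi>) within \<gamma> ` {- pi..pi})"
        by (rule DERIV_subset[OF V, rotated]) (use e in \<open>auto simp: S_def \<gamma>_def\<close>)
      have "(\<gamma> has_vector_derivative (0 + \<i> * complex_of_real 1)) (at \<phi> within {- pi..pi})"
        unfolding \<gamma>_def
        by (intro has_vector_derivative_add has_vector_derivative_const has_vector_derivative_mult_right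
              has_vector_derivative_of_real DERIV_ident)
      from field_vector_diff_chain_within[OF this DV]
      have VD: "((V \<circ> \<gamma>) has_vector_derivative \<i> * v (\<gamma> \<phi>)) (at \<phi> within {- pi..pi})" by simp
      have gr: "complex_of_real (ln e) + \<i> * complex_of_real \<phi> = \<gamma> \<phi>" by (simp add: \<gamma>_def)
      have "exp (\<gamma> \<phi>) = complex_of_real e * cis \<phi>"
        using e by (simp add: \<gamma>_def exp_add cis_conv_exp exp_of_real)
      hence eq: "\<i> * v (\<gamma> \<phi>) = circle_integrand (*) s g e \<phi>"
        by (simp add: v_def circle_integrand_def exp_diff exp_minus gr divide_simps mult.assoc)
      show "((V \<circ> \<gamma>) has_vector_derivative circle_integrand (*) s g e \<phi>) (at \<phi> within {- pi..pi})"
        using VD unfolding eq .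
    qed
    thus ?thesis by (simp add: \<gamma>_def integral_unique)
  qed
  have ray': "integral {d..} (ray_integrand (*) s g \<theta>) =
      (V (complex_of_real (ln d') + \<i> * complex_of_real \<theta>) - V (complex_of_real (ln d) + \<i> * complex_of_real \<theta>))
      + integral {d'..} (ray_integrand (*) s g \<theta>)"
    if "cis \<theta> = -1" "ray_integrand (*) s g \<theta> integrable_on {d'..}" for \<theta>
    using half_line_integral_split[OF d has_integral_integrable[OF ray[OF that(1)]] that(2)]
      integral_unique[OF ray[OF that(1)]] by simp
  show ?thesis
    unfolding keyhole_def circ[OF d0 d] circ[OF d0' order_refl]
      ray'[OF cis_pi int'(1)] ray'[OF cis_minus_pi int'(2)]
    by (simp add: algebra_simps)
qed

text \<open>
  The two sides of the cut contribute the same integral with the phases \<open>exp(-i\<pi>s)\<close> and \<open>exp(i\<pi>s)\<close>, which combine to a sine.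
\<close>

lemma keyhole_scalar:
  "keyhole (*) d s g =
     sin (complex_of_real pi * s) / complex_of_real pi * integral {d..} (\<lambda>r. exp (- s * complex_of_real (ln r)) * g (- complex_of_real r))
     - \<i> / (2 * complex_of_real pi) * integral {- pi..pi} (circle_integrand (*) s g d)"
proof -
  let ?J = "integral {d..} (\<lambda>r. exp (- s * complex_of_real (ln r)) * g (- complex_of_real r))"
  have r1: "ray_integrand (*) s g pi = (\<lambda>r. (- exp (- s * (\<i> * complex_of_real pi))) * (exp (- s * complex_of_real (ln r)) * g (- complex_of_real r)))"
    by (rule ext) (simp add: ray_integrand_def algebra_simps exp_add exp_diff exp_minus divide_simps)
  have r2: "ray_integrand (*) s g (- pi) = (\<lambda>r. (- exp (s * (\<i> * complex_of_real pi))) * (exp (- s * complex_of_real (ln r)) * g (- complex_of_real r)))"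
    by (rule ext) (simp add: ray_integrand_def algebra_simps exp_add exp_diff exp_minus divide_simps)
  have sin: "sin (complex_of_real pi * s) = \<i> / 2 * (exp (- s * (\<i> * complex_of_real pi)) - exp (s * (\<i> * complex_of_real pi)))"
    by (simp add: sin_exp_eq mult_ac divide_simps)
  show ?thesis
    unfolding keyhole_def r1 r2 integral_mult_right sin
    by (simp add: field_simps)
qed

lemma circle_integral_entire:
  assumes "continuous_on {- pi..pi} (\<lambda>\<phi>. g (complex_of_real d * cis \<phi>))"
  shows "(\<lambda>s. integral {- pi..pi} (circle_integrand (*) s g d)) holomorphic_on UNIV"
proof -
  have c: "continuous_on (UNIV \<times> {- pi..pi}) (\<lambda>p. g (complex_of_real d * cis (snd p)))"
    by (rule continuous_on_compose2[OF assms]) (auto intro: continuous_intros)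
  have "(\<lambda>s. integral (cbox (- pi) pi) (circle_integrand (*) s g d)) holomorphic_on UNIV"
  proof (rule leibniz_rule_holomorphic[where fx="\<lambda>s \<phi>. - (complex_of_real (ln d) + \<i> * complex_of_real \<phi>) * circle_integrand (*) s g d \<phi>"])
    fix s :: complex and \<phi> :: real
    show "((\<lambda>s. circle_integrand (*) s g d \<phi>) has_field_derivative
        - (complex_of_real (ln d) + \<i> * complex_of_real \<phi>) * circle_integrand (*) s g d \<phi>) (at s within UNIV)"
      unfolding circle_integrand_def by (rule derivative_eq_intros refl)+ (simp add: algebra_simps)
    show "circle_integrand (*) s g d integrable_on cbox (- pi) pi"
      unfolding circle_integrand_def box_real
      by (intro integrable_continuous_interval continuous_intros assms)
  next
    show "continuous_on (UNIV \<times> cbox (- pi) pi) (\<lambda>(s, \<phi>). - (complex_of_real (ln d) + \<i> * complex_of_real \<phi>) * circle_integrand (*) s g d \<phi>)"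
      unfolding circle_integrand_def case_prod_unfold box_real
      by (intro continuous_intros c)
  qed simp
  thus ?thesis by simp
qed

section \<open>Traces of relative powers as contour integrals\<close>

lemma csqrt_minus_real: "0 \<le> r \<Longrightarrow> csqrt (- complex_of_real r) = \<i> * complex_of_real (sqrt r)"
  by (subst csqrt_of_real_nonpos) auto

lemma half_angle_square: "(complex_of_real c * cis (\<phi> / 2))\<^sup>2 = complex_of_real (c\<^sup>2) * cis \<phi>"
  by (simp add: power_mult_distrib cis_mult power2_eq_square)

lemma even_csqrt_square:
  assumes "\<And>l. F (- l) = F l"
  shows "F (csqrt (l\<^sup>2)) = F l"
proof -
  have "(csqrt (l\<^sup>2))\<^sup>2 = l\<^sup>2" by simp
  hence "csqrt (l\<^sup>2) = l \<or> csqrt (l\<^sup>2) = - l" by (simp only: power2_eq_iff)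
  thus ?thesis using assms by auto
qed

lemma even_csqrt_circle:
  assumes "\<And>l. F (- l) = F l"
  shows "F (csqrt (complex_of_real (c\<^sup>2) * cis \<phi>)) = F (complex_of_real c * cis (\<phi> / 2))"
  unfolding half_angle_square[symmetric] by (rule even_csqrt_square[of F, OF assms])

lemma axis_in_axis_disc: "\<i> * complex_of_real t \<in> axis_disc \<rho>" "- (\<i> * complex_of_real t) \<in> axis_disc \<rho>"
  by (simp_all add: axis_disc_def)

lemma circle_in_axis_disc: "0 < c \<Longrightarrow> c < \<rho> \<Longrightarrow> complex_of_real c * cis \<phi> \<in> axis_disc \<rho>"
  by (simp add: axis_disc_def norm_mult)

text \<open>
  The integrands are even functions of \<open>\<lambda> = \<surd>\<mu>\<close>, so the jump of the square root along the negative axis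
  does not destroy their continuity along the contour.
\<close>

lemma keyhole_admissible_csqrt:
  fixes F :: "complex \<Rightarrow> 'b::banach"
  assumes c: "0 < c" "c < \<rho>" and even: "\<And>l. F (- l) = F l"
    and cont: "continuous_on (axis_disc \<rho> - {0}) F"
    and bnd: "\<And>t. t \<ge> c \<Longrightarrow> norm (F (\<i> * complex_of_real t)) \<le> K"
  shows "keyhole_admissible (c\<^sup>2) (\<lambda>\<mu>. F (csqrt \<mu>))"
  unfolding keyhole_admissible_def
proof (intro conjI exI[of _ K] allI impI)
  show "0 < c\<^sup>2" using c by simp
  have r0: "0 < r" if "r \<ge> c\<^sup>2" for r using that c by (smt (verit) zero_less_power)
  have "continuous_on {c\<^sup>2..} (\<lambda>r. F (\<i> * complex_of_real (sqrt r)))"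
    by (rule continuous_on_compose2[OF cont])
       (use r0 in \<open>fastforce intro!: continuous_intros simp: axis_disc_def\<close>)+
  thus "continuous_on {c\<^sup>2..} (\<lambda>r. F (csqrt (- complex_of_real r)))"
    by (rule continuous_on_eq) (use r0 in \<open>fastforce simp: csqrt_minus_real\<close>)
  have "continuous_on {- pi..pi} (\<lambda>\<phi>. F (complex_of_real c * cis (\<phi> / 2)))"
    by (rule continuous_on_compose2[OF cont])
       (use c in \<open>auto intro!: continuous_intros simp: axis_disc_def norm_mult\<close>)
  thus "continuous_on {- pi..pi} (\<lambda>\<phi>. F (csqrt (complex_of_real (c\<^sup>2) * cis \<phi>)))"
    by (simp only: even_csqrt_circle[of F, OF even])
  fix r assume r: "c\<^sup>2 \<le> r"
  hence "c \<le> sqrt r" using c by (intro real_le_rsqrt) 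
  thus "norm (F (csqrt (- complex_of_real r))) \<le> K"
    using bnd r0[OF r] by (simp add: csqrt_minus_real)
qed

locale axis_resolvent =
  fixes A :: "'h::complex_hilbert graph" and \<rho> :: real
  assumes sa: "self_adjoint A" and res: "axis_disc \<rho> \<subseteq> resolvent_set A" and rho: "\<rho> > 0"
begin

lemma lin: "linear_operator A"
  using sa by (simp add: self_adjoint_def)

lemma in_res: "l \<in> axis_disc \<rho> \<Longrightarrow> l \<in> resolvent_set A" "l \<in> axis_disc \<rho> \<Longrightarrow> - l \<in> resolvent_set A"
  using res axis_disc_closed(1) by auto

lemma square_in_res: "l \<in> axis_disc \<rho> \<Longrightarrow> l\<^sup>2 \<in> resolvent_set (A O A)"
  by (rule resolvent_square(1)[OF lin in_res])

lemma neg_axis_in_res: "0 \<le> r \<Longrightarrow> - complex_of_real r \<in> resolvent_set (A O A)"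
  using square_in_res[OF axis_in_axis_disc(1), of "sqrt r"] by (simp add: power_mult_distrib flip: of_real_power)

lemma disc_in_res:
  assumes "0 < c" "c < \<rho>"
  shows "cball 0 (c\<^sup>2) \<subseteq> resolvent_set (A O A)"
proof
  fix \<mu> :: complex assume "\<mu> \<in> cball 0 (c\<^sup>2)"
  hence "norm (csqrt \<mu>) \<le> c" using assms by (simp add: real_le_lsqrt)
  hence "csqrt \<mu> \<in> axis_disc \<rho>" using assms by (simp add: axis_disc_def)
  thus "\<mu> \<in> resolvent_set (A O A)" using square_in_res by fastforce
qed

lemma square_resolvent_bound:
  assumes "0 < r"
  shows "norm (resolvent (A O A) (- complex_of_real r) x) \<le> norm x / r"
proof -
  let ?l = "\<i> * complex_of_real (sqrt r)" and ?m = "\<i> * complex_of_real (- sqrt r)"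
  have l: "?l \<in> resolvent_set A" "?m \<in> resolvent_set A"
    using in_res(1)[OF axis_in_axis_disc(1)] by blast+
  have sq: "?l\<^sup>2 = - complex_of_real r" using assms by (simp add: power_mult_distrib flip: of_real_power)
  have "resolvent (A O A) (- complex_of_real r) x = resolvent A ?l (resolvent A ?m x)"
    using resolvent_square(2)[OF lin, of ?l x] l sq by simp
  also have "norm \<dots> \<le> (1 / \<bar>sqrt r\<bar>) * ((1 / \<bar>- sqrt r\<bar>) * norm x)"
    by (rule order_trans[OF resolvent_imaginary_bound[OF sa l(1)] mult_left_mono[OF resolvent_imaginary_bound[OF sa l(2)]]])
       (use assms in auto)
  also have "\<dots> = norm x / (sqrt r * sqrt r)" using assms by simp
  finally show ?thesis using assms by simp
qed

lemma square_resolvent_admissible: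
  assumes d: "0 < d" "cball 0 d \<subseteq> resolvent_set (A O A)"
  shows "keyhole_admissible d (\<lambda>\<mu>. resolvent (A O A) \<mu> x)"
  unfolding keyhole_admissible_def
proof (intro conjI exI[of _ "norm x / d"] allI impI)
  show "continuous_on {d..} (\<lambda>r. resolvent (A O A) (- complex_of_real r) x)"
    by (rule continuous_on_compose2[OF resolvent_continuous_on])
       (use d neg_axis_in_res in \<open>auto intro!: continuous_intros\<close>)
  show "continuous_on {- pi..pi} (\<lambda>\<phi>. resolvent (A O A) (complex_of_real d * cis \<phi>) x)"
    by (rule continuous_on_compose2[OF resolvent_continuous_on])
       (use d in \<open>auto intro!: continuous_intros subsetD[OF d(2)] simp: norm_mult\<close>)
  show "norm (resolvent (A O A) (- complex_of_real r) x) \<le> norm x / d" if "d \<le> r" for r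
    using order_trans[OF square_resolvent_bound[of r x] divide_left_mono[of d r "norm x"]] d that by simp
qed (use d in simp)

text \<open>
  The radius chosen in the definition of the power is unknown and may differ between operators; by
  Cauchy's theorem, applied to matrix elements, it can be replaced by any small one.
\<close>

lemma neg_power_keyhole:
  assumes c: "0 < c" "c < \<rho>" and s: "2 \<le> Re s"
  shows "neg_power pi (A O A) s x = keyhole (*\<^sub>C) (c\<^sup>2) s (\<lambda>\<mu>. resolvent (A O A) \<mu> x)"
proof -
  let ?B = "A O A"
  define e where "e = (SOME e. e > 0 \<and> cball 0 e \<subseteq> resolvent_set ?B)"
  have "c\<^sup>2 > 0 \<and> cball 0 (c\<^sup>2) \<subseteq> resolvent_set ?B" using c disc_in_res[OF c] by simp
  hence e: "e > 0 \<and> cball 0 e \<subseteq> resolvent_set ?B" unfolding e_def by (rule someI)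
  have "neg_power pi ?B s x = keyhole (*\<^sub>C) e s (\<lambda>\<mu>. resolvent ?B \<mu> x)"
    unfolding neg_power_def Let_def e_def[symmetric] keyhole_def
    by (simp add: contour_integrand_def ray_integrand_def[abs_def] circle_integrand_def[abs_def])
  also have "\<dots> = keyhole (*\<^sub>C) (c\<^sup>2) s (\<lambda>\<mu>. resolvent ?B \<mu> x)"
  proof (rule cinner_eqI)
    fix y
    define g where "g = (\<lambda>\<mu>. cinner y (resolvent ?B \<mu> x))"
    have adm: "keyhole_admissible d (\<lambda>\<mu>. resolvent ?B \<mu> x)" "keyhole_admissible d g"
      "continuous_on (cball 0 d) g" "g holomorphic_on ball 0 d"
      if d: "0 < d" "cball 0 d \<subseteq> resolvent_set ?B" for d
    proof -
      show a: "keyhole_admissible d (\<lambda>\<mu>. resolvent ?B \<mu> x)" by (rule square_resolvent_admissible[OF d])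
      have "norm (g (- complex_of_real r)) \<le> norm y * (norm x / d)" if "d \<le> r" for r
      proof -
        have "norm (resolvent ?B (- complex_of_real r) x) \<le> norm x / d"
          using order_trans[OF square_resolvent_bound[of r x] divide_left_mono[of d r "norm x"]] d that by simp
        thus ?thesis unfolding g_def
          by (rule order_trans[OF cauchy_schwarz mult_left_mono]) simp
      qed
      thus "keyhole_admissible d g"
        using a unfolding keyhole_admissible_def g_def
        by (auto intro!: bounded_linear.continuous_on[OF cinner.bounded_linear_right])
      show "continuous_on (cball 0 d) g"
        unfolding g_def
        by (rule bounded_linear.continuous_on[OF cinner.bounded_linear_right
              continuous_on_subset[OF resolvent_continuous_on d(2)]])
      show "g holomorphic_on ball 0 d"
        unfolding g_def by (rule resolvent_weakly_holomorphic) (use d ball_subset_cball in auto)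
    qed
    have key: "cinner y (keyhole (*\<^sub>C) d s (\<lambda>\<mu>. resolvent ?B \<mu> x)) = keyhole (*) d s g"
      if d: "0 < d" "cball 0 d \<subseteq> resolvent_set ?B" for d
      unfolding g_def
      by (rule keyhole_linear[where f="cinner y" and sm="(*\<^sub>C)" and sm'="(*)" and G="\<lambda>\<mu>. resolvent ?B \<mu> x",
            OF bounded_bilinear_scaleC adm(1)[OF d] s cinner.bounded_linear_right cinner_scaleC_right])
    have e': "0 < e" "cball 0 e \<subseteq> resolvent_set ?B" using e by auto
    have c': "0 < c\<^sup>2" "cball 0 (c\<^sup>2) \<subseteq> resolvent_set ?B" using c disc_in_res[OF c] by auto
    have "keyhole (*) e s g = keyhole (*) (c\<^sup>2) s g"
    proof (cases "e \<le> c\<^sup>2")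
      case True
      thus ?thesis
        by (rule keyhole_radius_independent[OF _ adm(3)[OF c'] adm(4)[OF c'] adm(2)[OF e'] adm(2)[OF c'] s])
    next
      case False
      hence "c\<^sup>2 \<le> e" by simp
      thus ?thesis
        by (rule keyhole_radius_independent[OF _ adm(3)[OF e'] adm(4)[OF e'] adm(2)[OF c'] adm(2)[OF e'] s, symmetric])
    qed
    thus "cinner y (keyhole (*\<^sub>C) e s (\<lambda>\<mu>. resolvent ?B \<mu> x)) =
        cinner y (keyhole (*\<^sub>C) (c\<^sup>2) s (\<lambda>\<mu>. resolvent ?B \<mu> x))"
      by (simp only: key[OF e'] key[OF c'])
  qed
  finally show ?thesis .
qed

text \<open>\<open>A (A\<^sup>2 - \<lambda>\<^sup>2)\<^sup>-\<^sup>1\<close>, which is bounded and even in \<open>\<lambda>\<close>.\<close>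

definition half_sum :: "complex \<Rightarrow> 'h \<Rightarrow> 'h" where
  "half_sum l x = (1 / 2) *\<^sub>C (resolvent A l x + resolvent A (- l) x)"

lemma half_sum_admissible:
  assumes c: "0 < c" "c < \<rho>"
  shows "keyhole_admissible (c\<^sup>2) (\<lambda>\<mu>. half_sum (csqrt \<mu>) x)"
proof (rule keyhole_admissible_csqrt[OF c, where F="\<lambda>l. half_sum l x" and K="norm x / c"])
  show "half_sum (- l) x = half_sum l x" for l by (simp add: half_sum_def add.commute)
  show "continuous_on (axis_disc \<rho> - {0}) (\<lambda>l. half_sum l x)"
    unfolding half_sum_def
    by (intro continuous_intros bounded_linear.continuous_on[OF scaleC.bounded_linear_right]
          continuous_on_compose2[OF resolvent_continuous_on]) (auto intro: in_res)
  show "norm (half_sum (\<i> * complex_of_real t) x) \<le> norm x / c" if t: "t \<ge> c" for t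
  proof -
    have b: "norm (resolvent A (\<i> * complex_of_real t') x) \<le> norm x / c" if "\<bar>t'\<bar> = t" for t'
    proof -
      have "norm (resolvent A (\<i> * complex_of_real t') x) \<le> 1 / \<bar>t'\<bar> * norm x"
        by (rule resolvent_imaginary_bound[OF sa in_res(1)[OF axis_in_axis_disc(1)]]) (use that t c in auto)
      also have "\<dots> \<le> norm x / c" using that t c by (simp add: divide_left_mono)
      finally show ?thesis .
    qed
    have "norm (half_sum (\<i> * complex_of_real t) x) \<le>
      1 / 2 * (norm (resolvent A (\<i> * complex_of_real t) x) + norm (resolvent A (\<i> * complex_of_real (- t)) x))"
      unfolding half_sum_def norm_scaleC by (intro mult_mono) (auto intro: norm_triangle_ineq)
    also have "\<dots> \<le> 1 / 2 * (norm x / c + norm x / c)"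
      using t c by (intro mult_left_mono add_mono b) auto
    finally show ?thesis by simp
  qed
qed

lemma half_sum_csqrt_square: "half_sum (csqrt (l\<^sup>2)) x = half_sum l x"
  by (rule even_csqrt_square[of "\<lambda>l. half_sum l x"]) (simp add: half_sum_def add.commute)

lemma square_resolvent_half_sum:
  assumes "l \<in> axis_disc \<rho>" "l \<noteq> 0"
  shows "resolvent (A O A) (l\<^sup>2) x = resolvent A 0 (half_sum l x)"
proof -
  have "(resolvent (A O A) (l\<^sup>2) x, half_sum l x + 0 *\<^sub>C resolvent (A O A) (l\<^sup>2) x) \<in> A"
    unfolding half_sum_def
    using resolvent_square_partial_fractions(2)[OF lin in_res(1)[OF assms(1)] in_res(2)[OF assms(1)] assms(2), of x]
    by simp
  moreover have "0 \<in> resolvent_set A" by (rule in_res) (simp add: axis_disc_def rho)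
  ultimately show ?thesis by (intro resolvent_eqI[symmetric])
qed

text \<open>
  The unbounded \<open>A\<close> passes under the integral sign because \<open>A\<^sup>-\<^sup>1\<close> is bounded: the resolvent of \<open>A\<^sup>2\<close> is
  \<open>A\<^sup>-\<^sup>1\<close> applied to an integrand whose integral converges as well.
\<close>

lemma eta_keyhole:
  assumes c: "0 < c" "c < \<rho>" and s: "2 \<le> Re s"
  shows "op_apply A (neg_power pi (A O A) s x) = keyhole (*\<^sub>C) (c\<^sup>2) s (\<lambda>\<mu>. half_sum (csqrt \<mu>) x)"
proof -
  have zero: "0 \<in> resolvent_set A" by (rule in_res) (simp add: axis_disc_def rho)
  note R0 = bounded_clinear_resolvent[OF zero]
  have "neg_power pi (A O A) s x = keyhole (*\<^sub>C) (c\<^sup>2) s (\<lambda>\<mu>. resolvent (A O A) \<mu> x)"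
    by (rule neg_power_keyhole[OF c s])
  also have "\<dots> = keyhole (*\<^sub>C) (c\<^sup>2) s (\<lambda>\<mu>. resolvent A 0 (half_sum (csqrt \<mu>) x))"
  proof (rule keyhole_cong)
    fix r assume "c\<^sup>2 \<le> r"
    hence r: "r > 0" using c by (smt (verit) zero_less_power)
    show "resolvent (A O A) (- complex_of_real r) x = resolvent A 0 (half_sum (csqrt (- complex_of_real r)) x)"
      using square_resolvent_half_sum[OF axis_in_axis_disc(1), of "sqrt r" x] r
      by (simp add: csqrt_minus_real power_mult_distrib flip: of_real_power)
  next
    fix \<phi> :: real
    have "complex_of_real c * cis (\<phi> / 2) \<noteq> 0" using c by simp
    from square_resolvent_half_sum[OF circle_in_axis_disc[OF c] this, of x]
    show "resolvent (A O A) (complex_of_real (c\<^sup>2) * cis \<phi>) x =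
        resolvent A 0 (half_sum (csqrt (complex_of_real (c\<^sup>2) * cis \<phi>)) x)"
      unfolding half_angle_square[symmetric] half_sum_csqrt_square .
  qed
  also have "\<dots> = resolvent A 0 (keyhole (*\<^sub>C) (c\<^sup>2) s (\<lambda>\<mu>. half_sum (csqrt \<mu>) x))"
    by (rule keyhole_linear[where f="resolvent A 0" and sm="(*\<^sub>C)" and sm'="(*\<^sub>C)" and G="\<lambda>\<mu>. half_sum (csqrt \<mu>) x",
          OF bounded_bilinear_scaleC half_sum_admissible[OF c] s
          bounded_clinear_bounded_linear[OF R0] bounded_clinear_scaleC[OF R0], symmetric])
  finally have "(neg_power pi (A O A) s x, keyhole (*\<^sub>C) (c\<^sup>2) s (\<lambda>\<mu>. half_sum (csqrt \<mu>) x)) \<in> A"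
    using resolvent_graph[OF zero, of "keyhole (*\<^sub>C) (c\<^sup>2) s (\<lambda>\<mu>. half_sum (csqrt \<mu>) x)"] by simp
  moreover have "single_valued A" using lin by (simp add: linear_operator_def)
  ultimately show ?thesis
    unfolding op_apply_def by (intro the_equality) (auto dest: single_valuedD)
qed

end

context nuclear_pair
begin

sublocale A1: axis_resolvent A\<^sub>1 \<rho>
  using sa1 res1 rho_pos by unfold_locales

sublocale A2: axis_resolvent A\<^sub>2 \<rho>
  using sa2 res2 rho_pos by unfold_locales

abbreviation "rtr \<equiv> rel_resolvent_trace A\<^sub>1 A\<^sub>2"

text \<open>
  The differences of the operators \<open>(A\<^sup>2 - \<lambda>\<^sup>2)\<^sup>-\<^sup>1\<close> and \<open>A (A\<^sup>2 - \<lambda>\<^sup>2)\<^sup>-\<^sup>1\<close> for \<open>A\<^sub>1\<close> and \<open>A\<^sub>2\<close>, in partial fractions.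
  Their traces are the densities.
\<close>

definition rel_odd :: "complex \<Rightarrow> 'h nuclear" where
  "rel_odd l = nscale (1 / (2 * l)) (rel_res l - rel_res (- l))"

definition rel_even :: "complex \<Rightarrow> 'h nuclear" where
  "rel_even l = nscale (1 / 2) (rel_res l + rel_res (- l))"

definition zeta_density :: "complex \<Rightarrow> complex" where
  "zeta_density l = (rtr l - rtr (- l)) / (2 * l)"

definition eta_density :: "complex \<Rightarrow> complex" where
  "eta_density l = (rtr l + rtr (- l)) / 2"

lemma rel_odd_minus: "rel_odd (- l) = rel_odd l"
proof -
  have "nscale (1 / (2 * - l)) (rel_res (- l) - rel_res (- (- l))) = nscale (- (1 / (2 * l))) (- (rel_res l - rel_res (- l)))"
    by (simp add: divide_minus_right)
  also have "\<dots> = nscale (1 / (2 * l)) (rel_res l - rel_res (- l))"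
    by (simp only: nscale.minus_left nscale.minus_right minus_minus)
  finally show ?thesis by (simp add: rel_odd_def)
qed

lemma rel_even_minus: "rel_even (- l) = rel_even l"
  by (simp add: rel_even_def add.commute)

lemma continuous_rel_res_minus: "continuous_on (axis_disc \<rho> - {0}) (\<lambda>l. rel_res (- l))"
  by (rule continuous_on_compose2[OF rel_res_continuous]) (auto intro!: continuous_intros dest: axis_disc_closed(1))

lemma rel_odd_admissible:
  assumes c: "0 < c" "c < \<rho>"
  shows "keyhole_admissible (c\<^sup>2) (\<lambda>\<mu>. rel_odd (csqrt \<mu>))"
proof (rule keyhole_admissible_csqrt[where F=rel_odd and K="1 / (2 * c) * (8 * norm (rel_res 0))", OF c rel_odd_minus])
  show "continuous_on (axis_disc \<rho> - {0}) rel_odd"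
    unfolding rel_odd_def
    by (intro nscale.continuous_on continuous_on_diff continuous_rel_res_minus
          continuous_on_subset[OF rel_res_continuous] continuous_intros) auto
  show "norm (rel_odd (\<i> * complex_of_real t)) \<le> 1 / (2 * c) * (8 * norm (rel_res 0))" if t: "t \<ge> c" for t
  proof -
    have "norm (rel_odd (\<i> * complex_of_real t)) \<le>
        norm (1 / (2 * (\<i> * complex_of_real t))) * norm (rel_res (\<i> * complex_of_real t) - rel_res (- (\<i> * complex_of_real t)))"
      unfolding rel_odd_def by (rule norm_nscale_le)
    also have "\<dots> \<le> 1 / (2 * c) * (8 * norm (rel_res 0))"
    proof (rule mult_mono)
      show "norm (1 / (2 * (\<i> * complex_of_real t))) \<le> 1 / (2 * c)"
        using t c by (simp add: norm_divide norm_mult frac_le)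
      show "norm (rel_res (\<i> * complex_of_real t) - rel_res (- (\<i> * complex_of_real t))) \<le> 8 * norm (rel_res 0)"
        using norm_triangle_ineq4[of "rel_res (\<i> * complex_of_real t)" "rel_res (- (\<i> * complex_of_real t))"]
          rel_res_axis_bound[of t] rel_res_axis_bound[of "- t"] by simp
    qed (use c in auto)
    finally show ?thesis .
  qed
qed

lemma rel_even_admissible:
  assumes c: "0 < c" "c < \<rho>"
  shows "keyhole_admissible (c\<^sup>2) (\<lambda>\<mu>. rel_even (csqrt \<mu>))"
proof (rule keyhole_admissible_csqrt[where F=rel_even and K="1 / 2 * (8 * norm (rel_res 0))", OF c rel_even_minus])
  show "continuous_on (axis_disc \<rho> - {0}) rel_even"
    unfolding rel_even_def
    by (intro nscale.continuous_on continuous_on_add continuous_rel_res_minus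
          continuous_on_subset[OF rel_res_continuous] continuous_intros) auto
  show "norm (rel_even (\<i> * complex_of_real t)) \<le> 1 / 2 * (8 * norm (rel_res 0))" for t
  proof -
    have "norm (rel_even (\<i> * complex_of_real t)) \<le>
        norm (1 / 2 :: complex) * norm (rel_res (\<i> * complex_of_real t) + rel_res (- (\<i> * complex_of_real t)))"
      unfolding rel_even_def by (rule norm_nscale_le)
    also have "\<dots> \<le> 1 / 2 * (8 * norm (rel_res 0))"
      using norm_triangle_ineq[of "rel_res (\<i> * complex_of_real t)" "rel_res (- (\<i> * complex_of_real t))"]
        rel_res_axis_bound[of t] rel_res_axis_bound[of "- t"] by simp
    finally show ?thesis .
  qed
qed

lemma ntrace_rel_odd: "l \<in> axis_disc \<rho> \<Longrightarrow> ntrace (rel_odd l) = zeta_density l"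
  by (simp add: rel_odd_def zeta_density_def ntrace_nscale ntrace_rel_res axis_disc_closed(1)
        linear_diff[OF bounded_linear.linear[OF bounded_linear_ntrace]])

lemma ntrace_rel_even: "l \<in> axis_disc \<rho> \<Longrightarrow> ntrace (rel_even l) = eta_density l"
  by (simp add: rel_even_def eta_density_def ntrace_nscale ntrace_rel_res axis_disc_closed(1) ntrace_add)

lemma csqrt_contour_in_axis_disc:
  assumes "0 < c" "c < \<rho>"
  shows "c\<^sup>2 \<le> r \<Longrightarrow> csqrt (- complex_of_real r) \<in> axis_disc \<rho>"
    and "csqrt (complex_of_real (c\<^sup>2) * cis \<phi>) \<in> axis_disc \<rho>"
proof -
  assume "c\<^sup>2 \<le> r"
  hence "0 \<le> r" using zero_le_power2 order_trans by blast
  thus "csqrt (- complex_of_real r) \<in> axis_disc \<rho>" by (simp add: csqrt_minus_real axis_disc_def)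
next
  have "norm (csqrt (complex_of_real (c\<^sup>2) * cis \<phi>)) = c" using assms by (simp add: norm_mult norm_power)
  thus "csqrt (complex_of_real (c\<^sup>2) * cis \<phi>) \<in> axis_disc \<rho>" using assms by (simp add: axis_disc_def)
qed

text \<open>
  The contour integral of the difference of the resolvents is taken in the space of nuclear operators.
  Evaluation at a vector and the trace are bounded linear maps on that space, so the same integral
  gives the difference of the powers and its trace.
\<close>

lemma zeta_trace:
  assumes c: "0 < c" "c < \<rho>" and s: "2 \<le> Re s"
  defines "T \<equiv> \<lambda>x. neg_power pi (A\<^sub>1 O A\<^sub>1) s x - neg_power pi (A\<^sub>2 O A\<^sub>2) s x"
  shows "trace_class_on UNIV T"
    and "trace_on UNIV T = keyhole (*) (c\<^sup>2) s (\<lambda>\<mu>. zeta_density (csqrt \<mu>))"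
proof -
  define N where "N = keyhole nscale (c\<^sup>2) s (\<lambda>\<mu>. rel_odd (csqrt \<mu>))"
  have odd_apply: "nuc_apply (rel_odd (csqrt (l\<^sup>2))) x = resolvent (A\<^sub>1 O A\<^sub>1) (l\<^sup>2) x - resolvent (A\<^sub>2 O A\<^sub>2) (l\<^sup>2) x"
    if l: "l \<in> axis_disc \<rho>" "l \<noteq> 0" for l x
  proof -
    note l' = axis_disc_closed(1)[OF l(1)]
    have "nuc_apply (rel_odd (csqrt (l\<^sup>2))) x = nuc_apply (rel_odd l) x"
      by (simp only: even_csqrt_square[of rel_odd, OF rel_odd_minus])
    also have "\<dots> = (1 / (2 * l)) *\<^sub>C ((resolvent A\<^sub>1 l x - resolvent A\<^sub>1 (- l) x) - (resolvent A\<^sub>2 l x - resolvent A\<^sub>2 (- l) x))"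
      by (simp add: rel_odd_def nuc_apply_minus nuc_apply_rel_res[OF l(1)] nuc_apply_rel_res[OF l'] algebra_simps)
    also have "\<dots> = resolvent (A\<^sub>1 O A\<^sub>1) (l\<^sup>2) x - resolvent (A\<^sub>2 O A\<^sub>2) (l\<^sup>2) x"
      unfolding resolvent_square_partial_fractions(1)[OF A1.lin A1.in_res(1)[OF l(1)] A1.in_res(2)[OF l(1)] l(2)]
        resolvent_square_partial_fractions(1)[OF A2.lin A2.in_res(1)[OF l(1)] A2.in_res(2)[OF l(1)] l(2)]
      by (rule scaleC_diff_right)
    finally show ?thesis .
  qed
  have T: "T = nuc_apply N"
  proof
    fix x
    have c2: "0 < c\<^sup>2" using c by simp
    have "T x = keyhole (*\<^sub>C) (c\<^sup>2) s (\<lambda>\<mu>. resolvent (A\<^sub>1 O A\<^sub>1) \<mu> x) - keyhole (*\<^sub>C) (c\<^sup>2) s (\<lambda>\<mu>. resolvent (A\<^sub>2 O A\<^sub>2) \<mu> x)"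
      unfolding T_def by (simp only: A1.neg_power_keyhole[OF c s] A2.neg_power_keyhole[OF c s])
    also have "\<dots> = keyhole (*\<^sub>C) (c\<^sup>2) s (\<lambda>\<mu>. resolvent (A\<^sub>1 O A\<^sub>1) \<mu> x - resolvent (A\<^sub>2 O A\<^sub>2) \<mu> x)"
      by (rule keyhole_diff[OF bounded_bilinear_scaleC A1.square_resolvent_admissible[OF c2 A1.disc_in_res[OF c]]
            A2.square_resolvent_admissible[OF c2 A2.disc_in_res[OF c]] s])
    also have "\<dots> = keyhole (*\<^sub>C) (c\<^sup>2) s (\<lambda>\<mu>. nuc_apply (rel_odd (csqrt \<mu>)) x)"
    proof (rule keyhole_cong)
      fix r assume "c\<^sup>2 \<le> r"
      hence r: "r > 0" using c2 by linarith
      show "resolvent (A\<^sub>1 O A\<^sub>1) (- complex_of_real r) x - resolvent (A\<^sub>2 O A\<^sub>2) (- complex_of_real r) x =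
          nuc_apply (rel_odd (csqrt (- complex_of_real r))) x"
        using odd_apply[OF axis_in_axis_disc(1), of "sqrt r" x] r
        by (simp add: power_mult_distrib flip: of_real_power)
    next
      fix \<phi> :: real
      have "complex_of_real c * cis (\<phi> / 2) \<noteq> 0" using c by simp
      from odd_apply[OF circle_in_axis_disc[OF c] this, of x]
      show "resolvent (A\<^sub>1 O A\<^sub>1) (complex_of_real (c\<^sup>2) * cis \<phi>) x - resolvent (A\<^sub>2 O A\<^sub>2) (complex_of_real (c\<^sup>2) * cis \<phi>) x =
          nuc_apply (rel_odd (csqrt (complex_of_real (c\<^sup>2) * cis \<phi>))) x"
        unfolding half_angle_square by (rule sym)
    qed
    also have "\<dots> = nuc_apply N x"
      unfolding N_def
      by (rule keyhole_linear[where f="\<lambda>N. nuc_apply N x" and sm=nscale and sm'="(*\<^sub>C)" and G="\<lambda>\<mu>. rel_odd (csqrt \<mu>)",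
            OF bounded_bilinear_nscale rel_odd_admissible[OF c] s bounded_linear_nuc_apply nuc_apply_nscale, symmetric])
    finally show "T x = nuc_apply N x" .
  qed
  show "trace_class_on UNIV T" unfolding T using nuc_apply[of N] by simp
  have "trace_on UNIV T = ntrace N" by (simp add: T ntrace_def)
  also have "\<dots> = keyhole (*) (c\<^sup>2) s (\<lambda>\<mu>. ntrace (rel_odd (csqrt \<mu>)))"
    unfolding N_def
    by (rule keyhole_linear[where f=ntrace and sm=nscale and sm'="(*)" and G="\<lambda>\<mu>. rel_odd (csqrt \<mu>)",
          OF bounded_bilinear_nscale rel_odd_admissible[OF c] s bounded_linear_ntrace ntrace_nscale])
  also have "\<dots> = keyhole (*) (c\<^sup>2) s (\<lambda>\<mu>. zeta_density (csqrt \<mu>))"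
    by (rule keyhole_cong) (simp_all only: ntrace_rel_odd csqrt_contour_in_axis_disc[OF c])
  finally show "trace_on UNIV T = keyhole (*) (c\<^sup>2) s (\<lambda>\<mu>. zeta_density (csqrt \<mu>))" .
qed

lemma eta_trace:
  assumes c: "0 < c" "c < \<rho>" and s: "3 \<le> Re s"
  defines "T \<equiv> \<lambda>x. eta_operator A\<^sub>1 s x - eta_operator A\<^sub>2 s x"
  shows "trace_class_on UNIV T"
    and "trace_on UNIV T = keyhole (*) (c\<^sup>2) ((s + 1) / 2) (\<lambda>\<mu>. eta_density (csqrt \<mu>))"
proof -
  define s' where "s' = (s + 1) / 2"
  have s': "2 \<le> Re s'" using s by (simp add: s'_def)
  define N where "N = keyhole nscale (c\<^sup>2) s' (\<lambda>\<mu>. rel_even (csqrt \<mu>))"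
  have even_apply: "nuc_apply (rel_even l) x = A1.half_sum l x - A2.half_sum l x"
    if l: "l \<in> axis_disc \<rho>" for l x
    by (simp add: rel_even_def A1.half_sum_def A2.half_sum_def nuc_apply_add nuc_apply_rel_res[OF l]
          nuc_apply_rel_res[OF axis_disc_closed(1)[OF l]] scaleC_add_right scaleC_diff_right)
  have T: "T = nuc_apply N"
  proof
    fix x
    have "T x = keyhole (*\<^sub>C) (c\<^sup>2) s' (\<lambda>\<mu>. A1.half_sum (csqrt \<mu>) x) - keyhole (*\<^sub>C) (c\<^sup>2) s' (\<lambda>\<mu>. A2.half_sum (csqrt \<mu>) x)"
      unfolding T_def eta_operator_def s'_def[symmetric]
      by (simp only: A1.eta_keyhole[OF c s'] A2.eta_keyhole[OF c s'])
    also have "\<dots> = keyhole (*\<^sub>C) (c\<^sup>2) s' (\<lambda>\<mu>. A1.half_sum (csqrt \<mu>) x - A2.half_sum (csqrt \<mu>) x)"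
      by (rule keyhole_diff[OF bounded_bilinear_scaleC A1.half_sum_admissible[OF c] A2.half_sum_admissible[OF c] s'])
    also have "\<dots> = keyhole (*\<^sub>C) (c\<^sup>2) s' (\<lambda>\<mu>. nuc_apply (rel_even (csqrt \<mu>)) x)"
      by (rule keyhole_cong) (simp_all only: even_apply csqrt_contour_in_axis_disc[OF c])
    also have "\<dots> = nuc_apply N x"
      unfolding N_def
      by (rule keyhole_linear[where f="\<lambda>N. nuc_apply N x" and sm=nscale and sm'="(*\<^sub>C)" and G="\<lambda>\<mu>. rel_even (csqrt \<mu>)",
            OF bounded_bilinear_nscale rel_even_admissible[OF c] s' bounded_linear_nuc_apply nuc_apply_nscale, symmetric])
    finally show "T x = nuc_apply N x" .
  qed
  show "trace_class_on UNIV T" unfolding T using nuc_apply[of N] by simp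
  have "trace_on UNIV T = ntrace N" by (simp add: T ntrace_def)
  also have "\<dots> = keyhole (*) (c\<^sup>2) s' (\<lambda>\<mu>. ntrace (rel_even (csqrt \<mu>)))"
    unfolding N_def
    by (rule keyhole_linear[where f=ntrace and sm=nscale and sm'="(*)" and G="\<lambda>\<mu>. rel_even (csqrt \<mu>)",
          OF bounded_bilinear_nscale rel_even_admissible[OF c] s' bounded_linear_ntrace ntrace_nscale])
  also have "\<dots> = keyhole (*) (c\<^sup>2) s' (\<lambda>\<mu>. eta_density (csqrt \<mu>))"
    by (rule keyhole_cong) (simp_all only: ntrace_rel_even csqrt_contour_in_axis_disc[OF c])
  finally show "trace_on UNIV T = keyhole (*) (c\<^sup>2) ((s + 1) / 2) (\<lambda>\<mu>. eta_density (csqrt \<mu>))"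
    by (simp add: s'_def)
qed

lemma zeta_density_minus: "zeta_density (- l) = zeta_density l"
  by (simp add: zeta_density_def minus_divide_left divide_minus_right)

lemma eta_density_minus: "eta_density (- l) = eta_density l"
  by (simp add: eta_density_def add.commute)

lemma density_circle_continuous:
  assumes c: "0 < c" "c < \<rho>"
  shows "continuous_on {- pi..pi} (\<lambda>\<phi>. zeta_density (csqrt (complex_of_real (c\<^sup>2) * cis \<phi>)))"
    and "continuous_on {- pi..pi} (\<lambda>\<phi>. eta_density (csqrt (complex_of_real (c\<^sup>2) * cis \<phi>)))"
proof -
  have "continuous_on {- pi..pi} (\<lambda>\<phi>. ntrace (rel_odd (csqrt (complex_of_real (c\<^sup>2) * cis \<phi>))))"
    using rel_odd_admissible[OF c] unfolding keyhole_admissible_def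
    by (intro bounded_linear.continuous_on[OF bounded_linear_ntrace]) simp
  thus "continuous_on {- pi..pi} (\<lambda>\<phi>. zeta_density (csqrt (complex_of_real (c\<^sup>2) * cis \<phi>)))"
    by (simp only: ntrace_rel_odd csqrt_contour_in_axis_disc[OF c])
  have "continuous_on {- pi..pi} (\<lambda>\<phi>. ntrace (rel_even (csqrt (complex_of_real (c\<^sup>2) * cis \<phi>))))"
    using rel_even_admissible[OF c] unfolding keyhole_admissible_def
    by (intro bounded_linear.continuous_on[OF bounded_linear_ntrace]) simp
  thus "continuous_on {- pi..pi} (\<lambda>\<phi>. eta_density (csqrt (complex_of_real (c\<^sup>2) * cis \<phi>)))"
    by (simp only: ntrace_rel_even csqrt_contour_in_axis_disc[OF c])
qed

text \<open>
  On the circle the integrands are derivatives of combinations of a primitive \<open>L\<close> of the trace. The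
  half circle \<open>\<lambda> = c e\<^sup>i\<^sup>\<phi>\<^sup>/\<^sup>2\<close> runs from \<open>-ic\<close> to \<open>ic\<close>, which \<open>\<lambda> \<mapsto> -\<lambda>\<close> interchanges.
\<close>

lemma circle_values:
  assumes c: "0 < c" "c < \<rho>" and L: "\<And>z. z \<in> ball 0 \<rho> \<Longrightarrow> (L has_field_derivative - rtr z) (at z)"
  shows "integral {- pi..pi} (circle_integrand (*) 0 (\<lambda>\<mu>. zeta_density (csqrt \<mu>)) (c\<^sup>2)) = 0"
    and "integral {- pi..pi} (circle_integrand (*) (1 / 2) (\<lambda>\<mu>. eta_density (csqrt \<mu>)) (c\<^sup>2)) =
      - 2 * (L (\<i> * complex_of_real c) - L (- (\<i> * complex_of_real c)))"
proof -
  define l where "l = (\<lambda>\<phi>::real. complex_of_real c * cis (\<phi> / 2))"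
  have lpi: "l pi = \<i> * complex_of_real c" "l (- pi) = - (\<i> * complex_of_real c)"
    by (simp_all add: l_def complex_eq_iff)
  have l0: "l \<phi> \<noteq> 0" for \<phi> using c by (simp add: l_def)
  have lb: "l \<phi> \<in> ball 0 \<rho>" "- l \<phi> \<in> ball 0 \<rho>" for \<phi> using c by (simp_all add: l_def norm_mult)
  have cis': "((\<lambda>\<phi>. cis (\<phi> / 2)) has_vector_derivative (\<i> / 2 * cis (\<phi> / 2))) (at \<phi> within X)" for \<phi> X
  proof -
    have "((\<lambda>\<phi>. \<i> * complex_of_real (\<phi> / 2)) has_vector_derivative \<i> * complex_of_real (1 / 2)) (at \<phi> within X)"
      by (intro has_vector_derivative_mult_right has_vector_derivative_of_real) (auto intro!: derivative_eq_intros)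
    from field_vector_diff_chain_within[OF this has_field_derivative_at_within[OF DERIV_exp]]
    show ?thesis by (simp add: o_def cis_conv_exp)
  qed
  have l': "(l has_vector_derivative (\<i> / 2 * l \<phi>)) (at \<phi> within X)" for \<phi> X
    using has_vector_derivative_mult_right[OF cis', of "complex_of_real c"] by (simp add: l_def mult_ac)
  have lm': "((\<lambda>\<phi>. - l \<phi>) has_vector_derivative - (\<i> / 2 * l \<phi>)) (at \<phi> within X)" for \<phi> X
    by (rule has_vector_derivative_minus[OF l'])
  have Lp: "((L \<circ> l) has_vector_derivative \<i> / 2 * l \<phi> * - rtr (l \<phi>)) (at \<phi> within X)" for \<phi> X
    by (rule field_vector_diff_chain_within[OF l' has_field_derivative_at_within[OF L[OF lb(1)]]])
  have Lm: "((L \<circ> (\<lambda>\<phi>. - l \<phi>)) has_vector_derivative - (\<i> / 2 * l \<phi>) * - rtr (- l \<phi>)) (at \<phi> within X)" for \<phi> X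
    by (rule field_vector_diff_chain_within[OF lm' has_field_derivative_at_within[OF L[OF lb(2)]]])
  have zd: "zeta_density (csqrt (complex_of_real (c\<^sup>2) * cis \<phi>)) = zeta_density (l \<phi>)" for \<phi>
    unfolding l_def by (rule even_csqrt_circle[of zeta_density, OF zeta_density_minus])
  have ed: "eta_density (csqrt (complex_of_real (c\<^sup>2) * cis \<phi>)) = eta_density (l \<phi>)" for \<phi>
    unfolding l_def by (rule even_csqrt_circle[of eta_density, OF eta_density_minus])
  have sq: "complex_of_real (c\<^sup>2) * cis \<phi> = l \<phi> * l \<phi>" for \<phi>
    unfolding l_def by (rule trans[OF half_angle_square[symmetric] power2_eq_square])
  have ex: "exp (- (1 / 2) * (complex_of_real (ln (c\<^sup>2)) + \<i> * complex_of_real \<phi>)) * l \<phi> = 1" for \<phi>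
  proof -
    have "l \<phi> = exp (complex_of_real (ln c) + \<i> * complex_of_real (\<phi> / 2))"
      using c by (simp add: l_def exp_add cis_conv_exp exp_of_real)
    moreover have "ln (c\<^sup>2) = 2 * ln c" using c by (simp add: ln_realpow)
    ultimately show ?thesis by (simp add: algebra_simps flip: exp_add)
  qed
  have zi: "circle_integrand (*) 0 (\<lambda>\<mu>. zeta_density (csqrt \<mu>)) (c\<^sup>2) \<phi> =
      - (\<i> / 2 * l \<phi> * - rtr (l \<phi>) + - (\<i> / 2 * l \<phi>) * - rtr (- l \<phi>))" for \<phi>
  proof -
    have "circle_integrand (*) 0 (\<lambda>\<mu>. zeta_density (csqrt \<mu>)) (c\<^sup>2) \<phi> = \<i> * (l \<phi> * l \<phi>) * zeta_density (l \<phi>)"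
      by (simp only: circle_integrand_def zd sq[symmetric]) simp
    thus ?thesis unfolding zeta_density_def using l0[of \<phi>] by (simp add: divide_simps) (simp add: algebra_simps)
  qed
  have ei: "circle_integrand (*) (1 / 2) (\<lambda>\<mu>. eta_density (csqrt \<mu>)) (c\<^sup>2) \<phi> =
      - (\<i> / 2 * l \<phi> * - rtr (l \<phi>) - - (\<i> / 2 * l \<phi>) * - rtr (- l \<phi>))" for \<phi>
  proof -
    have "circle_integrand (*) (1 / 2) (\<lambda>\<mu>. eta_density (csqrt \<mu>)) (c\<^sup>2) \<phi> =
      \<i> * (complex_of_real (c\<^sup>2) * cis \<phi>) * (exp (- (1 / 2) * (complex_of_real (ln (c\<^sup>2)) + \<i> * complex_of_real \<phi>)) * eta_density (l \<phi>))"
      by (simp only: circle_integrand_def ed mult.assoc)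
    also have "\<dots> = \<i> * l \<phi> * (exp (- (1 / 2) * (complex_of_real (ln (c\<^sup>2)) + \<i> * complex_of_real \<phi>)) * l \<phi>) * eta_density (l \<phi>)"
      unfolding sq by (simp only: mult_ac)
    also have "\<dots> = \<i> * l \<phi> * eta_density (l \<phi>)" unfolding ex by simp
    finally show ?thesis by (simp add: eta_density_def field_simps)
  qed
  have "((\<lambda>\<phi>. - ((L \<circ> l) \<phi> + (L \<circ> (\<lambda>\<phi>. - l \<phi>)) \<phi>)) has_vector_derivative
      circle_integrand (*) 0 (\<lambda>\<mu>. zeta_density (csqrt \<mu>)) (c\<^sup>2) \<phi>) (at \<phi> within {- pi..pi})" for \<phi>
    unfolding zi by (rule has_vector_derivative_minus[OF has_vector_derivative_add[OF Lp Lm]])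
  from fundamental_theorem_of_calculus[where a="- pi" and b=pi, OF _ this]
  have "(circle_integrand (*) 0 (\<lambda>\<mu>. zeta_density (csqrt \<mu>)) (c\<^sup>2) has_integral
      (- ((L \<circ> l) pi + (L \<circ> (\<lambda>\<phi>. - l \<phi>)) pi) - - ((L \<circ> l) (- pi) + (L \<circ> (\<lambda>\<phi>. - l \<phi>)) (- pi)))) {- pi..pi}" by simp
  thus "integral {- pi..pi} (circle_integrand (*) 0 (\<lambda>\<mu>. zeta_density (csqrt \<mu>)) (c\<^sup>2)) = 0"
    by (simp add: lpi integral_unique)
  have "((\<lambda>\<phi>. - ((L \<circ> l) \<phi> - (L \<circ> (\<lambda>\<phi>. - l \<phi>)) \<phi>)) has_vector_derivative
      circle_integrand (*) (1 / 2) (\<lambda>\<mu>. eta_density (csqrt \<mu>)) (c\<^sup>2) \<phi>) (at \<phi> within {- pi..pi})" for \<phi>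
    unfolding ei by (rule has_vector_derivative_minus[OF has_vector_derivative_diff[OF Lp Lm]])
  from fundamental_theorem_of_calculus[where a="- pi" and b=pi, OF _ this]
  have "(circle_integrand (*) (1 / 2) (\<lambda>\<mu>. eta_density (csqrt \<mu>)) (c\<^sup>2) has_integral
      (- ((L \<circ> l) pi - (L \<circ> (\<lambda>\<phi>. - l \<phi>)) pi) - - ((L \<circ> l) (- pi) - (L \<circ> (\<lambda>\<phi>. - l \<phi>)) (- pi)))) {- pi..pi}" by simp
  thus "integral {- pi..pi} (circle_integrand (*) (1 / 2) (\<lambda>\<mu>. eta_density (csqrt \<mu>)) (c\<^sup>2)) =
      - 2 * (L (\<i> * complex_of_real c) - L (- (\<i> * complex_of_real c)))"
    by (simp add: lpi integral_unique)
qed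

end

section \<open>Mellin transforms of functions with asymptotic expansions\<close>

definition mellin_kernel :: "complex \<Rightarrow> real \<Rightarrow> complex" where
  "mellin_kernel s r = exp (- (s + 1) * complex_of_real (ln r))"

lemma norm_mellin_kernel: "r > 0 \<Longrightarrow> norm (mellin_kernel s r) = r powr (- Re s - 1)"
  by (simp add: mellin_kernel_def powr_def algebra_simps)

lemma continuous_on_mellin_kernel: "d > 0 \<Longrightarrow> continuous_on {d..} (mellin_kernel s)"
  unfolding mellin_kernel_def by (intro continuous_intros) auto

lemma mellin_integrand_bound:
  assumes "d > 0" "r \<ge> d" "norm (\<phi> r) \<le> K * r powr (- a)"
  shows "norm (mellin_kernel s r * \<phi> r) \<le> K * r powr (- (Re s + a + 1))"
proof -
  have "norm (mellin_kernel s r * \<phi> r) \<le> r powr (- Re s - 1) * (K * r powr (- a))"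
    using assms by (simp add: norm_mult norm_mellin_kernel mult_left_mono)
  also have "\<dots> = K * (r powr (- Re s - 1) * r powr (- a))" by simp
  also have "r powr (- Re s - 1) * r powr (- a) = r powr (- (Re s + a + 1))"
    by (subst powr_add[symmetric], rule arg_cong[where f="(powr) r"]) simp
  finally show ?thesis .
qed

lemma mellin_integrable:
  assumes d: "d > 0" and cont: "continuous_on {d..} \<phi>" and bnd: "\<And>r. r \<ge> d \<Longrightarrow> norm (\<phi> r) \<le> K * r powr (- a)"
    and s: "Re s > - a"
  shows "(\<lambda>r. mellin_kernel s r * \<phi> r) integrable_on {d..}"
proof (rule power_dominated_improper_integral(1)[OF d, where p="Re s + a + 1" and K=K])
  show "continuous_on {d..} (\<lambda>r. mellin_kernel s r * \<phi> r)"
    by (intro continuous_intros continuous_on_mellin_kernel d cont)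
  show "norm (mellin_kernel s r * \<phi> r) \<le> K * r powr (- (Re s + a + 1))" if "r \<ge> d" for r
    by (rule mellin_integrand_bound[where \<phi>=\<phi>, OF d that bnd[OF that]])
qed (use s in simp)

text \<open>The truncated integrals are entire and converge locally uniformly in the half plane of convergence.\<close>

lemma mellin_holomorphic:
  assumes d: "d > 0" and cont: "continuous_on {d..} \<phi>" and bnd: "\<And>r. r \<ge> d \<Longrightarrow> norm (\<phi> r) \<le> K * r powr (- a)"
  shows "(\<lambda>s. integral {d..} (\<lambda>r. mellin_kernel s r * \<phi> r)) holomorphic_on {s. Re s > - a}"
proof (rule holomorphic_uniform_sequence[where f="\<lambda>n s. integral {d..d + real n} (\<lambda>r. mellin_kernel s r * \<phi> r)"])
  show "open {s. Re s > - a}" by (rule open_halfspace_Re_gt)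
  have K: "K \<ge> 0"
  proof -
    have "0 \<le> K * d powr (- a)" using order_trans[OF norm_ge_zero bnd[of d]] by simp
    thus ?thesis using d by (simp add: zero_le_mult_iff)
  qed
  show "(\<lambda>s. integral {d..d + real n} (\<lambda>r. mellin_kernel s r * \<phi> r)) holomorphic_on {s. Re s > - a}" for n
  proof -
    have c1: "continuous_on {d..d + real n} (\<lambda>r. mellin_kernel s r * \<phi> r)" for s
      by (rule continuous_on_subset[of "{d..}"]) (use d cont in \<open>auto intro!: continuous_intros continuous_on_mellin_kernel\<close>)
    have c2: "continuous_on (UNIV \<times> {d..d + real n}) (\<lambda>p. \<phi> (snd p))"
      by (rule continuous_on_compose2[OF cont]) (auto intro: continuous_intros)
    have "(\<lambda>s. integral (cbox d (d + real n)) (\<lambda>r. mellin_kernel s r * \<phi> r)) holomorphic_on UNIV"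
    proof (rule leibniz_rule_holomorphic[where fx="\<lambda>s r. - complex_of_real (ln r) * mellin_kernel s r * \<phi> r"])
      fix s :: complex and r :: real
      show "((\<lambda>s. mellin_kernel s r * \<phi> r) has_field_derivative - complex_of_real (ln r) * mellin_kernel s r * \<phi> r) (at s within UNIV)"
        unfolding mellin_kernel_def by (rule derivative_eq_intros refl)+ (simp add: algebra_simps)
      show "(\<lambda>r. mellin_kernel s r * \<phi> r) integrable_on cbox d (d + real n)"
        using c1 by (simp add: integrable_continuous_interval)
    next
      show "continuous_on (UNIV \<times> cbox d (d + real n)) (\<lambda>(s, r). - complex_of_real (ln r) * mellin_kernel s r * \<phi> r)"
        unfolding mellin_kernel_def case_prod_unfold box_real
        by (intro continuous_intros c2) (use d in auto)
    qed simp
    thus ?thesis by (auto intro: holomorphic_on_subset)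
  qed
  fix x assume "x \<in> {s. Re s > - a}"
  hence x: "Re x + a > 0" by simp
  define \<delta> where "\<delta> = (Re x + a) / 2"
  have \<delta>: "\<delta> > 0" using x by (simp add: \<delta>_def)
  have low: "Re s \<ge> Re x - \<delta>" and upp: "Re s \<le> Re x + \<delta>" if "s \<in> cball x \<delta>" for s
    using abs_Re_le_cmod[of "s - x"] that by (auto simp: dist_norm norm_minus_commute)
  define C where "C = exp (2 * \<delta> * \<bar>ln d\<bar>)"
  have bound: "norm (mellin_kernel s r * \<phi> r) \<le> C * K * r powr (- (1 + \<delta>))"
    if s: "s \<in> cball x \<delta>" and r: "r \<ge> d" for s r
  proof -
    define h where "h = Re s - (Re x - \<delta>)"
    have h: "0 \<le> h" "h \<le> 2 * \<delta>" using low[OF s] upp[OF s] by (simp_all add: h_def)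
    have "norm (mellin_kernel s r * \<phi> r) \<le> K * r powr (- (Re s + a + 1))"
      by (rule mellin_integrand_bound[where \<phi>=\<phi>, OF d r bnd[OF r]])
    also have "- (Re s + a + 1) = - h + (- (1 + \<delta>))" by (simp add: h_def \<delta>_def field_simps)
    also have "r powr (- h + (- (1 + \<delta>))) = r powr (- h) * r powr (- (1 + \<delta>))" by (simp only: powr_add)
    also have "K * (r powr (- h) * r powr (- (1 + \<delta>))) \<le> K * (C * r powr (- (1 + \<delta>)))"
    proof (intro mult_left_mono mult_right_mono K)
      have "r powr (- h) \<le> d powr (- h)" using d r h by (intro powr_mono2') auto
      also have "\<dots> = exp (- h * ln d)" using d by (simp add: powr_def)
      also have "- h * ln d \<le> 2 * \<delta> * \<bar>ln d\<bar>"
      proof -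
        have "- h * ln d \<le> h * \<bar>ln d\<bar>" using h by (metis abs_ge_minus_self minus_mult_commute mult_left_mono)
        also have "\<dots> \<le> 2 * \<delta> * \<bar>ln d\<bar>" using h by (intro mult_right_mono) auto
        finally show ?thesis .
      qed
      finally show "r powr (- h) \<le> C" by (simp add: C_def)
    qed simp
    finally show ?thesis by (simp add: mult_ac)
  qed
  show "\<exists>\<delta>>0. cball x \<delta> \<subseteq> {s. Re s > - a} \<and>
      uniform_limit (cball x \<delta>) (\<lambda>n s. integral {d..d + real n} (\<lambda>r. mellin_kernel s r * \<phi> r))
        (\<lambda>s. integral {d..} (\<lambda>r. mellin_kernel s r * \<phi> r)) sequentially"
  proof (intro exI[of _ \<delta>] conjI \<delta>)
    show "cball x \<delta> \<subseteq> {s. Re s > - a}"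
    proof
      fix s assume "s \<in> cball x \<delta>"
      thus "s \<in> {s. Re s > - a}" using low[of s] x by (simp add: \<delta>_def field_simps)
    qed
    show "uniform_limit (cball x \<delta>) (\<lambda>n s. integral {d..d + real n} (\<lambda>r. mellin_kernel s r * \<phi> r))
        (\<lambda>s. integral {d..} (\<lambda>r. mellin_kernel s r * \<phi> r)) sequentially"
    proof (rule uniform_limitI)
      fix e :: real assume e: "e > 0"
      define \<tau> where "\<tau> = (\<lambda>n::nat. C * K * ((d + real n) powr (1 - (1 + \<delta>)) / ((1 + \<delta>) - 1)))"
      have "filterlim (\<lambda>n::nat. d + real n) at_top sequentially"
        by (rule filterlim_tendsto_add_at_top[OF tendsto_const filterlim_real_sequentially])
      hence "((\<lambda>n. (d + real n) powr (- \<delta>)) \<longlonglongrightarrow> 0)" using \<delta> by (intro tendsto_neg_powr) auto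
      from tendsto_mult[OF tendsto_const[of "C * K"] tendsto_divide[OF this tendsto_const[of "\<delta>"]]]
      have "\<tau> \<longlonglongrightarrow> 0" using \<delta> by (simp add: \<tau>_def)
      hence "\<forall>\<^sub>F n in sequentially. dist (\<tau> n) 0 < e" by (rule tendstoD) (rule e)
      thus "\<forall>\<^sub>F n in sequentially. \<forall>s\<in>cball x \<delta>.
          dist (integral {d..d + real n} (\<lambda>r. mellin_kernel s r * \<phi> r)) (integral {d..} (\<lambda>r. mellin_kernel s r * \<phi> r)) < e"
      proof eventually_elim
        case (elim n)
        show ?case
        proof
          fix s assume s: "s \<in> cball x \<delta>"
          have "norm (integral {d..} (\<lambda>r. mellin_kernel s r * \<phi> r) - integral {d..d + real n} (\<lambda>r. mellin_kernel s r * \<phi> r)) \<le> \<tau> n"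
            unfolding \<tau>_def
            by (rule power_dominated_improper_integral(2)[OF d])
               (use \<delta> d cont bound[OF s] in \<open>auto intro!: continuous_intros continuous_on_mellin_kernel\<close>)
          thus "dist (integral {d..d + real n} (\<lambda>r. mellin_kernel s r * \<phi> r)) (integral {d..} (\<lambda>r. mellin_kernel s r * \<phi> r)) < e"
            using elim by (simp add: dist_norm norm_minus_commute)
        qed
      qed
    qed
  qed
qed

definition log_power_term :: "complex \<Rightarrow> complex \<Rightarrow> real \<Rightarrow> real \<Rightarrow> complex" where
  "log_power_term p q b r = (p + q * complex_of_real (ln r)) * complex_of_real (r powr (- b))"

definition log_power_mellin :: "real \<Rightarrow> complex \<Rightarrow> complex \<Rightarrow> real \<Rightarrow> complex \<Rightarrow> complex" where
  "log_power_mellin d p q b s = exp (- (s + complex_of_real b) * complex_of_real (ln d)) *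
     (p / (s + complex_of_real b) + q * (complex_of_real (ln d) / (s + complex_of_real b) + 1 / (s + complex_of_real b)\<^sup>2))"

lemma continuous_on_log_power_term: "d > 0 \<Longrightarrow> continuous_on {d..} (log_power_term p q b)"
  unfolding log_power_term_def by (intro continuous_intros) auto

text \<open>
  The transform, as a function of its lower limit, is minus a primitive of the integrand and vanishes at
  infinity.
\<close>

lemma log_power_mellin_integral:
  assumes d: "d > 0" and s: "Re s + b > 0"
  shows "((\<lambda>r. mellin_kernel s r * log_power_term p q b r) has_integral log_power_mellin d p q b s) {d..}"
proof -
  define z where "z = s + complex_of_real b"
  have z: "Re z > 0" "z \<noteq> 0" using s by (auto simp: z_def complex_eq_iff)
  define G where "G = (\<lambda>r. - log_power_mellin r p q b s)"
  have Gd: "(G has_vector_derivative mellin_kernel s r * log_power_term p q b r) (at r within X)" if r: "r > 0" for r X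
  proof -
    define E where "E = (\<lambda>u. - (exp (- z * u) * (p / z + q * (u / z + 1 / z\<^sup>2))))"
    have "(E has_field_derivative (z * exp (- z * u) * (p / z + q * (u / z + 1 / z\<^sup>2)) - exp (- z * u) * (q / z))) (at u)" for u
      unfolding E_def by (rule derivative_eq_intros refl z)+ (use z in \<open>simp add: field_simps\<close>)
    moreover have "z * exp (- z * u) * (p / z + q * (u / z + 1 / z\<^sup>2)) - exp (- z * u) * (q / z) = exp (- z * u) * (p + q * u)" for u
      using z by (simp add: field_simps power2_eq_square)
    ultimately have E: "(E has_field_derivative exp (- z * u) * (p + q * u)) (at u within Y)" for u Y
      by (metis has_field_derivative_at_within)
    have "((\<lambda>r. complex_of_real (ln r)) has_vector_derivative complex_of_real (inverse r)) (at r within X)"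
      using r by (intro has_vector_derivative_of_real)
        (auto intro!: derivative_eq_intros simp: inverse_eq_divide)
    from field_vector_diff_chain_within[OF this E]
    have "((\<lambda>r. E (complex_of_real (ln r))) has_vector_derivative
        complex_of_real (inverse r) * (exp (- z * complex_of_real (ln r)) * (p + q * complex_of_real (ln r)))) (at r within X)"
      by (simp add: o_def)
    moreover have "(\<lambda>r. E (complex_of_real (ln r))) = G"
      by (rule ext) (simp add: E_def G_def log_power_mellin_def z_def)
    moreover have "complex_of_real (inverse r) * (exp (- z * complex_of_real (ln r)) * (p + q * complex_of_real (ln r))) =
        mellin_kernel s r * log_power_term p q b r"
    proof -
      have e: "complex_of_real r = exp (complex_of_real (ln r))" "complex_of_real (r powr (- b)) = exp (- complex_of_real b * complex_of_real (ln r))"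
        using r by (simp_all add: exp_of_real powr_def flip: of_real_mult of_real_minus)
      have "complex_of_real (inverse r) * exp (- z * complex_of_real (ln r)) = mellin_kernel s r * complex_of_real (r powr (- b))"
        unfolding mellin_kernel_def of_real_inverse e
        by (simp add: z_def algebra_simps flip: exp_minus exp_add)
      thus ?thesis by (simp add: log_power_term_def mult_ac)
    qed
    ultimately show ?thesis by simp
  qed
  have int: "((\<lambda>r. mellin_kernel s r * log_power_term p q b r) has_integral (G R - G d)) {d..R}" if "R \<ge> d" for R
    by (rule fundamental_theorem_of_calculus[OF that Gd]) (use d in auto)
  have lim: "(G \<longlongrightarrow> 0) at_top"
  proof (rule Lim_null_comparison)
    define A B where "A = norm (p / z) + norm q * norm (1 / z\<^sup>2)" and "B = norm q / norm z"
    show "\<forall>\<^sub>F R in at_top. norm (G R) \<le> R powr (- Re z) * (A + B * \<bar>ln R\<bar>)"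
      using eventually_gt_at_top[of 0]
    proof eventually_elim
      case (elim R)
      have "norm (G R) = R powr (- Re z) * norm (p / z + q * (complex_of_real (ln R) / z + 1 / z\<^sup>2))"
        using elim by (simp add: G_def log_power_mellin_def norm_mult powr_def flip: z_def)
      also have "norm (p / z + q * (complex_of_real (ln R) / z + 1 / z\<^sup>2)) \<le>
          norm (p / z) + norm q * (norm (complex_of_real (ln R) / z) + norm (1 / z\<^sup>2))"
        by (rule order_trans[OF norm_triangle_ineq]) (simp only: norm_mult add_left_mono mult_left_mono norm_triangle_ineq norm_ge_zero)
      also have "\<dots> = A + B * \<bar>ln R\<bar>" by (simp add: A_def B_def norm_divide algebra_simps)
      finally show ?case by (simp add: mult_left_mono)
    qed
    show "((\<lambda>R. R powr (- Re z) * (A + B * \<bar>ln R\<bar>)) \<longlongrightarrow> 0) at_top"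
      using z(1) by real_asymp
  qed
  have "((\<lambda>R. integral {d..R} (\<lambda>r. mellin_kernel s r * log_power_term p q b r)) \<longlongrightarrow> 0 - G d) at_top"
  proof (rule Lim_transform_eventually)
    show "((\<lambda>R. G R - G d) \<longlongrightarrow> 0 - G d) at_top" by (intro tendsto_intros lim)
    show "\<forall>\<^sub>F R in at_top. G R - G d = integral {d..R} (\<lambda>r. mellin_kernel s r * log_power_term p q b r)"
      using eventually_ge_at_top[of d] by eventually_elim (simp add: integral_unique[OF int])
  qed
  hence "((\<lambda>r. mellin_kernel s r * log_power_term p q b r) has_integral (0 - G d)) {d..}"
  proof (rule improper_has_integral[rotated])
    show "(\<lambda>r. mellin_kernel s r * log_power_term p q b r) integrable_on {d..R}" for R
      by (rule integrable_continuous_interval, rule continuous_on_subset[of "{d..}"])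
         (use d in \<open>auto intro!: continuous_intros continuous_on_mellin_kernel continuous_on_log_power_term\<close>)
  qed
  thus ?thesis by (simp add: G_def)
qed

lemma log_power_mellin_meromorphic: "log_power_mellin d p q b meromorphic_on UNIV"
  unfolding log_power_mellin_def
  by (intro meromorphic_intros analytic_on_imp_meromorphic_on analytic_intros)

text \<open>
  The remainder bound gives away a full power compared with the first omitted term. This absorbs the
  logarithm and any \<open>\<epsilon>\<close> in the exponent, and costs nothing because the truncation is arbitrary. At the
  index \<open>J\<close> of the exponent \<open>0\<close>, \<open>p J\<close> is the regularized limit and \<open>q J\<close> the coefficient of the logarithm.
\<close>

definition log_expansion :: "(nat \<Rightarrow> real) \<Rightarrow> (nat \<Rightarrow> complex) \<Rightarrow> (nat \<Rightarrow> complex) \<Rightarrow> (real \<Rightarrow> complex) \<Rightarrow> bool" where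
  "log_expansion \<beta> p q \<phi> \<longleftrightarrow> strict_mono \<beta> \<and> filterlim \<beta> at_top sequentially \<and>
     (\<forall>\<^sub>F N in sequentially.
        (\<lambda>r. \<phi> r - (\<Sum>j<N. log_power_term (p j) (q j) (\<beta> j) r)) \<in> O[at_top](\<lambda>r. complex_of_real (r powr (1 - \<beta> N))))"

lemma log_power_term_bigo:
  assumes "b \<ge> a"
  shows "log_power_term p q b \<in> O[at_top](\<lambda>r. complex_of_real (r powr (1 - a)))"
proof (rule bigoI)
  show "\<forall>\<^sub>F r in at_top. norm (log_power_term p q b r) \<le> (norm p + norm q) * norm (complex_of_real (r powr (1 - a)))"
    using eventually_ge_at_top[of 1]
  proof eventually_elim
    case (elim r)
    have l: "0 \<le> ln r" "ln r \<le> r" using elim ln_bound[of r] by auto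
    have "norm (log_power_term p q b r) \<le> (norm p + norm q * ln r) * r powr (- b)"
      unfolding log_power_term_def norm_mult
      using l order_trans[OF norm_triangle_ineq[of p "q * complex_of_real (ln r)"]]
      by (intro mult_mono) (auto simp: norm_mult)
    also have "\<dots> \<le> (norm p * r + norm q * r) * r powr (- a)"
    proof (rule mult_mono)
      have "norm p \<le> norm p * r" using elim mult_left_mono[of 1 r "norm p"] by simp
      moreover have "norm q * ln r \<le> norm q * r" using l by (intro mult_left_mono) auto
      ultimately show "norm p + norm q * ln r \<le> norm p * r + norm q * r" by (rule add_mono)
      show "r powr (- b) \<le> r powr (- a)" using elim assms by (intro powr_mono) auto
    qed (use elim l in auto)
    also have "\<dots> = (norm p + norm q) * (r powr 1 * r powr (- a))" using elim by (simp add: algebra_simps)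
    also have "r powr 1 * r powr (- a) = r powr (1 - a)" by (subst powr_add[symmetric]) simp
    finally show ?case by simp
  qed
qed

text \<open>
  A coarser truncation differs from a fine one by finitely many terms, each within the bound, so the
  bound holds for every \<open>N\<close>; by compactness it holds on all of \<open>[d, \<infinity>)\<close>. For \<open>N = 0\<close> it controls the
  growth of \<open>\<phi>\<close> itself.
\<close>

lemma log_expansion_remainder_bound:
  assumes ex: "log_expansion \<beta> p q \<phi>" and d: "d > 0" and cont: "continuous_on {d..} \<phi>"
  shows "\<exists>K. \<forall>r\<ge>d. norm (\<phi> r - (\<Sum>j<N. log_power_term (p j) (q j) (\<beta> j) r)) \<le> K * r powr (- (\<beta> N - 1))"
proof -
  define rem where "rem = (\<lambda>N r. \<phi> r - (\<Sum>j<N. log_power_term (p j) (q j) (\<beta> j) r))"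
  have mono: "\<beta> i \<le> \<beta> j" if "i \<le> j" for i j
    using ex that by (auto simp: log_expansion_def strict_mono_less_eq)
  obtain N' where N': "N' \<ge> N" "rem N' \<in> O[at_top](\<lambda>r. complex_of_real (r powr (1 - \<beta> N')))"
  proof -
    have "\<forall>\<^sub>F N' in sequentially. rem N' \<in> O[at_top](\<lambda>r. complex_of_real (r powr (1 - \<beta> N')))"
      using ex by (simp add: log_expansion_def rem_def)
    from eventually_happens[OF eventually_conj[OF this eventually_ge_at_top[of N]]]
    show ?thesis using that by auto
  qed
  have "(\<lambda>r. complex_of_real (r powr (1 - \<beta> N'))) \<in> O[at_top](\<lambda>r. complex_of_real (r powr (1 - \<beta> N)))"
  proof (rule bigoI[where c=1])
    show "\<forall>\<^sub>F r in at_top. norm (complex_of_real (r powr (1 - \<beta> N'))) \<le> 1 * norm (complex_of_real (r powr (1 - \<beta> N)))"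
      using eventually_ge_at_top[of 1] by eventually_elim (use mono[OF N'(1)] in \<open>auto intro!: powr_mono\<close>)
  qed
  hence b1: "rem N' \<in> O[at_top](\<lambda>r. complex_of_real (r powr (1 - \<beta> N)))"
    by (rule landau_o.big_trans[OF N'(2)])
  have b2: "(\<lambda>r. \<Sum>j\<in>{N..<N'}. log_power_term (p j) (q j) (\<beta> j) r) \<in> O[at_top](\<lambda>r. complex_of_real (r powr (1 - \<beta> N)))"
    by (intro big_sum_in_bigo log_power_term_bigo mono) auto
  have "rem N = (\<lambda>r. rem N' r + (\<Sum>j\<in>{N..<N'}. log_power_term (p j) (q j) (\<beta> j) r))"
  proof
    fix r
    have "{..<N'} = {..<N} \<union> {N..<N'}" using N'(1) by auto
    hence "(\<Sum>j<N'. log_power_term (p j) (q j) (\<beta> j) r) =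
        (\<Sum>j\<in>{..<N} \<union> {N..<N'}. log_power_term (p j) (q j) (\<beta> j) r)" by (rule arg_cong)
    also have "\<dots> = (\<Sum>j<N. log_power_term (p j) (q j) (\<beta> j) r) + (\<Sum>j\<in>{N..<N'}. log_power_term (p j) (q j) (\<beta> j) r)"
      by (subst sum.union_disjoint) auto
    finally show "rem N r = rem N' r + (\<Sum>j\<in>{N..<N'}. log_power_term (p j) (q j) (\<beta> j) r)"
      unfolding rem_def by simp
  qed
  hence "rem N \<in> O[at_top](\<lambda>r. complex_of_real (r powr (1 - \<beta> N)))" using sum_in_bigo(1)[OF b1 b2] by simp
  then obtain C where C: "C > 0" "\<forall>\<^sub>F r in at_top. norm (rem N r) \<le> C * norm (complex_of_real (r powr (1 - \<beta> N)))"
    by (rule landau_o.bigE)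
  then obtain R where R: "\<And>r. r \<ge> R \<Longrightarrow> norm (rem N r) \<le> C * r powr (1 - \<beta> N)"
    by (auto simp: eventually_at_top_linorder)
  define g where "g = (\<lambda>r. norm (rem N r) * r powr (\<beta> N - 1))"
  have contg: "continuous_on {d..max d R} g"
    unfolding g_def rem_def using d
    by (intro continuous_intros continuous_on_subset[OF cont] continuous_on_subset[OF continuous_on_log_power_term[OF d]]) auto
  have "bounded (g ` {d..max d R})"
    by (rule compact_imp_bounded[OF compact_continuous_image[OF contg compact_Icc]])
  then obtain K where K: "\<And>r. r \<in> {d..max d R} \<Longrightarrow> norm (g r) \<le> K" unfolding bounded_iff by blast
  have inv: "r powr (\<beta> N - 1) * r powr (- (\<beta> N - 1)) = 1" if "r \<ge> d" for r
    using that d by (simp flip: powr_add)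
  have "norm (rem N r) \<le> max K C * r powr (- (\<beta> N - 1))" if r: "r \<ge> d" for r
  proof (cases "r \<le> max d R")
    case True
    have "norm (rem N r) = g r * r powr (- (\<beta> N - 1))"
      using inv[OF r] by (simp add: g_def mult.assoc)
    also have "\<dots> \<le> max K C * r powr (- (\<beta> N - 1))"
      using K[of r] True r by (intro mult_right_mono) auto
    finally show ?thesis .
  next
    case False
    hence "norm (rem N r) \<le> C * r powr (- (\<beta> N - 1))" using R[of r] by simp
    also have "\<dots> \<le> max K C * r powr (- (\<beta> N - 1))" by (intro mult_right_mono) auto
    finally show ?thesis .
  qed
  thus ?thesis unfolding rem_def by blast
qed


text \<open>
  Continuations are thus determined by their values in a half plane, off a discrete set.
\<close>

lemma meromorphic_identity:
  assumes F: "F meromorphic_on UNIV" and G: "G meromorphic_on UNIV"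
    and eq: "\<And>s. Re s > \<sigma> \<Longrightarrow> F s = G s"
  shows "\<forall>\<^sub>F w in at z. F w = (G w :: complex)"
proof -
  have D: "(\<lambda>w. F w - G w) meromorphic_on UNIV" by (intro meromorphic_intros F G)
  have "\<not> (\<forall>\<^sub>F w in cosparse UNIV. F w - G w \<noteq> 0)"
  proof
    assume "\<forall>\<^sub>F w in cosparse UNIV. F w - G w \<noteq> 0"
    hence "\<forall>\<^sub>F w in at (complex_of_real (\<sigma> + 1)). F w - G w \<noteq> 0"
      by (rule eventually_cosparse_imp_eventually_at) simp
    moreover have "\<forall>\<^sub>F w in at (complex_of_real (\<sigma> + 1)). w \<in> {s. Re s > \<sigma>}"
      by (rule eventually_at_in_open'[OF open_halfspace_Re_gt]) simp
    ultimately have "\<forall>\<^sub>F w in at (complex_of_real (\<sigma> + 1)). False"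
      by eventually_elim (simp add: eq)
    thus False by simp
  qed
  hence "\<forall>\<^sub>F w in cosparse UNIV. F w - G w = 0"
    using meromorphic_imp_constant_or_avoid[OF D open_UNIV connected_UNIV, of 0] by blast
  hence "\<forall>\<^sub>F w in at z. F w - G w = 0" by (rule eventually_cosparse_imp_eventually_at) simp
  thus ?thesis by eventually_elim simp
qed

lemma laurent_constant_term:
  assumes F: "F meromorphic_on UNIV" and lim: "((\<lambda>s. F s - B / s) \<longlongrightarrow> C) (at 0)"
  shows "fls_nth (laurent_expansion F 0) 0 = C"
proof -
  have "(\<lambda>w. F (0 + w)) has_laurent_expansion laurent_expansion F 0"
    by (rule meromorphic_on_imp_has_laurent_expansion[OF F]) simp
  hence LF: "F has_laurent_expansion laurent_expansion F 0" by simp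
  have "(\<lambda>s. B * inverse s) has_laurent_expansion fls_const B * fls_X_inv"
    by (intro laurent_expansion_intros)
  from has_laurent_expansion_diff[OF LF this]
  have LG: "(\<lambda>s. F s - B / s) has_laurent_expansion laurent_expansion F 0 - fls_const B * fls_X_inv"
    by (simp add: divide_inverse)
  have "\<not> is_pole (\<lambda>s. F s - B / s) 0"
    using lim by (metis not_tendsto_and_filterlim_at_infinity is_pole_def at_neq_bot)
  hence sub: "fls_subdegree (laurent_expansion F 0 - fls_const B * fls_X_inv) \<ge> 0"
    using has_laurent_expansion_imp_is_pole_iff[of "\<lambda>s. F s - B / s" 0] LG by simp
  have "fls_nth (laurent_expansion F 0 - fls_const B * fls_X_inv) 0 = C"
    by (rule LIM_unique[OF has_laurent_expansion_imp_tendsto_0[OF LG sub] lim])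
  thus ?thesis by simp
qed

text \<open>
  Integration by parts moves the derivative off \<open>\<phi>\<close>; subtracting the first \<open>N\<close> terms of the expansion,
  whose Mellin transforms are explicit, continues the transform to \<open>Re s > 1 - \<beta> N\<close>. The factor \<open>s\<close> from
  the integration by parts reduces the double pole at \<open>0\<close> to a simple one, with constant term
  \<open>p J - \<phi> d\<close>, the regularized value of \<open>\<integral>\<^sub>d\<^sup>\<infinity> \<phi>' dr\<close>.
\<close>

lemma mellin_transform_of_derivative:
  assumes ex: "log_expansion \<beta> p q \<phi>" and d: "d > 0" and J: "\<beta> J = 0"
    and \<phi>': "\<And>r. r \<ge> d \<Longrightarrow> (\<phi> has_vector_derivative \<phi>' r) (at r within {d..})"
    and cont': "continuous_on {d..} \<phi>'"
  shows "\<exists>M. M meromorphic_on UNIV \<and>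
    (\<forall>s. Re s > 1 - \<beta> 0 \<longrightarrow> ((\<lambda>r. exp (- s * complex_of_real (ln r)) * \<phi>' r) has_integral M s) {d..}) \<and>
    ((\<lambda>s. M s - q J / s) \<longlongrightarrow> p J - \<phi> d) (at 0)"
proof -
  have cont: "continuous_on {d..} \<phi>"
    unfolding continuous_on_eq_continuous_within
    by (intro ballI has_vector_derivative_continuous[OF \<phi>']) simp
  have smono: "strict_mono \<beta>" and lim\<beta>: "filterlim \<beta> at_top sequentially"
    using ex by (simp_all add: log_expansion_def)
  have mono: "\<beta> i \<le> \<beta> j" if "i \<le> j" for i j using smono that by (simp add: strict_mono_less_eq)
  define rem where "rem = (\<lambda>N r. \<phi> r - (\<Sum>j<N. log_power_term (p j) (q j) (\<beta> j) r))"
  have contr: "continuous_on {d..} (rem N)" for N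
    unfolding rem_def by (intro continuous_intros cont continuous_on_log_power_term[OF d])
  have "\<exists>K. \<forall>r\<ge>d. norm (rem N r) \<le> K * r powr (- (\<beta> N - 1))" for N
    unfolding rem_def by (rule log_expansion_remainder_bound[OF ex d cont])
  then obtain K where K: "\<And>N r. r \<ge> d \<Longrightarrow> norm (rem N r) \<le> K N * r powr (- (\<beta> N - 1))" by metis
  define H where "H = (\<lambda>N s. integral {d..} (\<lambda>r. mellin_kernel s r * rem N r))"
  have half: "{s. Re s > - (\<beta> N - 1)} = {s. Re s > 1 - \<beta> N}" for N by auto
  have holH: "H N holomorphic_on {s. Re s > 1 - \<beta> N}" for N
    unfolding H_def half[symmetric] by (rule mellin_holomorphic[OF d contr K])
  have intH: "(\<lambda>r. mellin_kernel s r * rem N r) integrable_on {d..}" if "Re s > 1 - \<beta> N" for s N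
    by (rule mellin_integrable[OF d contr K]) (use that in auto)
  let ?T = "\<lambda>j s. log_power_mellin d (p j) (q j) (\<beta> j) s"
  define MN where "MN = (\<lambda>N s. s * ((\<Sum>j<N. ?T j s) + H N s) - exp (- s * complex_of_real (ln d)) * \<phi> d)"
  have step: "MN N s = MN (Suc N) s" if s: "Re s > 1 - \<beta> N" for N s
  proof -
    have s': "Re s > 1 - \<beta> (Suc N)" using mono[of N "Suc N"] s by simp
    have "((\<lambda>r. mellin_kernel s r * log_power_term (p N) (q N) (\<beta> N) r + mellin_kernel s r * rem (Suc N) r)
        has_integral (?T N s + H (Suc N) s)) {d..}"
      unfolding H_def
      by (intro has_integral_add log_power_mellin_integral[OF d] integrable_integral intH[OF s']) (use s in simp)
    moreover have "mellin_kernel s r * log_power_term (p N) (q N) (\<beta> N) r + mellin_kernel s r * rem (Suc N) r =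
        mellin_kernel s r * rem N r" for r
      by (simp add: rem_def algebra_simps)
    ultimately have "H N s = ?T N s + H (Suc N) s" by (simp add: H_def integral_unique)
    thus ?thesis by (simp add: MN_def)
  qed
  have consistent: "MN N s = MN N' s" if "N \<le> N'" "Re s > 1 - \<beta> N" for N N' s
    using that(1)
  proof (induction N' rule: dec_induct)
    case (step n)
    have "Re s > 1 - \<beta> n" using that(2) mono[OF step(1)] by linarith
    thus ?case using step(3) \<open>\<And>s N. Re s > 1 - \<beta> N \<Longrightarrow> MN N s = MN (Suc N) s\<close> by simp
  qed simp
  have exN: "\<exists>N. Re s > 1 - \<beta> N" for s
  proof -
    have "\<forall>\<^sub>F N in sequentially. \<beta> N > 1 - Re s" using lim\<beta> by (simp add: filterlim_at_top_dense)
    from eventually_happens[OF this] show ?thesis by (auto simp: algebra_simps)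
  qed
  \<comment> \<open>The continuations to the half planes agree where they overlap and are glued.\<close>
  define M where "M = (\<lambda>s. MN (LEAST N. Re s > 1 - \<beta> N) s)"
  have M_eq: "M s = MN N s" if s: "Re s > 1 - \<beta> N" for N s
    unfolding M_def
    by (rule consistent[OF Least_le[of "\<lambda>N. Re s > 1 - \<beta> N", OF s] LeastI[of "\<lambda>N. Re s > 1 - \<beta> N", OF s]])
  have mer: "M meromorphic_on UNIV"
    unfolding meromorphic_on_meromorphic_at[of M UNIV]
  proof
    fix z :: complex
    obtain N where N: "Re z > 1 - \<beta> N" using exN by blast
    have "H N analytic_on {z}"
      using holH[of N] N open_halfspace_Re_gt[of "1 - \<beta> N"] by (auto simp: analytic_at)
    hence Hm: "H N meromorphic_on {z}" by (rule analytic_on_imp_meromorphic_on)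
    have Tm: "?T j meromorphic_on {z}" for j
      by (rule meromorphic_on_subset[OF log_power_mellin_meromorphic]) simp
    have Em: "(\<lambda>s. exp (- s * complex_of_real (ln d)) * \<phi> d) meromorphic_on {z}"
      by (intro analytic_on_imp_meromorphic_on analytic_intros)
    have "MN N meromorphic_on {z}" unfolding MN_def by (intro meromorphic_intros Hm Tm Em)
    moreover have "\<forall>\<^sub>F w in at z. M w = MN N w"
    proof -
      have "\<forall>\<^sub>F w in at z. w \<in> {s. Re s > 1 - \<beta> N}"
        by (rule eventually_at_in_open'[OF open_halfspace_Re_gt]) (use N in simp)
      thus ?thesis by eventually_elim (simp add: M_eq)
    qed
    ultimately show "M meromorphic_on {z}"
      by (subst meromorphic_on_cong[where g="MN N" and B="{z}"]) auto
  qed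
  have integral: "((\<lambda>r. exp (- s * complex_of_real (ln r)) * \<phi>' r) has_integral M s) {d..}" if s: "Re s > 1 - \<beta> 0" for s
  proof -
    let ?e = "\<lambda>r. exp (- s * complex_of_real (ln r))"
    have rem0: "rem 0 = \<phi>" by (simp add: rem_def)
    have bnd: "norm (\<phi> r) \<le> K 0 * r powr (- (\<beta> 0 - 1))" if "r \<ge> d" for r using K[of r 0] that by (simp add: rem0)
    have Ms: "M s = s * integral {d..} (\<lambda>r. mellin_kernel s r * \<phi> r) - ?e d * \<phi> d"
      using M_eq[OF s] by (simp add: MN_def H_def rem0)
    have tail: "norm (integral {d..} (\<lambda>r. mellin_kernel s r * \<phi> r) - integral {d..R} (\<lambda>r. mellin_kernel s r * \<phi> r))
        \<le> K 0 * (R powr (1 - (Re s + (\<beta> 0 - 1) + 1)) / ((Re s + (\<beta> 0 - 1) + 1) - 1))" if "R \<ge> d" for R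
    proof (rule power_dominated_improper_integral(2)[OF d])
      show "continuous_on {d..} (\<lambda>r. mellin_kernel s r * \<phi> r)"
        by (intro continuous_intros continuous_on_mellin_kernel d cont)
      show "norm (mellin_kernel s r * \<phi> r) \<le> K 0 * r powr (- (Re s + (\<beta> 0 - 1) + 1))" if "r \<ge> d" for r
        by (rule mellin_integrand_bound[where \<phi>=\<phi>, OF d that bnd[OF that]])
    qed (use s that in auto)
    have lim1: "((\<lambda>R. integral {d..R} (\<lambda>r. mellin_kernel s r * \<phi> r)) \<longlongrightarrow> integral {d..} (\<lambda>r. mellin_kernel s r * \<phi> r)) at_top"
    proof (rule LIM_zero_cancel, rule Lim_null_comparison)
      show "\<forall>\<^sub>F R in at_top. norm (integral {d..R} (\<lambda>r. mellin_kernel s r * \<phi> r) - integral {d..} (\<lambda>r. mellin_kernel s r * \<phi> r))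
        \<le> K 0 * (R powr (1 - (Re s + (\<beta> 0 - 1) + 1)) / ((Re s + (\<beta> 0 - 1) + 1) - 1))"
        using eventually_ge_at_top[of d]
        by eventually_elim (subst norm_minus_commute, rule tail)
      have "((\<lambda>R. R powr (1 - (Re s + (\<beta> 0 - 1) + 1))) \<longlongrightarrow> 0) at_top"
        using s by (intro tendsto_neg_powr filterlim_ident) auto
      from tendsto_mult[OF tendsto_const[of "K 0"] tendsto_divide[OF this tendsto_const[of "(Re s + (\<beta> 0 - 1) + 1) - 1"]]]
      show "((\<lambda>R. K 0 * (R powr (1 - (Re s + (\<beta> 0 - 1) + 1)) / ((Re s + (\<beta> 0 - 1) + 1) - 1))) \<longlongrightarrow> 0) at_top"
        using s by simp
    qed
    have lim2: "((\<lambda>R. ?e R * \<phi> R) \<longlongrightarrow> 0) at_top"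
    proof (rule Lim_null_comparison)
      show "\<forall>\<^sub>F R in at_top. norm (?e R * \<phi> R) \<le> K 0 * R powr (- (Re s + \<beta> 0 - 1))"
        using eventually_ge_at_top[of d]
      proof eventually_elim
        case (elim R)
        have "norm (?e R) = R powr (- Re s)" using elim d by (simp add: powr_def)
        hence "norm (?e R * \<phi> R) \<le> R powr (- Re s) * (K 0 * R powr (- (\<beta> 0 - 1)))"
          using bnd[OF elim] by (simp add: norm_mult mult_left_mono)
        also have "\<dots> = K 0 * (R powr (- Re s) * R powr (- (\<beta> 0 - 1)))" by simp
        also have "R powr (- Re s) * R powr (- (\<beta> 0 - 1)) = R powr (- (Re s + \<beta> 0 - 1))"
          by (subst powr_add[symmetric], rule arg_cong[where f="(powr) R"]) simp
        finally show ?case .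
      qed
      have "((\<lambda>R. R powr (- (Re s + \<beta> 0 - 1))) \<longlongrightarrow> 0) at_top"
        using s by (intro tendsto_neg_powr filterlim_ident) auto
      from tendsto_mult[OF tendsto_const[of "K 0"] this]
      show "((\<lambda>R. K 0 * R powr (- (Re s + \<beta> 0 - 1))) \<longlongrightarrow> 0) at_top" by simp
    qed
    have e': "(?e has_vector_derivative - s * mellin_kernel s r) (at r within X)" if "r > 0" for r X
    proof -
      have "((\<lambda>r. complex_of_real (ln r)) has_vector_derivative complex_of_real (inverse r)) (at r within X)"
        using that by (intro has_vector_derivative_of_real) (auto intro!: derivative_eq_intros simp: inverse_eq_divide)
      from has_vector_derivative_mult_right[OF this, of "- s"]
      have "((\<lambda>r. - s * complex_of_real (ln r)) has_vector_derivative - s * complex_of_real (inverse r)) (at r within X)" .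
      from field_vector_diff_chain_within[OF this has_field_derivative_at_within[OF DERIV_exp]]
      have D: "(?e has_vector_derivative - s * complex_of_real (inverse r) * ?e r) (at r within X)" by (simp add: o_def)
      have "complex_of_real (inverse r) = exp (- complex_of_real (ln r))"
        using that by (simp add: exp_minus exp_of_real)
      hence "- s * complex_of_real (inverse r) * ?e r = - s * mellin_kernel s r"
        by (simp add: mellin_kernel_def algebra_simps flip: exp_add)
      thus ?thesis using D by (simp only:)
    qed
    have parts: "((\<lambda>r. ?e r * \<phi>' r) has_integral
        (?e R * \<phi> R - ?e d * \<phi> d + s * integral {d..R} (\<lambda>r. mellin_kernel s r * \<phi> r))) {d..R}" if R: "R \<ge> d" for R
    proof -
      have "((\<lambda>r. ?e r * \<phi>' r + - s * mellin_kernel s r * \<phi> r) has_integral (?e R * \<phi> R - ?e d * \<phi> d)) {d..R}"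
      proof (rule fundamental_theorem_of_calculus[OF R])
        fix r assume r: "r \<in> {d..R}"
        have "(\<phi> has_vector_derivative \<phi>' r) (at r within {d..R})"
          by (rule has_vector_derivative_within_subset[OF \<phi>']) (use r in auto)
        from has_vector_derivative_mult[OF e' this]
        show "((\<lambda>r. ?e r * \<phi> r) has_vector_derivative ?e r * \<phi>' r + - s * mellin_kernel s r * \<phi> r) (at r within {d..R})"
          using r d by auto
      qed
      moreover have "((\<lambda>r. s * (mellin_kernel s r * \<phi> r)) has_integral (s * integral {d..R} (\<lambda>r. mellin_kernel s r * \<phi> r))) {d..R}"
      proof (rule has_integral_mult_right[OF integrable_integral[OF integrable_continuous_interval]])
        have "continuous_on {d..} (\<lambda>r. mellin_kernel s r * \<phi> r)"
          by (intro continuous_intros continuous_on_mellin_kernel d cont)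
        thus "continuous_on {d..R} (\<lambda>r. mellin_kernel s r * \<phi> r)"
          by (rule continuous_on_subset) auto
      qed
      ultimately have "((\<lambda>r. (?e r * \<phi>' r + - s * mellin_kernel s r * \<phi> r) + s * (mellin_kernel s r * \<phi> r)) has_integral
        ((?e R * \<phi> R - ?e d * \<phi> d) + s * integral {d..R} (\<lambda>r. mellin_kernel s r * \<phi> r))) {d..R}"
        by (rule has_integral_add)
      thus ?thesis by (simp add: mult.assoc)
    qed
    show ?thesis
    proof (rule improper_has_integral)
      show "(\<lambda>r. ?e r * \<phi>' r) integrable_on {d..R}" for R
        by (rule integrable_continuous_interval, rule continuous_on_subset[of "{d..}"])
           (use d cont' in \<open>auto intro!: continuous_intros\<close>)
      show "((\<lambda>R. integral {d..R} (\<lambda>r. ?e r * \<phi>' r)) \<longlongrightarrow> M s) at_top"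
      proof (rule Lim_transform_eventually)
        have "((\<lambda>R. ?e R * \<phi> R - ?e d * \<phi> d + s * integral {d..R} (\<lambda>r. mellin_kernel s r * \<phi> r)) \<longlongrightarrow>
            0 - ?e d * \<phi> d + s * integral {d..} (\<lambda>r. mellin_kernel s r * \<phi> r)) at_top"
          by (intro tendsto_intros lim1 lim2)
        thus "((\<lambda>R. ?e R * \<phi> R - ?e d * \<phi> d + s * integral {d..R} (\<lambda>r. mellin_kernel s r * \<phi> r)) \<longlongrightarrow> M s) at_top"
          by (simp add: Ms)
        show "\<forall>\<^sub>F R in at_top. ?e R * \<phi> R - ?e d * \<phi> d + s * integral {d..R} (\<lambda>r. mellin_kernel s r * \<phi> r) =
            integral {d..R} (\<lambda>r. ?e r * \<phi>' r)"
          using eventually_ge_at_top[of d] by eventually_elim (rule integral_unique[OF parts, symmetric])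
      qed
    qed
  qed
  have "((\<lambda>s. M s - q J / s) \<longlongrightarrow> p J - \<phi> d) (at 0)"
  proof -
    obtain N where N: "Re 0 > 1 - \<beta> N" using exN by blast
    have JN: "J < N" using N J mono[of N J] by (cases "J < N") auto
    define u where "u = complex_of_real (ln d)"
    have H0: "isCont (H N) 0"
      using holH[of N] N open_halfspace_Re_gt[of "1 - \<beta> N"]
      by (auto intro!: holomorphic_on_imp_continuous_on continuous_on_interior simp: interior_open)
    have T0: "((\<lambda>s. ?T j s) \<longlongrightarrow> ?T j 0) (at 0)" if "j \<noteq> J" for j
    proof -
      have "\<beta> j \<noteq> 0" using smono that J by (metis strict_mono_eq)
      thus ?thesis unfolding log_power_mellin_def by (intro tendsto_intros) auto
    qed
    have lim1: "((\<lambda>s. s * ((\<Sum>j\<in>{..<N} - {J}. ?T j s) + H N s)) \<longlongrightarrow> 0 * ((\<Sum>j\<in>{..<N} - {J}. ?T j 0) + H N 0)) (at 0)"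
      using H0 by (intro tendsto_intros T0) (auto simp: isCont_def)
    have lim2: "((\<lambda>s. (exp (- s * u) - 1) / s) \<longlongrightarrow> - u) (at 0)"
    proof -
      have "((\<lambda>s. exp (- s * u)) has_field_derivative - u) (at 0)"
        by (rule derivative_eq_intros refl)+ simp
      thus ?thesis by (simp add: has_field_derivative_iff)
    qed
    have lim3: "((\<lambda>s. exp (- s * u) * (p J + q J * u)) \<longlongrightarrow> exp (- 0 * u) * (p J + q J * u)) (at 0)"
      "((\<lambda>s. exp (- s * u) * \<phi> d) \<longlongrightarrow> exp (- 0 * u) * \<phi> d) (at 0)"
      by (intro tendsto_intros)+
    have "((\<lambda>s. s * ((\<Sum>j\<in>{..<N} - {J}. ?T j s) + H N s) + (exp (- s * u) * (p J + q J * u) + q J * ((exp (- s * u) - 1) / s)) - exp (- s * u) * \<phi> d) \<longlongrightarrow>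
       0 * ((\<Sum>j\<in>{..<N} - {J}. ?T j 0) + H N 0) + (exp (- 0 * u) * (p J + q J * u) + q J * (- u)) - exp (- 0 * u) * \<phi> d) (at 0)"
      by (intro tendsto_add tendsto_diff tendsto_mult lim1 lim2 lim3 tendsto_const)
    hence lim: "((\<lambda>s. s * ((\<Sum>j\<in>{..<N} - {J}. ?T j s) + H N s) + (exp (- s * u) * (p J + q J * u) + q J * ((exp (- s * u) - 1) / s)) - exp (- s * u) * \<phi> d) \<longlongrightarrow> p J - \<phi> d) (at 0)"
      by simp
    have "\<forall>\<^sub>F s in at 0. s \<in> {s. Re s > 1 - \<beta> N}"
      by (rule eventually_at_in_open'[OF open_halfspace_Re_gt]) (use N in simp)
    moreover have "\<forall>\<^sub>F s in at (0::complex). s \<noteq> 0" by (simp add: eventually_at_filter)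
    ultimately have "\<forall>\<^sub>F s in at 0. s * ((\<Sum>j\<in>{..<N} - {J}. ?T j s) + H N s) + (exp (- s * u) * (p J + q J * u) + q J * ((exp (- s * u) - 1) / s)) - exp (- s * u) * \<phi> d = M s - q J / s"
    proof eventually_elim
      case (elim s)
      have TJ: "s * ?T J s = exp (- s * u) * (p J + q J * u) + q J * (exp (- s * u) / s)"
        using elim(2) by (simp add: log_power_mellin_def J u_def field_simps power2_eq_square)
      have "(\<Sum>j<N. ?T j s) = ?T J s + (\<Sum>j\<in>{..<N} - {J}. ?T j s)"
        using JN by (intro sum.remove) auto
      hence "M s = s * ((\<Sum>j\<in>{..<N} - {J}. ?T j s) + H N s) + s * ?T J s - exp (- s * u) * \<phi> d"
        using M_eq[of N s] elim(1) by (simp add: MN_def u_def algebra_simps)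
      thus ?case using elim(2) unfolding TJ by (simp add: diff_divide_distrib right_diff_distrib)
    qed
    thus ?thesis by (rule Lim_transform_eventually[OF lim])
  qed
  thus ?thesis
    by (intro exI[of _ M] conjI allI impI mer integral)
qed

text \<open>
  Both expansions describe the same Mellin transform, whose residue and constant term at \<open>0\<close> they give.
\<close>

lemma log_expansion_unique:
  assumes ex: "log_expansion \<beta> p q \<phi>" "\<beta> J = 0" and ex': "log_expansion \<beta>' p' q' \<phi>" "\<beta>' J' = 0" and d: "d > 0"
    and \<phi>': "\<And>r. r \<ge> d \<Longrightarrow> (\<phi> has_vector_derivative \<phi>' r) (at r within {d..})"
    and cont': "continuous_on {d..} \<phi>'"
  shows "p J = p' J'" "q J = q' J'"
proof -
  have "\<exists>M. M meromorphic_on UNIV \<and> (\<forall>s. Re s > 1 - \<beta> 0 \<longrightarrow> ((\<lambda>r. exp (- s * complex_of_real (ln r)) * \<phi>' r) has_integral M s) {d..}) \<and> ((\<lambda>s. M s - q J / s) \<longlongrightarrow> p J - \<phi> d) (at 0)"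
    by (rule mellin_transform_of_derivative[OF ex(1) d ex(2) \<phi>' cont'])
  then obtain M where M: "M meromorphic_on UNIV"
    "\<forall>s. Re s > 1 - \<beta> 0 \<longrightarrow> ((\<lambda>r. exp (- s * complex_of_real (ln r)) * \<phi>' r) has_integral M s) {d..}"
    "((\<lambda>s. M s - q J / s) \<longlongrightarrow> p J - \<phi> d) (at 0)"
    by (elim exE conjE) (rule that)
  have "\<exists>M. M meromorphic_on UNIV \<and> (\<forall>s. Re s > 1 - \<beta>' 0 \<longrightarrow> ((\<lambda>r. exp (- s * complex_of_real (ln r)) * \<phi>' r) has_integral M s) {d..}) \<and> ((\<lambda>s. M s - q' J' / s) \<longlongrightarrow> p' J' - \<phi> d) (at 0)"
    by (rule mellin_transform_of_derivative[OF ex'(1) d ex'(2) \<phi>' cont'])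
  then obtain M' where M': "M' meromorphic_on UNIV"
    "\<forall>s. Re s > 1 - \<beta>' 0 \<longrightarrow> ((\<lambda>r. exp (- s * complex_of_real (ln r)) * \<phi>' r) has_integral M' s) {d..}"
    "((\<lambda>s. M' s - q' J' / s) \<longlongrightarrow> p' J' - \<phi> d) (at 0)"
    by (elim exE conjE) (rule that)
  have "\<forall>\<^sub>F s in at 0. M s = M' s"
  proof (rule meromorphic_identity[OF M(1) M'(1)])
    fix s assume "Re s > max (1 - \<beta> 0) (1 - \<beta>' 0)"
    thus "M s = M' s" using has_integral_unique[OF M(2)[rule_format] M'(2)[rule_format]] by simp
  qed
  hence "\<forall>\<^sub>F s in at 0. M' s - q' J' / s = M s - q' J' / s" by eventually_elim simp
  from Lim_transform_eventually[OF M'(3) this]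
  have lim: "((\<lambda>s. M s - q' J' / s) \<longlongrightarrow> p' J' - \<phi> d) (at 0)" .
  have mult: "((\<lambda>s. s * M s) \<longlongrightarrow> b) (at 0)" if "((\<lambda>s. M s - b / s) \<longlongrightarrow> c) (at 0)" for b c
  proof (rule Lim_transform_eventually)
    have "((\<lambda>s. s * (M s - b / s) + b) \<longlongrightarrow> 0 * c + b) (at 0)" by (intro tendsto_intros that)
    thus "((\<lambda>s. s * (M s - b / s) + b) \<longlongrightarrow> b) (at 0)" by simp
    show "\<forall>\<^sub>F s in at 0. s * (M s - b / s) + b = s * M s"
      by (simp add: eventually_at_filter right_diff_distrib)
  qed
  show q: "q J = q' J'" by (rule LIM_unique[OF mult[OF M(3)] mult[OF lim]])
  have "p J - \<phi> d = p' J' - \<phi> d" by (rule LIM_unique[OF M(3)[unfolded q] lim])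
  thus "p J = p' J'" by simp
qed

section \<open>Regularized limits in the sectors\<close>

text \<open>
  In the coordinate \<open>w = log \<lambda>\<close> with \<open>Im w\<close> near \<open>\<theta>\<close>, all branches of logarithms and powers of \<open>-\<lambda>\<close> become
  explicit entire functions.
\<close>

lemma cut_Ln_minus_exp:
  assumes "\<bar>Im w - \<theta>\<bar> < pi"
  shows "cut_Ln \<theta> (- exp w) = w - \<i> * complex_of_real pi"
proof -
  have "Arg2pi (- exp w * cis (- \<theta>)) = Im w - \<theta> + pi"
  proof (rule Arg2pi_unique[of "exp (Re w)"])
    have "exp w = complex_of_real (exp (Re w)) * exp (\<i> * complex_of_real (Im w))"
      by (subst complex_eq[of w]) (simp add: exp_add exp_of_real)
    moreover have "exp (\<i> * complex_of_real (Im w - \<theta> + pi)) = exp (\<i> * complex_of_real (Im w)) * cis (- \<theta>) * (- 1)"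
      by (simp add: cis_conv_exp algebra_simps exp_add exp_diff exp_minus divide_simps)
    ultimately show "complex_of_real (exp (Re w)) * exp (\<i> * complex_of_real (Im w - \<theta> + pi)) = - exp w * cis (- \<theta>)"
      by simp
  qed (use assms in auto)
  hence "cut_Arg \<theta> (- exp w) = Im w - pi" by (simp add: cut_Arg_def)
  thus ?thesis by (simp add: cut_Ln_def complex_eq_iff)
qed

definition strip :: "real \<Rightarrow> real \<Rightarrow> real \<Rightarrow> complex set" where
  "strip \<theta> \<delta> X = {w. Re w > X \<and> \<bar>Im w - \<theta>\<bar> < \<delta>}"

lemma convex_strip: "convex (strip \<theta> \<delta> X)"
proof -
  have "strip \<theta> \<delta> X = {w. X < Re w} \<inter> ({w. Im w < \<theta> + \<delta>} \<inter> {w. \<theta> - \<delta> < Im w})"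
    by (auto simp: strip_def)
  thus ?thesis by (auto intro!: convex_Int convex_halfspace_Re_gt convex_halfspace_Im_lt convex_halfspace_Im_gt)
qed

lemma exp_polar: "exp w = complex_of_real (norm (exp w)) * cis (Im w)"
  by (simp add: exp_eq_polar norm_mult)

lemma exp_in_cut_sector: "\<bar>Im w - \<theta>\<bar> < \<delta> \<Longrightarrow> exp w \<in> cut_sector \<theta> \<delta> \<rho>"
  unfolding cut_sector_def using exp_polar by blast

lemma cut_sector_log:
  assumes "z \<in> cut_sector \<theta> \<delta> \<rho>" "norm z \<ge> \<rho>" "\<rho> > 0"
  shows "\<exists>w. z = exp w \<and> Re w = ln (norm z) \<and> \<bar>Im w - \<theta>\<bar> < \<delta>"
proof -
  obtain t where t: "\<bar>t - \<theta>\<bar> < \<delta>" "z = complex_of_real (norm z) * cis t"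
    using assms by (auto simp: cut_sector_def)
  have "norm z > 0" using assms by linarith
  hence "exp (Complex (ln (norm z)) t) = complex_of_real (norm z) * cis t"
    by (simp add: exp_eq_polar)
  thus ?thesis using t by (intro exI[of _ "Complex (ln (norm z)) t"]) simp
qed

lemma open_cut_sector:
  assumes "\<delta> \<le> pi / 2" "\<rho> > 0"
  shows "open (cut_sector \<theta> \<delta> \<rho>)"
proof -
  define S where "S = {w::complex. Im w < \<theta> + \<delta>} \<inter> {w. \<theta> - \<delta> < Im w}"
  have S: "w \<in> S \<longleftrightarrow> \<bar>Im w - \<theta>\<bar> < \<delta>" for w by (auto simp: S_def)
  have "open S" unfolding S_def by (intro open_Int open_halfspace_Im_lt open_halfspace_Im_gt)
  moreover have "inj_on exp S"
  proof (rule inj_onI)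
    fix w w' assume w: "w \<in> S" "w' \<in> S" and eq: "exp w = exp w'"
    have wb: "\<bar>Im w - \<theta>\<bar> < \<delta>" "\<bar>Im w' - \<theta>\<bar> < \<delta>" using w by (simp_all add: S)
    hence "\<bar>Im w - Im w'\<bar> < 2 * pi" using assms(1) pi_gt_zero by linarith
    thus "w = w'" by (rule exp_complex_eqI[OF _ eq])
  qed
  ultimately have "open (exp ` S)"
    by (intro open_mapping_thm3[of exp S]) (auto intro: holomorphic_intros)
  moreover have "cut_sector \<theta> \<delta> \<rho> = exp ` S \<union> ball 0 \<rho>"
  proof
    show "cut_sector \<theta> \<delta> \<rho> \<subseteq> exp ` S \<union> ball 0 \<rho>"
    proof
      fix z assume z: "z \<in> cut_sector \<theta> \<delta> \<rho>"
      show "z \<in> exp ` S \<union> ball 0 \<rho>"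
      proof (cases "norm z \<ge> \<rho>")
        case True
        then obtain w where "z = exp w" "\<bar>Im w - \<theta>\<bar> < \<delta>" using cut_sector_log[OF z _ assms(2)] by blast
        thus ?thesis using S by blast
      qed simp
    qed
    show "exp ` S \<union> ball 0 \<rho> \<subseteq> cut_sector \<theta> \<delta> \<rho>"
    proof (rule Un_least)
      show "exp ` S \<subseteq> cut_sector \<theta> \<delta> \<rho>" using S exp_in_cut_sector by blast
      show "ball 0 \<rho> \<subseteq> cut_sector \<theta> \<delta> \<rho>" by (auto simp: cut_sector_def)
    qed
  qed
  ultimately show ?thesis by auto
qed

text \<open>
  A function on a half strip whose derivative decays exponentially converges, at the same rate, to one
  constant: unit steps to the right are summable, and points at bounded distance are asymptotically
  identified by the mean value inequality.
\<close>

lemma decaying_derivative_limit: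
  fixes g :: "complex \<Rightarrow> complex"
  assumes g': "\<And>w. w \<in> strip \<theta> \<delta> X \<Longrightarrow> (g has_field_derivative g' w) (at w)"
    and bnd: "\<And>w. w \<in> strip \<theta> \<delta> X \<Longrightarrow> norm (g' w) \<le> C * exp (- a * Re w)"
    and a: "a > 0" and \<delta>: "\<delta> > 0"
  shows "\<exists>c. \<forall>w\<in>strip \<theta> \<delta> X. norm (g w - c) \<le> C / (1 - exp (- a)) * exp (- a * Re w)"
proof -
  let ?S = "strip \<theta> \<delta> X"
  have shift: "w + of_nat n \<in> ?S" if "w \<in> ?S" for w n using that by (auto simp: strip_def)
  have w0: "Complex (X + 1) \<theta> \<in> ?S" using \<delta> by (simp add: strip_def)
  have C: "C \<ge> 0"
  proof -
    have "0 \<le> C * exp (- a * Re (Complex (X + 1) \<theta>))" using order_trans[OF norm_ge_zero bnd[OF w0]] .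
    thus ?thesis by (simp add: zero_le_mult_iff)
  qed
  have lip: "norm (g w - g w') \<le> C * exp (- a * x) * norm (w - w')"
    if "w \<in> ?S" "w' \<in> ?S" "x \<le> Re w" "x \<le> Re w'" for w w' x
  proof (rule field_differentiable_bound[where S="?S \<inter> {w. Re w \<ge> x}" and f'=g'])
    show "convex (?S \<inter> {w. Re w \<ge> x})" by (intro convex_Int convex_strip convex_halfspace_Re_ge)
    show "(g has_field_derivative g' z) (at z within ?S \<inter> {w. Re w \<ge> x})" if "z \<in> ?S \<inter> {w. Re w \<ge> x}" for z
      using g'[of z] that by (auto intro: has_field_derivative_at_within)
    show "norm (g' z) \<le> C * exp (- a * x)" if "z \<in> ?S \<inter> {w. Re w \<ge> x}" for z
    proof -
      have "norm (g' z) \<le> C * exp (- a * Re z)" using bnd[of z] that by simp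
      also have "\<dots> \<le> C * exp (- a * x)" using that a C by (intro mult_left_mono) auto
      finally show ?thesis .
    qed
  qed (use that in auto)
  define q where "q = exp (- a)"
  have q: "0 < q" "q < 1" using a by (simp_all add: q_def)
  have ex: "exp (- a * (Re w + real n)) = exp (- a * Re w) * q ^ n" for w :: complex and n
    by (simp add: q_def algebra_simps flip: exp_add exp_of_nat_mult)
  have lim: "\<exists>c. (\<lambda>n. g (w + of_nat n)) \<longlonglongrightarrow> c \<and> norm (g w - c) \<le> C / (1 - q) * exp (- a * Re w)"
    if w: "w \<in> ?S" for w
  proof -
    define t where "t = (\<lambda>n. g (w + of_nat (Suc n)) - g (w + of_nat n))"
    have tn: "norm (t n) \<le> C * exp (- a * Re w) * q ^ n" for n
    proof -
      have "norm (t n) \<le> C * exp (- a * (Re w + real n)) * norm ((w + of_nat (Suc n)) - (w + of_nat n))"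
        unfolding t_def by (rule lip[OF shift[OF w] shift[OF w]]) simp_all
      also have "(w + of_nat (Suc n)) - (w + of_nat n) = 1" by simp
      finally show ?thesis unfolding ex by (simp only: norm_one mult_1_right mult.assoc)
    qed
    have geo: "(\<lambda>n. C * exp (- a * Re w) * q ^ n) sums (C * exp (- a * Re w) * (1 / (1 - q)))"
      by (intro sums_mult geometric_sums) (use q in simp)
    have sumt: "summable (\<lambda>n. norm (t n))"
      by (rule summable_comparison_test'[OF sums_summable[OF geo], of 0]) (use tn in simp)
    have tsum: "t sums suminf t" by (rule summable_sums[OF summable_norm_cancel[OF sumt]])
    have "(\<Sum>i<n. t i) = g (w + of_nat n) - g w" for n
      unfolding t_def using sum_lessThan_telescope[of "\<lambda>n. g (w + of_nat n)" n] by simp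
    hence "(\<lambda>n. g (w + of_nat n) - g w) \<longlonglongrightarrow> suminf t" using tsum by (simp add: sums_def)
    from tendsto_add[OF this tendsto_const[of "g w"]]
    have l: "(\<lambda>n. g (w + of_nat n)) \<longlonglongrightarrow> suminf t + g w" by simp
    have "norm (suminf t) \<le> (\<Sum>n. norm (t n))" by (rule summable_norm[OF sumt])
    also have "\<dots> \<le> (\<Sum>n. C * exp (- a * Re w) * q ^ n)"
      by (rule suminf_le[OF tn sumt sums_summable[OF geo]])
    also have "\<dots> = C / (1 - q) * exp (- a * Re w)" using geo by (simp add: sums_iff)
    finally have "norm (g w - (suminf t + g w)) \<le> C / (1 - q) * exp (- a * Re w)" by simp
    thus ?thesis using l by blast
  qed
  obtain c where c: "(\<lambda>n. g (Complex (X + 1) \<theta> + of_nat n)) \<longlonglongrightarrow> c" using lim[OF w0] by blast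
  have "norm (g w - c) \<le> C / (1 - q) * exp (- a * Re w)" if w: "w \<in> ?S" for w
  proof -
    obtain c' where c': "(\<lambda>n. g (w + of_nat n)) \<longlonglongrightarrow> c'" "norm (g w - c') \<le> C / (1 - q) * exp (- a * Re w)"
      using lim[OF w] by blast
    define x where "x = min (Re w) (X + 1)"
    have d: "norm (g (w + of_nat n) - g (Complex (X + 1) \<theta> + of_nat n)) \<le>
        C * exp (- a * x) * norm (w - Complex (X + 1) \<theta>) * q ^ n" for n
    proof -
      have "norm (g (w + of_nat n) - g (Complex (X + 1) \<theta> + of_nat n)) \<le>
          C * exp (- a * (x + real n)) * norm ((w + of_nat n) - (Complex (X + 1) \<theta> + of_nat n))"
        by (rule lip[OF shift[OF w] shift[OF w0]]) (simp_all add: x_def)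
      also have "exp (- a * (x + real n)) = exp (- a * x) * q ^ n"
        using ex[of "complex_of_real x" n] by simp
      finally show ?thesis by (simp add: mult_ac)
    qed
    have "(\<lambda>n. C * exp (- a * x) * norm (w - Complex (X + 1) \<theta>) * q ^ n) \<longlonglongrightarrow>
        C * exp (- a * x) * norm (w - Complex (X + 1) \<theta>) * 0"
      by (intro tendsto_mult tendsto_const LIMSEQ_power_zero) (use q in simp)
    hence "(\<lambda>n. g (w + of_nat n) - g (Complex (X + 1) \<theta> + of_nat n)) \<longlonglongrightarrow> 0"
      by (intro Lim_null_comparison[OF always_eventually, OF allI, OF d]) simp
    moreover have "(\<lambda>n. g (w + of_nat n) - g (Complex (X + 1) \<theta> + of_nat n)) \<longlonglongrightarrow> c' - c"
      by (rule tendsto_diff[OF c'(1) c])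
    ultimately have "0 = c' - c" by (rule LIMSEQ_unique)
    thus ?thesis using c'(2) by simp
  qed
  thus ?thesis unfolding q_def by blast
qed

lemma sector_bigoE:
  assumes "h \<in> O[sector_infinity \<theta> \<delta> \<rho>](\<lambda>z. complex_of_real (norm z powr e))"
  shows "\<exists>C X. \<forall>w\<in>strip \<theta> \<delta> X. norm (h (exp w)) \<le> C * exp (e * Re w)"
proof -
  obtain C where "\<forall>\<^sub>F z in sector_infinity \<theta> \<delta> \<rho>. norm (h z) \<le> C * norm (complex_of_real (norm z powr e))"
    using assms by (rule landau_o.bigE)
  then obtain b where b: "\<And>z. norm z \<ge> b \<Longrightarrow> z \<in> cut_sector \<theta> \<delta> \<rho> \<Longrightarrow> norm (h z) \<le> C * norm z powr e"
    unfolding sector_infinity_def eventually_inf_principal eventually_at_infinity by auto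
  have "norm (h (exp w)) \<le> C * exp (e * Re w)" if w: "w \<in> strip \<theta> \<delta> (ln (max b 1))" for w
  proof -
    have "ln (max b 1) \<le> Re w" using w by (simp add: strip_def)
    hence "exp (ln (max b 1)) \<le> exp (Re w)" by (simp only: exp_le_cancel_iff)
    hence "max b 1 \<le> exp (Re w)" by (subst (asm) exp_ln) auto
    hence "b \<le> norm (exp w)" by simp
    moreover have "exp w \<in> cut_sector \<theta> \<delta> \<rho>" using w by (intro exp_in_cut_sector) (simp add: strip_def)
    ultimately have "norm (h (exp w)) \<le> C * norm (exp w) powr e" by (rule b)
    thus ?thesis by (simp add: powr_def mult.commute)
  qed
  thus ?thesis by blast
qed

lemma sector_bigoI:
  assumes h: "\<And>w. w \<in> strip \<theta> \<delta> X \<Longrightarrow> norm (h (exp w)) \<le> C * exp (e * Re w)" and \<rho>: "\<rho> > 0"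
  shows "h \<in> O[sector_infinity \<theta> \<delta> \<rho>](\<lambda>z. complex_of_real (norm z powr e))"
proof (rule bigoI[where c=C])
  have "\<forall>z. norm z \<ge> max \<rho> (exp (X + 1)) \<longrightarrow> z \<in> cut_sector \<theta> \<delta> \<rho> \<longrightarrow> norm (h z) \<le> C * norm (complex_of_real (norm z powr e))"
  proof (intro allI impI)
    fix z :: complex assume z: "max \<rho> (exp (X + 1)) \<le> norm z" "z \<in> cut_sector \<theta> \<delta> \<rho>"
    have "norm z \<ge> \<rho>" using z(1) by simp
    then obtain w where w: "z = exp w" "Re w = ln (norm z)" "\<bar>Im w - \<theta>\<bar> < \<delta>"
      using cut_sector_log[OF z(2) _ \<rho>] by blast
    have "exp (X + 1) \<le> exp (Re w)" using z(1) w(1) by simp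
    hence "w \<in> strip \<theta> \<delta> X" using w(3) by (simp add: strip_def)
    from h[OF this] show "norm (h z) \<le> C * norm (complex_of_real (norm z powr e))"
      by (simp add: w(1) powr_def mult.commute)
  qed
  thus "\<forall>\<^sub>F z in sector_infinity \<theta> \<delta> \<rho>. norm (h z) \<le> C * norm (complex_of_real (norm z powr e))"
    unfolding sector_infinity_def eventually_inf_principal eventually_at_infinity
    by (intro exI[of _ "max \<rho> (exp (X + 1))"])
qed

text \<open>The value of an expansion term on the ray through \<open>\<theta>\<close>, in the variable \<open>r = |\<lambda>|\<^sup>2\<close>.\<close>

definition ray_coeff :: "real \<Rightarrow> real \<Rightarrow> complex \<Rightarrow> complex \<Rightarrow> complex" where
  "ray_coeff \<theta> e b0 b1 = exp (complex_of_real e * (\<i> * complex_of_real (\<theta> - pi))) * (b0 + b1 * (\<i> * complex_of_real (\<theta> - pi)))"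

lemma ray_exp:
  assumes "r > 0"
  shows "complex_of_real (sqrt r) * cis \<theta> = exp (complex_of_real (ln r / 2) + \<i> * complex_of_real \<theta>)"
proof -
  have "sqrt r = exp (ln r / 2)" using assms by (simp add: ln_sqrt[symmetric])
  hence "complex_of_real (sqrt r) = exp (complex_of_real (ln r / 2))" by (simp only: exp_of_real)
  thus ?thesis by (simp only: exp_add cis_conv_exp)
qed

lemma ray_term:
  fixes e \<theta> :: real
  assumes "r > 0"
  defines "v \<equiv> complex_of_real (ln r / 2) + \<i> * complex_of_real \<theta> - \<i> * complex_of_real pi"
  shows "exp (complex_of_real e * v) * (b0 + b1 * v) =
    log_power_term (ray_coeff \<theta> e b0 b1) (ray_coeff \<theta> e (b1 / 2) 0) (- e / 2) r"
proof -
  define u where "u = \<i> * complex_of_real (\<theta> - pi)"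
  have v: "v = u + complex_of_real (ln r / 2)" by (simp add: v_def u_def algebra_simps)
  have "exp (complex_of_real e * v) = exp (complex_of_real e * u) * exp (complex_of_real (e / 2 * ln r))"
    by (simp add: v algebra_simps flip: exp_add)
  also have "exp (complex_of_real (e / 2 * ln r)) = complex_of_real (r powr (e / 2))"
    using assms(1) by (simp only: exp_of_real) (simp add: powr_def)
  finally show ?thesis
    unfolding log_power_term_def ray_coeff_def u_def[symmetric] by (simp add: v algebra_simps)
qed

lemma cut_terms:
  assumes "\<bar>Im w - \<theta>\<bar> < pi"
  shows "(\<Sum>k\<le>1. b k * cut_power \<theta> (- exp w) a * cut_Ln \<theta> (- exp w) ^ k) =
    exp (complex_of_real a * (w - \<i> * complex_of_real pi)) * (b 0 + b (1::nat) * (w - \<i> * complex_of_real pi))"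
  unfolding cut_power_def cut_Ln_minus_exp[OF assms] by (simp add: algebra_simps)

text \<open>
  On the ray, \<open>log(-\<lambda>) = (log r) / 2 + i (\<theta> - \<pi>)\<close>. The imaginary part moves a multiple of the coefficient
  \<open>m\<close> of \<open>log(-\<lambda>)\<close> into the constant term; this shift accounts for the zeta term of the theorem.
\<close>

lemma regularized_limit_log_expansion:
  assumes reg: "has_regularized_limit \<theta> \<delta> \<rho> L c" and \<delta>: "0 < \<delta>"
  shows "\<exists>\<beta> p q J m. log_expansion \<beta> p q (\<lambda>r. L (complex_of_real (sqrt r) * cis \<theta>)) \<and> \<beta> J = 0 \<and>
    p J = c + m * (\<i> * complex_of_real (\<theta> - pi)) \<and> q J = m / 2"
proof -
  obtain \<alpha> J b m where ee: "expansion_exponents \<alpha> J" and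
    ex: "\<forall>\<^sub>F N in sequentially. \<forall>\<epsilon>>0.
           (\<lambda>z. L z - ((\<Sum>j\<in>{..<N} - {J}. \<Sum>k\<le>1. b j k * cut_power \<theta> (- z) (1 - \<alpha> j) * cut_Ln \<theta> (- z) ^ k)
                   + m * cut_Ln \<theta> (- z) + c))
             \<in> O[sector_infinity \<theta> \<delta> \<rho>](\<lambda>z. complex_of_real (norm z powr (1 - \<alpha> N + \<epsilon>)))"
    using reg unfolding has_regularized_limit_def by (elim exE conjE) (rule that)
  define \<beta> where "\<beta> = (\<lambda>j. (\<alpha> j - 1) / 2)"
  define p where "p = (\<lambda>j. if j = J then ray_coeff \<theta> 0 c m else ray_coeff \<theta> (1 - \<alpha> j) (b j 0) (b j 1))"
  define q where "q = (\<lambda>j. if j = J then ray_coeff \<theta> 0 (m / 2) 0 else ray_coeff \<theta> (1 - \<alpha> j) (b j 1 / 2) 0)"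
  have aJ: "\<alpha> J = 1" and am: "strict_mono \<alpha>" and al: "filterlim \<alpha> at_top sequentially"
    using ee by (simp_all add: expansion_exponents_def)
  have "log_expansion \<beta> p q (\<lambda>r. L (complex_of_real (sqrt r) * cis \<theta>))"
    unfolding log_expansion_def
  proof (intro conjI)
    show "strict_mono \<beta>" using am by (simp add: \<beta>_def strict_mono_def)
    show "filterlim \<beta> at_top sequentially"
      unfolding \<beta>_def by (rule filterlim_at_top_mult_tendsto_pos[where f="\<lambda>_. 1/2" and c="1/2", simplified])
        (auto intro: filterlim_tendsto_add_at_top[OF tendsto_const[of "-1"] al, simplified])
    show "\<forall>\<^sub>F N in sequentially. (\<lambda>r. L (complex_of_real (sqrt r) * cis \<theta>) - (\<Sum>j<N. log_power_term (p j) (q j) (\<beta> j) r))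
        \<in> O[at_top](\<lambda>r. complex_of_real (r powr (1 - \<beta> N)))"
      using ex eventually_gt_at_top[of J]
    proof eventually_elim
      case (elim N)
      define h where "h = (\<lambda>z. L z - ((\<Sum>j\<in>{..<N} - {J}. \<Sum>k\<le>1. b j k * cut_power \<theta> (- z) (1 - \<alpha> j) * cut_Ln \<theta> (- z) ^ k)
                   + m * cut_Ln \<theta> (- z) + c))"
      \<comment> \<open>The choice \<open>\<epsilon> = 2\<close> in the variable \<open>|\<lambda>|\<close> is the full power of \<open>r\<close> that a logarithmic expansion allows.\<close>
      have "h \<in> O[sector_infinity \<theta> \<delta> \<rho>](\<lambda>z. complex_of_real (norm z powr (1 - \<alpha> N + 2)))"
        unfolding h_def by (rule elim(1)[rule_format]) simp
      then obtain C X where CX: "\<And>w. w \<in> strip \<theta> \<delta> X \<Longrightarrow> norm (h (exp w)) \<le> C * exp ((1 - \<alpha> N + 2) * Re w)"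
        using sector_bigoE by blast
      show ?case
      proof (rule bigoI[where c=C])
        show "\<forall>\<^sub>F r in at_top. norm (L (complex_of_real (sqrt r) * cis \<theta>) - (\<Sum>j<N. log_power_term (p j) (q j) (\<beta> j) r))
            \<le> C * norm (complex_of_real (r powr (1 - \<beta> N)))"
          using eventually_gt_at_top[of "exp (2 * X)"]
        proof eventually_elim
          case (elim r)
          have r: "r > 0" using elim exp_gt_zero[of "2 * X"] by linarith
          define w where "w = complex_of_real (ln r / 2) + \<i> * complex_of_real \<theta>"
          have "2 * X < ln r" using elim r by (metis exp_less_cancel_iff exp_ln)
          hence w: "w \<in> strip \<theta> \<delta> X" using \<delta> by (simp add: w_def strip_def)
          have im: "\<bar>Im w - \<theta>\<bar> < pi" by (simp add: w_def)
          have z: "complex_of_real (sqrt r) * cis \<theta> = exp w" unfolding w_def by (rule ray_exp[OF r])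
          have tj: "(\<Sum>k\<le>1. b j k * cut_power \<theta> (- exp w) (1 - \<alpha> j) * cut_Ln \<theta> (- exp w) ^ k) =
              log_power_term (p j) (q j) (\<beta> j) r" if "j \<noteq> J" for j
            unfolding cut_terms[OF im] using ray_term[OF r, of "1 - \<alpha> j" \<theta> "b j 0" "b j 1"] that
            by (simp add: p_def q_def \<beta>_def w_def minus_divide_left)
          have tJ: "m * cut_Ln \<theta> (- exp w) + c = log_power_term (p J) (q J) (\<beta> J) r"
            unfolding cut_Ln_minus_exp[OF im] using ray_term[OF r, of 0 \<theta> c m]
            by (simp add: p_def q_def \<beta>_def aJ w_def add.commute)
          have "(\<Sum>j<N. log_power_term (p j) (q j) (\<beta> j) r) =
              log_power_term (p J) (q J) (\<beta> J) r + (\<Sum>j\<in>{..<N} - {J}. log_power_term (p j) (q j) (\<beta> j) r)"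
            using \<open>J < N\<close> by (intro sum.remove) auto
          also have "\<dots> = (\<Sum>j\<in>{..<N} - {J}. \<Sum>k\<le>1. b j k * cut_power \<theta> (- exp w) (1 - \<alpha> j) * cut_Ln \<theta> (- exp w) ^ k)
                   + m * cut_Ln \<theta> (- exp w) + c"
            using tJ tj by simp
          finally have "L (complex_of_real (sqrt r) * cis \<theta>) - (\<Sum>j<N. log_power_term (p j) (q j) (\<beta> j) r) = h (exp w)"
            unfolding z h_def by simp
          moreover have "norm (h (exp w)) \<le> C * exp ((1 - \<alpha> N + 2) * Re w)" by (rule CX[OF w])
          moreover have "exp ((1 - \<alpha> N + 2) * Re w) = r powr (1 - \<beta> N)"
            using r by (simp add: w_def powr_def \<beta>_def field_simps)
          ultimately show ?case by simp
        qed
      qed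
    qed
  qed
  moreover have "\<beta> J = 0" "p J = c + m * (\<i> * complex_of_real (\<theta> - pi))" "q J = m / 2"
    by (simp_all add: \<beta>_def aJ p_def q_def ray_coeff_def)
  ultimately show ?thesis by blast
qed

text \<open>
  In the coordinate \<open>w = log \<lambda>\<close>, with \<open>log(-\<lambda>) = w - i\<pi>\<close>, the trace expansion is integrated term by
  term. The remainder is integrated with the help of \<open>decaying_derivative_limit\<close>, and the constant it leaves is the same for
  all truncations because the omitted terms decay.
\<close>

lemma regularized_limit_exists:
  assumes \<delta>: "0 < \<delta>" "\<delta> \<le> pi / 2" and \<rho>: "\<rho> > 0"
    and L: "L holomorphic_on cut_sector \<theta> \<delta> \<rho>"
    and f: "\<And>z. z \<in> cut_sector \<theta> \<delta> \<rho> \<Longrightarrow> f z = - deriv L z"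
    and ex: "has_trace_expansion \<theta> \<delta> \<rho> f"
  shows "\<exists>c. has_regularized_limit \<theta> \<delta> \<rho> L c"
proof -
  obtain \<alpha> J b where ee: "expansion_exponents \<alpha> J" and
    exN: "\<forall>\<^sub>F N in sequentially. \<forall>\<epsilon>>0.
           (\<lambda>z. f z - ((\<Sum>j\<in>{..<N} - {J}. \<Sum>k\<le>1. b j k * cut_power \<theta> (- z) (- \<alpha> j) * cut_Ln \<theta> (- z) ^ k)
                   + b J 0 * cut_power \<theta> (- z) (- 1)))
             \<in> O[sector_infinity \<theta> \<delta> \<rho>](\<lambda>z. complex_of_real (norm z powr (- \<alpha> N + \<epsilon>)))"
    using ex unfolding has_trace_expansion_def by (elim exE conjE) (rule that)
  have aJ: "\<alpha> J = 1" and am: "strict_mono \<alpha>" and al: "filterlim \<alpha> at_top sequentially"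
    using ee by (simp_all add: expansion_exponents_def)
  have ane: "\<alpha> j \<noteq> 1" if "j \<noteq> J" for j using am that aJ by (metis strict_mono_eq)
  define \<kappa> where "\<kappa> = (\<lambda>j. complex_of_real (1 - \<alpha> j))"
  have \<kappa>: "\<kappa> j \<noteq> 0" if "j \<noteq> J" for j
    using ane[OF that] unfolding \<kappa>_def of_real_eq_0_iff by simp
  define B where "B = (\<lambda>j k::nat. if k = 0 then b j 0 / \<kappa> j - b j 1 / (\<kappa> j)\<^sup>2 else b j 1 / \<kappa> j)"
  define m where "m = b J 0"
  define V where "V = (\<lambda>w. w - \<i> * complex_of_real pi)"
  define T where "T = (\<lambda>j w. exp (\<kappa> j * V w) * (B j 0 + B j 1 * V w))"
  define g where "g = (\<lambda>N w. L (exp w) - ((\<Sum>j\<in>{..<N} - {J}. T j w) + m * V w))"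
  define rem where "rem = (\<lambda>N z. f z - ((\<Sum>j\<in>{..<N} - {J}. \<Sum>k\<le>1. b j k * cut_power \<theta> (- z) (- \<alpha> j) * cut_Ln \<theta> (- z) ^ k)
                   + b J 0 * cut_power \<theta> (- z) (- 1)))"
  have im: "\<bar>Im w - \<theta>\<bar> < pi" if "w \<in> strip \<theta> \<delta> X" for w X
    using that \<delta> pi_gt_zero by (simp add: strip_def)
  have Vw: "w - \<i> * complex_of_real pi = V w" for w by (simp add: V_def)
  have expV: "exp (V w) = - exp w" for w by (simp add: V_def exp_diff)
  have T': "(T j has_field_derivative exp (\<kappa> j * V w) * (b j 0 + b j 1 * V w)) (at w)" if "j \<noteq> J" for j w
  proof -
    have "(T j has_field_derivative (\<kappa> j * exp (\<kappa> j * V w) * (B j 0 + B j 1 * V w) + exp (\<kappa> j * V w) * B j 1)) (at w)"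
      unfolding T_def V_def by (rule derivative_eq_intros refl)+ (simp add: algebra_simps)
    moreover have "\<kappa> j * (B j 0 + B j 1 * V w) + B j 1 = b j 0 + b j 1 * V w"
      using \<kappa>[OF that] by (simp add: B_def field_simps power2_eq_square)
    hence "\<kappa> j * exp (\<kappa> j * V w) * (B j 0 + B j 1 * V w) + exp (\<kappa> j * V w) * B j 1 =
        exp (\<kappa> j * V w) * (b j 0 + b j 1 * V w)"
      by (metis (no_types, opaque_lifting) distrib_left mult.assoc mult.left_commute)
    ultimately show ?thesis by simp
  qed
  have g': "(g N has_field_derivative exp (V w) * rem N (exp w)) (at w)" if w: "w \<in> strip \<theta> \<delta> X" for N w X
  proof -
    have es: "exp w \<in> cut_sector \<theta> \<delta> \<rho>" using w by (intro exp_in_cut_sector) (simp add: strip_def)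
    have "(L has_field_derivative deriv L (exp w)) (at (exp w))"
      by (rule holomorphic_derivI[OF L open_cut_sector[OF \<delta>(2) \<rho>] es])
    from DERIV_chain2[OF this DERIV_exp]
    have Lw: "((\<lambda>w. L (exp w)) has_field_derivative exp (V w) * f (exp w)) (at w)"
      using f[OF es] by (simp add: expV mult.commute)
    have sum': "((\<lambda>w. \<Sum>j\<in>{..<N} - {J}. T j w) has_field_derivative
        (\<Sum>j\<in>{..<N} - {J}. exp (\<kappa> j * V w) * (b j 0 + b j 1 * V w))) (at w)"
      by (rule DERIV_sum) (rule T', simp)
    have mV: "((\<lambda>w. m * V w) has_field_derivative m) (at w)"
      unfolding V_def by (rule derivative_eq_intros refl)+ simp
    have "(g N has_field_derivative exp (V w) * f (exp w) -
        ((\<Sum>j\<in>{..<N} - {J}. exp (\<kappa> j * V w) * (b j 0 + b j 1 * V w)) + m)) (at w)"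
      unfolding g_def by (intro DERIV_diff DERIV_add Lw sum' mV)
    moreover have "exp (V w) * rem N (exp w) = exp (V w) * f (exp w) -
        ((\<Sum>j\<in>{..<N} - {J}. exp (\<kappa> j * V w) * (b j 0 + b j 1 * V w)) + m)"
    proof -
      have s: "exp (V w) * exp (complex_of_real (- \<alpha> j) * V w) = exp (\<kappa> j * V w)" for j
        by (simp add: \<kappa>_def algebra_simps flip: exp_add)
      have e0: "exp (V w) * (\<Sum>k\<le>1. b j k * cut_power \<theta> (- exp w) (- \<alpha> j) * cut_Ln \<theta> (- exp w) ^ k) =
          exp (\<kappa> j * V w) * (b j 0 + b j 1 * V w)" for j
        unfolding cut_terms[OF im[OF w]] Vw mult.assoc[symmetric] s ..
      have e1: "exp (V w) * (\<Sum>j\<in>{..<N} - {J}. \<Sum>k\<le>1. b j k * cut_power \<theta> (- exp w) (- \<alpha> j) * cut_Ln \<theta> (- exp w) ^ k) =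
          (\<Sum>j\<in>{..<N} - {J}. exp (\<kappa> j * V w) * (b j 0 + b j 1 * V w))"
        by (subst sum_distrib_left) (rule sum.cong[OF refl e0])
      have e2: "exp (V w) * (b J 0 * cut_power \<theta> (- exp w) (- 1)) = m"
        unfolding cut_power_def cut_Ln_minus_exp[OF im[OF w]] Vw m_def
        by (simp add: exp_minus)
      have "exp (V w) * rem N (exp w) = exp (V w) * f (exp w) -
          (exp (V w) * (\<Sum>j\<in>{..<N} - {J}. \<Sum>k\<le>1. b j k * cut_power \<theta> (- exp w) (- \<alpha> j) * cut_Ln \<theta> (- exp w) ^ k)
           + exp (V w) * (b J 0 * cut_power \<theta> (- exp w) (- 1)))"
        by (simp only: rem_def right_diff_distrib distrib_left)
      thus ?thesis unfolding e1 e2 .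
    qed
    ultimately show ?thesis by simp
  qed
  have good: "\<exists>c X C. \<forall>w\<in>strip \<theta> \<delta> X. norm (g N w - c) \<le> C * exp ((1 - \<alpha> N + \<epsilon>) * Re w)"
    if remN: "\<forall>\<epsilon>>0. rem N \<in> O[sector_infinity \<theta> \<delta> \<rho>](\<lambda>z. complex_of_real (norm z powr (- \<alpha> N + \<epsilon>)))"
      and \<epsilon>: "\<epsilon> > 0" "\<alpha> N - 1 - \<epsilon> > 0" for N \<epsilon>
  proof -
    obtain C X where CX: "\<And>w. w \<in> strip \<theta> \<delta> X \<Longrightarrow> norm (rem N (exp w)) \<le> C * exp ((- \<alpha> N + \<epsilon>) * Re w)"
      using sector_bigoE[OF remN[rule_format, OF \<epsilon>(1)]] by blast
    have "norm (exp (V w) * rem N (exp w)) \<le> C * exp (- (\<alpha> N - 1 - \<epsilon>) * Re w)" if w: "w \<in> strip \<theta> \<delta> X" for w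
    proof -
      have "norm (exp (V w) * rem N (exp w)) \<le> exp (Re w) * (C * exp ((- \<alpha> N + \<epsilon>) * Re w))"
        using CX[OF w] by (simp add: norm_mult expV mult_left_mono)
      also have "\<dots> = C * (exp (Re w) * exp ((- \<alpha> N + \<epsilon>) * Re w))" by simp
      also have "exp (Re w) * exp ((- \<alpha> N + \<epsilon>) * Re w) = exp (- (\<alpha> N - 1 - \<epsilon>) * Re w)"
        by (simp add: algebra_simps flip: exp_add)
      finally show ?thesis .
    qed
    hence "\<exists>c. \<forall>w\<in>strip \<theta> \<delta> X. norm (g N w - c) \<le> C / (1 - exp (- (\<alpha> N - 1 - \<epsilon>))) * exp (- (\<alpha> N - 1 - \<epsilon>) * Re w)"
      by (intro decaying_derivative_limit[OF g' _ \<epsilon>(2) \<delta>(1)])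
    then obtain c where "\<forall>w\<in>strip \<theta> \<delta> X. norm (g N w - c) \<le> C / (1 - exp (- (\<alpha> N - 1 - \<epsilon>))) * exp (- (\<alpha> N - 1 - \<epsilon>) * Re w)"
      by blast
    thus ?thesis by (intro exI[of _ c] exI[of _ X] exI[of _ "C / (1 - exp (- (\<alpha> N - 1 - \<epsilon>)))"]) (simp add: algebra_simps)
  qed
  define ray where "ray = (\<lambda>x. complex_of_real x + \<i> * complex_of_real \<theta>)"
  have ray: "ray x \<in> strip \<theta> \<delta> X" if "x > X" for x X using that \<delta> by (simp add: ray_def strip_def)
  have ray_lim: "((\<lambda>x. g N (ray x)) \<longlongrightarrow> c) at_top"
    if b: "\<And>w. w \<in> strip \<theta> \<delta> X \<Longrightarrow> norm (g N w - c) \<le> C * exp (e * Re w)" and e: "e < 0" for N c X C e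
  proof (rule LIM_zero_cancel, rule Lim_null_comparison)
    show "\<forall>\<^sub>F x in at_top. norm (g N (ray x) - c) \<le> C * exp (e * x)"
      using eventually_gt_at_top[of X] by eventually_elim (use b[OF ray] in \<open>simp add: ray_def\<close>)
    show "((\<lambda>x. C * exp (e * x)) \<longlongrightarrow> 0) at_top" using e by real_asymp
  qed
  have T_lim: "((\<lambda>x. T j (ray x)) \<longlongrightarrow> 0) at_top" if "\<alpha> j > 1" for j
  proof (rule Lim_null_comparison)
    define A where "A = norm (B j 0) + norm (B j 1) * \<bar>\<theta> - pi\<bar>"
    show "\<forall>\<^sub>F x in at_top. norm (T j (ray x)) \<le> exp ((1 - \<alpha> j) * x) * (A + norm (B j 1) * \<bar>x\<bar>)"
    proof (rule always_eventually, rule allI)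
      fix x
      have Vr: "V (ray x) = complex_of_real x + \<i> * complex_of_real (\<theta> - pi)" by (simp add: V_def ray_def algebra_simps)
      have nV: "norm (V (ray x)) \<le> \<bar>x\<bar> + \<bar>\<theta> - pi\<bar>"
        unfolding Vr by (rule order_trans[OF norm_triangle_ineq]) (simp add: norm_mult)
      have "norm (T j (ray x)) = exp ((1 - \<alpha> j) * x) * norm (B j 0 + B j 1 * V (ray x))"
        unfolding T_def norm_mult norm_exp_eq_Re \<kappa>_def Vr by simp
      also have "\<dots> \<le> exp ((1 - \<alpha> j) * x) * (norm (B j 0) + norm (B j 1) * (\<bar>x\<bar> + \<bar>\<theta> - pi\<bar>))"
        using nV by (intro mult_left_mono order_trans[OF norm_triangle_ineq]) (auto simp: norm_mult intro: mult_left_mono)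
      also have "\<dots> = exp ((1 - \<alpha> j) * x) * (A + norm (B j 1) * \<bar>x\<bar>)" by (simp add: A_def algebra_simps)
      finally show "norm (T j (ray x)) \<le> exp ((1 - \<alpha> j) * x) * (A + norm (B j 1) * \<bar>x\<bar>)" .
    qed
    show "((\<lambda>x. exp ((1 - \<alpha> j) * x) * (A + norm (B j 1) * \<bar>x\<bar>)) \<longlongrightarrow> 0) at_top"
      using that by real_asymp
  qed
  have "\<forall>\<^sub>F N in sequentially. \<alpha> N > 1" using al by (simp add: filterlim_at_top_dense)
  with exN have "\<forall>\<^sub>F N in sequentially. (\<forall>\<epsilon>>0. rem N \<in> O[sector_infinity \<theta> \<delta> \<rho>](\<lambda>z. complex_of_real (norm z powr (- \<alpha> N + \<epsilon>)))) \<and> \<alpha> N > 1"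
    unfolding rem_def by (rule eventually_conj)
  then obtain N0 where N0: "\<And>N \<epsilon>. N \<ge> N0 \<Longrightarrow> \<epsilon> > 0 \<Longrightarrow> rem N \<in> O[sector_infinity \<theta> \<delta> \<rho>](\<lambda>z. complex_of_real (norm z powr (- \<alpha> N + \<epsilon>)))"
    "\<And>N. N \<ge> N0 \<Longrightarrow> \<alpha> N > 1" unfolding eventually_sequentially by metis
  have lims: "\<exists>c X C. \<forall>w\<in>strip \<theta> \<delta> X. norm (g N w - c) \<le> C * exp ((1 - \<alpha> N + (\<alpha> N - 1) / 2) * Re w)" if "N \<ge> N0" for N
    by (rule good) (use N0 that in \<open>auto simp: field_simps\<close>)
  obtain c X0 C0 where c: "\<And>w. w \<in> strip \<theta> \<delta> X0 \<Longrightarrow> norm (g N0 w - c) \<le> C0 * exp ((1 - \<alpha> N0 + (\<alpha> N0 - 1) / 2) * Re w)"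
    using lims[of N0] by blast
  have c0: "((\<lambda>x. g N0 (ray x)) \<longlongrightarrow> c) at_top"
    by (rule ray_lim[OF c]) (use N0(2)[of N0] in \<open>simp_all add: field_simps\<close>)
  have cN: "((\<lambda>x. g N (ray x)) \<longlongrightarrow> c) at_top" if N: "N \<ge> N0" for N
  proof -
    have fin: "g N w = g N0 w - (\<Sum>j\<in>{N0..<N} - {J}. T j w)" for w
    proof -
      have "{..<N} - {J} = ({..<N0} - {J}) \<union> ({N0..<N} - {J})" using N by auto
      hence "(\<Sum>j\<in>{..<N} - {J}. T j w) = (\<Sum>j\<in>({..<N0} - {J}) \<union> ({N0..<N} - {J}). T j w)" by (rule arg_cong)
      also have "\<dots> = (\<Sum>j\<in>{..<N0} - {J}. T j w) + (\<Sum>j\<in>{N0..<N} - {J}. T j w)"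
        by (subst sum.union_disjoint) auto
      finally show ?thesis by (simp add: g_def)
    qed
    have "((\<lambda>x. g N0 (ray x) - (\<Sum>j\<in>{N0..<N} - {J}. T j (ray x))) \<longlongrightarrow> c - (\<Sum>j\<in>{N0..<N} - {J}. 0)) at_top"
      by (intro tendsto_diff c0 tendsto_sum T_lim N0(2)) simp
    thus ?thesis unfolding fin by simp
  qed
  have "has_regularized_limit \<theta> \<delta> \<rho> L c"
    unfolding has_regularized_limit_def
  proof (rule exI[of _ \<alpha>], rule exI[of _ J], rule exI[of _ B], rule exI[of _ m], intro conjI ee)
    show "\<forall>\<^sub>F N in sequentially. \<forall>\<epsilon>>0.
           (\<lambda>z. L z - ((\<Sum>j\<in>{..<N} - {J}. \<Sum>k\<le>1. B j k * cut_power \<theta> (- z) (1 - \<alpha> j) * cut_Ln \<theta> (- z) ^ k)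
                   + m * cut_Ln \<theta> (- z) + c))
             \<in> O[sector_infinity \<theta> \<delta> \<rho>](\<lambda>z. complex_of_real (norm z powr (1 - \<alpha> N + \<epsilon>)))"
      using eventually_ge_at_top[of N0]
    proof (eventually_elim, intro allI impI)
      fix N and \<epsilon> :: real assume N: "N0 \<le> N" and \<epsilon>: "\<epsilon> > 0"
      define \<epsilon>' where "\<epsilon>' = min \<epsilon> ((\<alpha> N - 1) / 2)"
      have e': "\<epsilon>' > 0" "\<alpha> N - 1 - \<epsilon>' > 0" "\<epsilon>' \<le> \<epsilon>" using \<epsilon> N0(2)[OF N] by (auto simp: \<epsilon>'_def field_simps min_def)
      have rN: "\<forall>\<epsilon>>0. rem N \<in> O[sector_infinity \<theta> \<delta> \<rho>](\<lambda>z. complex_of_real (norm z powr (- \<alpha> N + \<epsilon>)))"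
        using N0(1)[OF N] by blast
      obtain c' X C where c': "\<And>w. w \<in> strip \<theta> \<delta> X \<Longrightarrow> norm (g N w - c') \<le> C * exp ((1 - \<alpha> N + \<epsilon>') * Re w)"
        using good[OF rN e'(1,2)] by blast
      have "((\<lambda>x. g N (ray x)) \<longlongrightarrow> c') at_top" by (rule ray_lim[OF c']) (use e' in auto)
      hence cc: "c' = c" using cN[OF N] tendsto_unique[OF trivial_limit_at_top_linorder] by blast
      have C0: "C \<ge> 0"
      proof -
        have "0 \<le> C * exp ((1 - \<alpha> N + \<epsilon>') * Re (ray (X + 1)))"
          using order_trans[OF norm_ge_zero c'[OF ray[of X "X + 1"]]] by simp
        thus ?thesis by (simp add: zero_le_mult_iff)
      qed
      show "(\<lambda>z. L z - ((\<Sum>j\<in>{..<N} - {J}. \<Sum>k\<le>1. B j k * cut_power \<theta> (- z) (1 - \<alpha> j) * cut_Ln \<theta> (- z) ^ k)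
                   + m * cut_Ln \<theta> (- z) + c))
             \<in> O[sector_infinity \<theta> \<delta> \<rho>](\<lambda>z. complex_of_real (norm z powr (1 - \<alpha> N + \<epsilon>)))"
      proof (rule sector_bigoI[where X="max X 0" and C=C, OF _ \<rho>])
        fix w assume w: "w \<in> strip \<theta> \<delta> (max X 0)"
        hence wX: "w \<in> strip \<theta> \<delta> X" and w0: "Re w \<ge> 0" by (auto simp: strip_def)
        have "(\<Sum>j\<in>{..<N} - {J}. \<Sum>k\<le>1. B j k * cut_power \<theta> (- exp w) (1 - \<alpha> j) * cut_Ln \<theta> (- exp w) ^ k) = (\<Sum>j\<in>{..<N} - {J}. T j w)"
          unfolding cut_terms[OF im[OF w]] T_def V_def \<kappa>_def ..
        hence "L (exp w) - ((\<Sum>j\<in>{..<N} - {J}. \<Sum>k\<le>1. B j k * cut_power \<theta> (- exp w) (1 - \<alpha> j) * cut_Ln \<theta> (- exp w) ^ k)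
                   + m * cut_Ln \<theta> (- exp w) + c) = g N w - c'"
          unfolding cut_Ln_minus_exp[OF im[OF w]] cc g_def V_def by simp
        moreover have "norm (g N w - c') \<le> C * exp ((1 - \<alpha> N + \<epsilon>') * Re w)" by (rule c'[OF wX])
        moreover have "C * exp ((1 - \<alpha> N + \<epsilon>') * Re w) \<le> C * exp ((1 - \<alpha> N + \<epsilon>) * Re w)"
        proof -
          have "(1 - \<alpha> N + \<epsilon>') * Re w \<le> (1 - \<alpha> N + \<epsilon>) * Re w" using e'(3) w0 by (intro mult_right_mono) auto
          thus ?thesis using C0 by (intro mult_left_mono) auto
        qed
        ultimately show "norm (L (exp w) - ((\<Sum>j\<in>{..<N} - {J}. \<Sum>k\<le>1. B j k * cut_power \<theta> (- exp w) (1 - \<alpha> j) * cut_Ln \<theta> (- exp w) ^ k)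
                   + m * cut_Ln \<theta> (- exp w) + c)) \<le> C * exp ((1 - \<alpha> N + \<epsilon>) * Re w)" by simp
      qed
    qed
  qed
  thus ?thesis by blast
qed

section \<open>The values at the origin\<close>

lemma tendsto_simple_pole:
  fixes X :: "complex \<Rightarrow> complex"
  assumes "((\<lambda>s. X s - b / s) \<longlongrightarrow> x) (at 0)"
  shows "((\<lambda>s. s * X s) \<longlongrightarrow> b) (at 0)"
proof (rule Lim_transform_eventually)
  have "((\<lambda>s. s * (X s - b / s) + b) \<longlongrightarrow> 0 * x + b) (at 0)" by (intro tendsto_intros assms)
  thus "((\<lambda>s. s * (X s - b / s) + b) \<longlongrightarrow> b) (at 0)" by simp
  show "\<forall>\<^sub>F s in at 0. s * (X s - b / s) + b = s * X s"
    by (simp add: eventually_at_filter right_diff_distrib)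
qed

lemma tendsto_half: "filterlim (\<lambda>s::complex. s / 2) (at 0) (at 0)"
proof -
  have "((\<lambda>s::complex. s / 2) \<longlongrightarrow> 0 / 2) (at 0)" by (intro tendsto_intros) simp
  thus ?thesis by (simp add: filterlim_at eventually_at_filter)
qed

context nuclear_pair
begin

text \<open>
  The half-line parts of the two contour integrals are Mellin transforms of \<open>\<phi> \<plusminus> \<psi>\<close>, where \<open>\<phi>\<close> and \<open>\<psi>\<close>
  are the derivatives of the two logarithms along the imaginary half-axes. For the zeta function the zero of \<open>sin(\<pi>s)\<close>
  keeps only the residues; for the eta function the constant terms survive.
\<close>

lemma zeta_eta_values:
  assumes c: "0 < c" "c < \<rho>"
    and P: "P meromorphic_on UNIV" "((\<lambda>s. P s - p / s) \<longlongrightarrow> a) (at 0)"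
      "\<And>s. Re s > \<sigma> \<Longrightarrow> ((\<lambda>r. exp (- s * complex_of_real (ln r)) * \<phi> r) has_integral P s) {c\<^sup>2..}"
    and Q: "Q meromorphic_on UNIV" "((\<lambda>s. Q s - q / s) \<longlongrightarrow> b) (at 0)"
      "\<And>s. Re s > \<sigma> \<Longrightarrow> ((\<lambda>r. exp (- s * complex_of_real (ln r)) * \<psi> r) has_integral Q s) {c\<^sup>2..}"
    and \<phi>: "\<And>r. r > 0 \<Longrightarrow> \<phi> r = - \<i> * rtr (\<i> * complex_of_real (sqrt r)) / (2 * complex_of_real (sqrt r))"
    and \<psi>: "\<And>r. r > 0 \<Longrightarrow> \<psi> r = \<i> * rtr (- (\<i> * complex_of_real (sqrt r))) / (2 * complex_of_real (sqrt r))"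
    and L: "\<And>z. z \<in> ball 0 \<rho> \<Longrightarrow> (L has_field_derivative - rtr z) (at z)"
  shows "rel_zeta_at_0 pi (A\<^sub>1 O A\<^sub>1) (A\<^sub>2 O A\<^sub>2) = p + q"
    and "rel_eta A\<^sub>1 A\<^sub>2 = \<i> / complex_of_real pi * (a - b + L (\<i> * complex_of_real c) - L (- (\<i> * complex_of_real c)))"
proof -
  define d where "d = c\<^sup>2"
  have r0: "r > 0" if "r \<ge> d" for r using that c unfolding d_def by (smt (verit) zero_less_power)
  let ?pi = "complex_of_real pi"
  define cz where "cz = (\<lambda>s. integral {- pi..pi} (circle_integrand (*) s (\<lambda>\<mu>. zeta_density (csqrt \<mu>)) d))"
  define ce where "ce = (\<lambda>s. integral {- pi..pi} (circle_integrand (*) s (\<lambda>\<mu>. eta_density (csqrt \<mu>)) d))"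
  have cz: "cz holomorphic_on UNIV" "cz 0 = 0"
    unfolding cz_def d_def
    by (rule circle_integral_entire density_circle_continuous[OF c] circle_values(1)[OF c L])+
  have ce: "ce holomorphic_on UNIV" "ce (1 / 2) = - 2 * (L (\<i> * complex_of_real c) - L (- (\<i> * complex_of_real c)))"
    unfolding ce_def d_def
    by (rule circle_integral_entire density_circle_continuous[OF c] circle_values(2)[OF c L])+
  have zd: "zeta_density (csqrt (- complex_of_real r)) = \<phi> r + \<psi> r" if r: "r > 0" for r
  proof -
    have "csqrt (- complex_of_real r) = \<i> * complex_of_real (sqrt r)" using r by (simp add: csqrt_minus_real)
    thus ?thesis using r unfolding \<phi>[OF r] \<psi>[OF r] zeta_density_def by (simp add: divide_simps) (simp add: algebra_simps)
  qed
  have ed: "eta_density (csqrt (- complex_of_real r)) = \<i> * complex_of_real (sqrt r) * (\<phi> r - \<psi> r)" if r: "r > 0" for r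
  proof -
    have "csqrt (- complex_of_real r) = \<i> * complex_of_real (sqrt r)" using r by (simp add: csqrt_minus_real)
    thus ?thesis using r unfolding \<phi>[OF r] \<psi>[OF r] eta_density_def by (simp add: divide_simps) (simp add: algebra_simps)
  qed

  define Fz where "Fz = (\<lambda>s. sin (?pi * s) / ?pi * (P s + Q s) - \<i> / (2 * ?pi) * cz s)"
  have "cz analytic_on UNIV" using cz(1) by (simp add: analytic_on_open)
  hence cz_mer: "cz meromorphic_on UNIV" by (rule analytic_on_imp_meromorphic_on)
  have "(\<lambda>s. sin (?pi * s)) analytic_on UNIV" by (intro analytic_intros)
  hence sin_mer: "(\<lambda>s. sin (?pi * s)) meromorphic_on UNIV" by (rule analytic_on_imp_meromorphic_on)
  have Fz_mer: "Fz meromorphic_on UNIV"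
    unfolding Fz_def by (intro meromorphic_intros P(1) Q(1) cz_mer sin_mer)
  have Fz_trace: "trace_class_on UNIV (\<lambda>x. neg_power pi (A\<^sub>1 O A\<^sub>1) s x - neg_power pi (A\<^sub>2 O A\<^sub>2) s x)"
      "Fz s = trace_on UNIV (\<lambda>x. neg_power pi (A\<^sub>1 O A\<^sub>1) s x - neg_power pi (A\<^sub>2 O A\<^sub>2) s x)"
    if s: "Re s > max 3 \<sigma>" for s
  proof -
    have s2: "2 \<le> Re s" using s by simp
    show "trace_class_on UNIV (\<lambda>x. neg_power pi (A\<^sub>1 O A\<^sub>1) s x - neg_power pi (A\<^sub>2 O A\<^sub>2) s x)"
      by (rule zeta_trace(1)[OF c s2])
    have "((\<lambda>r. exp (- s * complex_of_real (ln r)) * \<phi> r + exp (- s * complex_of_real (ln r)) * \<psi> r) has_integral (P s + Q s)) {d..}"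
      unfolding d_def by (intro has_integral_add P(3) Q(3)) (use s in auto)
    hence "integral {d..} (\<lambda>r. exp (- s * complex_of_real (ln r)) * \<phi> r + exp (- s * complex_of_real (ln r)) * \<psi> r) = P s + Q s"
      by (rule integral_unique)
    moreover have "integral {d..} (\<lambda>r. exp (- s * complex_of_real (ln r)) * zeta_density (csqrt (- complex_of_real r))) =
        integral {d..} (\<lambda>r. exp (- s * complex_of_real (ln r)) * \<phi> r + exp (- s * complex_of_real (ln r)) * \<psi> r)"
    proof (rule integral_cong)
      fix r assume "r \<in> {d..}"
      hence r: "r > 0" using r0 by simp
      show "exp (- s * complex_of_real (ln r)) * zeta_density (csqrt (- complex_of_real r)) =
          exp (- s * complex_of_real (ln r)) * \<phi> r + exp (- s * complex_of_real (ln r)) * \<psi> r"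
        unfolding zd[OF r] by (rule distrib_left)
    qed
    ultimately show "Fz s = trace_on UNIV (\<lambda>x. neg_power pi (A\<^sub>1 O A\<^sub>1) s x - neg_power pi (A\<^sub>2 O A\<^sub>2) s x)"
      unfolding zeta_trace(2)[OF c s2] keyhole_scalar d_def[symmetric] Fz_def cz_def by simp
  qed
  have Fz_lim: "(Fz \<longlongrightarrow> p + q) (at 0)"
  proof -
    have sinc: "((\<lambda>s. sin (?pi * s) / s) \<longlongrightarrow> ?pi) (at 0)"
    proof -
      have "((\<lambda>s. sin (?pi * s)) has_field_derivative ?pi) (at 0)"
        by (rule derivative_eq_intros refl)+ simp
      thus ?thesis by (simp add: has_field_derivative_iff)
    qed
    have "isCont cz 0" using cz(1) by (simp add: holomorphic_on_imp_continuous_on continuous_on_eq_continuous_at[symmetric] continuous_on_interior[of UNIV])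
    hence "(cz \<longlongrightarrow> 0) (at 0)" using cz(2) by (simp add: isCont_def)
    hence "((\<lambda>s. sin (?pi * s) / s / ?pi * (s * P s + s * Q s) - \<i> / (2 * ?pi) * cz s) \<longlongrightarrow>
        ?pi / ?pi * (p + q) - \<i> / (2 * ?pi) * 0) (at 0)"
      by (intro tendsto_intros sinc tendsto_simple_pole[OF P(2)] tendsto_simple_pole[OF Q(2)]) simp_all
    hence "((\<lambda>s. sin (?pi * s) / s / ?pi * (s * P s + s * Q s) - \<i> / (2 * ?pi) * cz s) \<longlongrightarrow> p + q) (at 0)" by simp
    thus ?thesis
      by (rule Lim_transform_eventually) (simp add: eventually_at_filter Fz_def field_simps)
  qed
  \<comment> \<open>The formula for \<open>Fz\<close> takes an arbitrary value at its removable singularity \<open>0\<close>.\<close>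
  define G where "G = Fz(0 := p + q)"
  have GF: "\<forall>\<^sub>F s in at z. G s = Fz s" for z
  proof -
    have "\<forall>\<^sub>F s in at z. s \<noteq> 0" by (rule eventually_neq_at_within)
    thus ?thesis by eventually_elim (simp add: G_def)
  qed
  have G_mer: "G meromorphic_on UNIV"
    by (subst meromorphic_on_cong[where g=Fz and B=UNIV]) (auto simp: GF Fz_mer)
  have "(G \<longlongrightarrow> p + q) (at 0)"
    by (rule Lim_transform_eventually[OF Fz_lim]) (use GF[of 0] in eventually_elim, simp)
  hence "isCont G 0" by (simp add: isCont_def G_def)
  hence G_an: "G analytic_on {0}"
    by (rule meromorphic_at_isCont_imp_analytic[OF meromorphic_on_subset[OF G_mer subset_UNIV]])
  show "rel_zeta_at_0 pi (A\<^sub>1 O A\<^sub>1) (A\<^sub>2 O A\<^sub>2) = p + q"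
    unfolding rel_zeta_at_0_def
  proof (rule the_equality)
    have "continues_trace G (\<lambda>s x. neg_power pi (A\<^sub>1 O A\<^sub>1) s x - neg_power pi (A\<^sub>2 O A\<^sub>2) s x)"
      unfolding continues_trace_def
    proof (intro conjI G_mer exI[of _ "max 3 \<sigma>"] allI impI)
      fix s :: complex assume s: "Re s > max 3 \<sigma>"
      show "trace_class_on UNIV (\<lambda>x. neg_power pi (A\<^sub>1 O A\<^sub>1) s x - neg_power pi (A\<^sub>2 O A\<^sub>2) s x)" by (rule Fz_trace(1)[OF s])
      have "s \<noteq> 0" using s by auto
      thus "G s = trace_on UNIV (\<lambda>x. neg_power pi (A\<^sub>1 O A\<^sub>1) s x - neg_power pi (A\<^sub>2 O A\<^sub>2) s x)"
        using Fz_trace(2)[OF s] by (simp add: G_def)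
    qed
    moreover have "p + q = G 0" by (simp add: G_def)
    ultimately show "\<exists>F. continues_trace F (\<lambda>s x. neg_power pi (A\<^sub>1 O A\<^sub>1) s x - neg_power pi (A\<^sub>2 O A\<^sub>2) s x) \<and>
        F analytic_on {0} \<and> p + q = F 0" using G_an by (intro exI[of _ G] conjI)
  next
    fix v assume "\<exists>F. continues_trace F (\<lambda>s x. neg_power pi (A\<^sub>1 O A\<^sub>1) s x - neg_power pi (A\<^sub>2 O A\<^sub>2) s x) \<and>
        F analytic_on {0} \<and> v = F 0"
    then obtain F where F: "continues_trace F (\<lambda>s x. neg_power pi (A\<^sub>1 O A\<^sub>1) s x - neg_power pi (A\<^sub>2 O A\<^sub>2) s x)"
        "F analytic_on {0}" "v = F 0" by (elim exE conjE) (rule that)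
    from F(1) obtain \<tau> where \<tau>: "\<forall>s. Re s > \<tau> \<longrightarrow> trace_class_on UNIV (\<lambda>x. neg_power pi (A\<^sub>1 O A\<^sub>1) s x - neg_power pi (A\<^sub>2 O A\<^sub>2) s x)
          \<and> F s = trace_on UNIV (\<lambda>x. neg_power pi (A\<^sub>1 O A\<^sub>1) s x - neg_power pi (A\<^sub>2 O A\<^sub>2) s x)"
      unfolding continues_trace_def by (elim exE conjE) (rule that)
    have Fm: "F meromorphic_on UNIV" using F(1) by (simp add: continues_trace_def)
    have "\<forall>\<^sub>F s in at 0. Fz s = F s"
    proof (rule meromorphic_identity[OF Fz_mer Fm])
      fix s assume "Re s > max (max 3 \<sigma>) \<tau>"
      hence "Re s > max 3 \<sigma>" "Re s > \<tau>" by simp_all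
      thus "Fz s = F s" using \<tau> Fz_trace(2)[of s] by simp
    qed
    from Lim_transform_eventually[OF Fz_lim this]
    have "(F \<longlongrightarrow> p + q) (at 0)" .
    moreover have "(F \<longlongrightarrow> F 0) (at 0)" using analytic_at_imp_isCont[OF F(2)] by (simp add: isCont_def)
    ultimately show "v = p + q" unfolding F(3) by (rule LIM_unique[symmetric])
  qed

  define Fe where "Fe = (\<lambda>s. cos (?pi * (s / 2)) / ?pi * (\<i> * (P (s / 2) - Q (s / 2))) - \<i> / (2 * ?pi) * ce ((s + 1) / 2))"
  have half: "(\<lambda>s. H (s / 2)) meromorphic_on UNIV" if "H meromorphic_on UNIV" for H :: "complex \<Rightarrow> complex"
    by (rule meromorphic_on_compose[OF that]) (auto intro!: analytic_intros)
  have "(\<lambda>s. cos (?pi * (s / 2))) analytic_on UNIV" by (intro analytic_intros) auto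
  hence cos_mer: "(\<lambda>s. cos (?pi * (s / 2))) meromorphic_on UNIV" by (rule analytic_on_imp_meromorphic_on)
  have ce_an: "(\<lambda>s. ce ((s + 1) / 2)) analytic_on UNIV"
    using holomorphic_on_compose_gen[of "\<lambda>s. (s + 1) / 2" UNIV ce UNIV] ce(1)
    by (simp add: analytic_on_open o_def holomorphic_intros)
  have Fe_mer: "Fe meromorphic_on UNIV"
    unfolding Fe_def
    by (intro meromorphic_intros half[OF P(1)] half[OF Q(1)] cos_mer analytic_on_imp_meromorphic_on[OF ce_an])
  have Fe_trace: "trace_class_on UNIV (\<lambda>x. eta_operator A\<^sub>1 s x - eta_operator A\<^sub>2 s x)"
      "Fe s = trace_on UNIV (\<lambda>x. eta_operator A\<^sub>1 s x - eta_operator A\<^sub>2 s x)"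
    if s: "Re s > max 3 (2 * \<sigma>)" for s
  proof -
    have s3: "3 \<le> Re s" using s by simp
    show "trace_class_on UNIV (\<lambda>x. eta_operator A\<^sub>1 s x - eta_operator A\<^sub>2 s x)" by (rule eta_trace(1)[OF c s3])
    have "((\<lambda>r. \<i> * (exp (- (s / 2) * complex_of_real (ln r)) * \<phi> r - exp (- (s / 2) * complex_of_real (ln r)) * \<psi> r)) has_integral
        (\<i> * (P (s / 2) - Q (s / 2)))) {d..}"
      unfolding d_def by (intro has_integral_mult_right has_integral_diff P(3) Q(3)) (use s in auto)
    hence "integral {d..} (\<lambda>r. \<i> * (exp (- (s / 2) * complex_of_real (ln r)) * \<phi> r - exp (- (s / 2) * complex_of_real (ln r)) * \<psi> r)) =
        \<i> * (P (s / 2) - Q (s / 2))" by (rule integral_unique)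
    moreover have "integral {d..} (\<lambda>r. exp (- ((s + 1) / 2) * complex_of_real (ln r)) * eta_density (csqrt (- complex_of_real r))) =
        integral {d..} (\<lambda>r. \<i> * (exp (- (s / 2) * complex_of_real (ln r)) * \<phi> r - exp (- (s / 2) * complex_of_real (ln r)) * \<psi> r))"
    proof (rule integral_cong)
      fix r assume "r \<in> {d..}"
      hence r: "r > 0" using r0 by simp
      have "complex_of_real (sqrt r) = exp (complex_of_real (ln r / 2))"
        using ray_exp[OF r, of 0] by simp
      hence "exp (- ((s + 1) / 2) * complex_of_real (ln r)) * complex_of_real (sqrt r) = exp (- (s / 2) * complex_of_real (ln r))"
        by (simp add: algebra_simps add_divide_distrib flip: exp_add)
      thus "exp (- ((s + 1) / 2) * complex_of_real (ln r)) * eta_density (csqrt (- complex_of_real r)) =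
          \<i> * (exp (- (s / 2) * complex_of_real (ln r)) * \<phi> r - exp (- (s / 2) * complex_of_real (ln r)) * \<psi> r)"
        unfolding ed[OF r] right_diff_distrib[symmetric] by (metis mult.assoc mult.left_commute)
    qed
    moreover have "sin (?pi * ((s + 1) / 2)) = cos (?pi * (s / 2))"
      by (simp add: distrib_left add_divide_distrib sin_add)
    ultimately show "Fe s = trace_on UNIV (\<lambda>x. eta_operator A\<^sub>1 s x - eta_operator A\<^sub>2 s x)"
      unfolding eta_trace(2)[OF c s3] keyhole_scalar d_def[symmetric] Fe_def ce_def by simp
  qed
  define v where "v = \<i> / ?pi * (a - b + L (\<i> * complex_of_real c) - L (- (\<i> * complex_of_real c)))"
  define k where "k = \<i> / ?pi * (2 * (p - q))"
  have Fe_lim: "((\<lambda>s. Fe s - k / s) \<longlongrightarrow> v) (at 0)"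
  proof -
    have cosc: "((\<lambda>s. (cos (?pi * (s / 2)) - 1) / s) \<longlongrightarrow> 0) (at 0)"
    proof -
      have "((\<lambda>s. cos (?pi * (s / 2))) has_field_derivative 0) (at 0)"
        by (rule derivative_eq_intros refl | simp)+
      thus ?thesis by (simp add: has_field_derivative_iff)
    qed
    have cos1: "((\<lambda>s. cos (?pi * (s / 2))) \<longlongrightarrow> cos (?pi * (0 / 2))) (at 0)" by (intro tendsto_intros) simp
    have PQ: "((\<lambda>s. (P (s / 2) - p / (s / 2)) - (Q (s / 2) - q / (s / 2))) \<longlongrightarrow> a - b) (at 0)"
      by (intro tendsto_diff filterlim_compose[OF P(2) tendsto_half] filterlim_compose[OF Q(2) tendsto_half])
    have "isCont (\<lambda>s. ce ((s + 1) / 2)) 0" using ce_an by (intro analytic_at_imp_isCont) (rule analytic_on_subset, auto)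
    hence cel: "((\<lambda>s. ce ((s + 1) / 2)) \<longlongrightarrow> ce (1 / 2)) (at 0)" by (simp add: isCont_def)
    have "((\<lambda>s. \<i> / ?pi * (cos (?pi * (s / 2)) * ((P (s / 2) - p / (s / 2)) - (Q (s / 2) - q / (s / 2))))
          + k * ((cos (?pi * (s / 2)) - 1) / s) - \<i> / (2 * ?pi) * ce ((s + 1) / 2)) \<longlongrightarrow>
        \<i> / ?pi * (cos (?pi * (0 / 2)) * (a - b)) + k * 0 - \<i> / (2 * ?pi) * ce (1 / 2)) (at 0)"
      by (intro tendsto_add tendsto_diff tendsto_mult tendsto_const cos1 PQ cosc cel)
    also have "\<i> / ?pi * (cos (?pi * (0 / 2)) * (a - b)) + k * 0 - \<i> / (2 * ?pi) * ce (1 / 2) = v"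
      unfolding ce(2) v_def by (simp add: field_simps)
    finally show ?thesis
      by (rule Lim_transform_eventually) (simp add: eventually_at_filter Fe_def k_def field_simps)
  qed
  show "rel_eta A\<^sub>1 A\<^sub>2 = \<i> / ?pi * (a - b + L (\<i> * complex_of_real c) - L (- (\<i> * complex_of_real c)))"
    unfolding rel_eta_def v_def[symmetric]
  proof (rule the_equality)
    have "continues_trace Fe (\<lambda>s x. eta_operator A\<^sub>1 s x - eta_operator A\<^sub>2 s x)"
      unfolding continues_trace_def
      by (intro conjI Fe_mer exI[of _ "max 3 (2 * \<sigma>)"] allI impI Fe_trace)
    thus "\<exists>F. continues_trace F (\<lambda>s x. eta_operator A\<^sub>1 s x - eta_operator A\<^sub>2 s x) \<and> v = fls_nth (laurent_expansion F 0) 0"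
      using laurent_constant_term[OF Fe_mer Fe_lim] by (intro exI[of _ Fe] conjI) (simp_all only:)
  next
    fix u assume "\<exists>F. continues_trace F (\<lambda>s x. eta_operator A\<^sub>1 s x - eta_operator A\<^sub>2 s x) \<and> u = fls_nth (laurent_expansion F 0) 0"
    then obtain F where F: "continues_trace F (\<lambda>s x. eta_operator A\<^sub>1 s x - eta_operator A\<^sub>2 s x)"
        "u = fls_nth (laurent_expansion F 0) 0" by (elim exE conjE) (rule that)
    from F(1) obtain \<tau> where \<tau>: "\<forall>s. Re s > \<tau> \<longrightarrow> trace_class_on UNIV (\<lambda>x. eta_operator A\<^sub>1 s x - eta_operator A\<^sub>2 s x)
          \<and> F s = trace_on UNIV (\<lambda>x. eta_operator A\<^sub>1 s x - eta_operator A\<^sub>2 s x)"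
      unfolding continues_trace_def by (elim exE conjE) (rule that)
    have Fm: "F meromorphic_on UNIV" using F(1) by (simp add: continues_trace_def)
    have "\<forall>\<^sub>F s in at 0. Fe s = F s"
    proof (rule meromorphic_identity[OF Fe_mer Fm])
      fix s assume "Re s > max (max 3 (2 * \<sigma>)) \<tau>"
      hence "Re s > max 3 (2 * \<sigma>)" "Re s > \<tau>" by simp_all
      thus "Fe s = F s" using \<tau> Fe_trace(2)[of s] by simp
    qed
    hence "\<forall>\<^sub>F s in at 0. Fe s - k / s = F s - k / s" by eventually_elim simp
    from Lim_transform_eventually[OF Fe_lim this]
    show "u = v" unfolding F(2) by (rule laurent_constant_term[OF Fm])
  qed
qed

end

lemma sector_ray_derivative:
  assumes L: "L holomorphic_on cut_sector \<theta> \<delta> \<rho>" and \<delta>: "0 < \<delta>" "\<delta> \<le> pi / 2" and \<rho>: "\<rho> > 0" and d: "d > 0"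
  defines "D \<equiv> \<lambda>r. cis \<theta> * complex_of_real (1 / (2 * sqrt r)) * deriv L (complex_of_real (sqrt r) * cis \<theta>)"
  shows "r \<ge> d \<Longrightarrow> ((\<lambda>r. L (complex_of_real (sqrt r) * cis \<theta>)) has_vector_derivative D r) (at r within {d..})"
    and "continuous_on {d..} D"
proof -
  note op = open_cut_sector[OF \<delta>(2) \<rho>]
  have in_sec: "complex_of_real (sqrt r) * cis \<theta> \<in> cut_sector \<theta> \<delta> \<rho>" if "r > 0" for r
    unfolding ray_exp[OF that] by (rule exp_in_cut_sector) (use \<delta> in simp)
  show "((\<lambda>r. L (complex_of_real (sqrt r) * cis \<theta>)) has_vector_derivative D r) (at r within {d..})" if "r \<ge> d"
  proof -
    have r: "r > 0" using that d by linarith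
    have "((\<lambda>r. complex_of_real (sqrt r)) has_vector_derivative complex_of_real (1 / (2 * sqrt r))) (at r within {d..})"
      using r by (intro has_vector_derivative_of_real)
        (auto intro!: derivative_eq_intros simp: field_simps)
    from has_vector_derivative_mult_left[OF this, of "cis \<theta>"]
    have "((\<lambda>r. complex_of_real (sqrt r) * cis \<theta>) has_vector_derivative complex_of_real (1 / (2 * sqrt r)) * cis \<theta>) (at r within {d..})" .
    from field_vector_diff_chain_within[OF this has_field_derivative_at_within[OF holomorphic_derivI[OF L op in_sec[OF r]]]]
    show ?thesis by (simp add: o_def D_def mult_ac)
  qed
  have "deriv L holomorphic_on cut_sector \<theta> \<delta> \<rho>" by (rule holomorphic_deriv[OF L op])
  hence cont: "continuous_on (cut_sector \<theta> \<delta> \<rho>) (deriv L)" by (rule holomorphic_on_imp_continuous_on)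
  have "continuous_on {d..} (\<lambda>r. deriv L (complex_of_real (sqrt r) * cis \<theta>))"
    by (rule continuous_on_compose2[OF cont]) (use d in_sec in \<open>auto intro!: continuous_intros\<close>)
  thus "continuous_on {d..} D"
    unfolding D_def using d by (intro continuous_intros) auto
qed

text \<open>
  The regularized limit exists by integration of the trace expansion and is unique by comparison of
  Mellin transforms along the ray.
\<close>

lemma LIM_reg_log_expansion:
  assumes \<delta>: "0 < \<delta>" "\<delta> \<le> pi / 2" and \<rho>: "\<rho> > 0"
    and L: "L holomorphic_on cut_sector \<theta> \<delta> \<rho>"
    and f: "\<forall>z\<in>cut_sector \<theta> \<delta> \<rho>. f z = - deriv L z"
    and ex: "has_trace_expansion \<theta> \<delta> \<rho> f"
  shows "\<exists>\<beta> p q J m. log_expansion \<beta> p q (\<lambda>r. L (complex_of_real (sqrt r) * cis \<theta>)) \<and> \<beta> J = 0 \<and>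
    p J = LIM_reg \<theta> \<delta> \<rho> L + m * (\<i> * complex_of_real (\<theta> - pi)) \<and> q J = m / 2"
proof -
  obtain c where c: "has_regularized_limit \<theta> \<delta> \<rho> L c"
    using regularized_limit_exists[OF \<delta> \<rho> L bspec[OF f] ex] by blast
  have LIM: "LIM_reg \<theta> \<delta> \<rho> L = c"
    unfolding LIM_reg_def
  proof (rule the_equality[where P="has_regularized_limit \<theta> \<delta> \<rho> L", OF c])
    fix c' assume c': "has_regularized_limit \<theta> \<delta> \<rho> L c'"
    obtain \<beta> p q J m where 1: "log_expansion \<beta> p q (\<lambda>r. L (complex_of_real (sqrt r) * cis \<theta>))" "\<beta> J = 0"
      "p J = c + m * (\<i> * complex_of_real (\<theta> - pi))" "q J = m / 2"
      using regularized_limit_log_expansion[OF c \<delta>(1)] by (elim exE conjE) (rule that)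
    obtain \<beta>' p' q' J' m' where 2: "log_expansion \<beta>' p' q' (\<lambda>r. L (complex_of_real (sqrt r) * cis \<theta>))" "\<beta>' J' = 0"
      "p' J' = c' + m' * (\<i> * complex_of_real (\<theta> - pi))" "q' J' = m' / 2"
      using regularized_limit_log_expansion[OF c' \<delta>(1)] by (elim exE conjE) (rule that)
    note ray = sector_ray_derivative[OF L \<delta> \<rho> zero_less_one]
    have "p J = p' J'" "q J = q' J'"
      by (rule log_expansion_unique[OF 1(1,2) 2(1,2) zero_less_one ray(1) ray(2)], assumption)+
    thus "c' = c" unfolding 1 2 by simp
  qed
  show ?thesis unfolding LIM by (rule regularized_limit_log_expansion[OF c \<delta>(1)])
qed

text \<open>
  A half-angle above \<open>\<pi>/2\<close> would put the whole punctured real axis into the sector, hence into the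
  resolvent set; points of the spectrum on the real axis exclude this.
\<close>

lemma sector_half_angle_bound:
  assumes "cut_sector \<theta> \<delta> \<rho> \<subseteq> resolvent_set A" "r > 0" "complex_of_real r \<in> spectrum A"
    and "\<theta> = pi / 2 \<or> \<theta> = 3 * pi / 2"
  shows "\<delta> \<le> pi / 2"
proof (rule ccontr)
  assume *: "\<not> \<delta> \<le> pi / 2"
  have "\<exists>t. \<bar>t - \<theta>\<bar> < \<delta> \<and> cis t = 1"
    using assms(4)
  proof
    assume \<theta>: "\<theta> = pi / 2"
    have "\<bar>0 - \<theta>\<bar> = pi / 2" by (simp add: \<theta>)
    thus ?thesis using * by (intro exI[of _ 0]) simp
  next
    assume \<theta>: "\<theta> = 3 * pi / 2"
    have "\<bar>2 * pi - \<theta>\<bar> = pi / 2" by (simp add: \<theta> abs_if field_simps)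
    thus ?thesis using * by (intro exI[of _ "2 * pi"]) (simp add: complex_eq_iff)
  qed
  hence "complex_of_real r \<in> cut_sector \<theta> \<delta> \<rho>" using assms(2) by (auto simp: cut_sector_def)
  thus False using assms(1,3) by (auto simp: spectrum_def)
qed

text \<open>
  Logarithms of the same function have equal derivatives, so the trace formula holds for every branch.
\<close>

lemma log_branch_deriv_eq:
  assumes S: "open S" and L: "log_branch_on S F L" and L': "log_branch_on S F L'" and z: "z \<in> S"
  shows "deriv L z = deriv L' z"
proof -
  have d: "(K has_field_derivative deriv K z) (at z)" "((\<lambda>w. exp (K w)) has_field_derivative F z * deriv K z) (at z)"
    if "log_branch_on S F K" for K
  proof -
    have K: "K holomorphic_on S" "exp (K z) = F z" using that z by (auto simp: log_branch_on_def)
    show *: "(K has_field_derivative deriv K z) (at z)" by (rule holomorphic_derivI[OF K(1) S z])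
    show "((\<lambda>w. exp (K w)) has_field_derivative F z * deriv K z) (at z)"
      using DERIV_fun_exp[OF *] by (simp add: K(2))
  qed
  have "((\<lambda>w. exp (L' w)) has_field_derivative F z * deriv L z) (at z)"
  proof (rule has_field_derivative_transform_within_open[OF d(2)[OF L] S z])
    show "exp (L w) = exp (L' w)" if "w \<in> S" for w using L L' that by (simp add: log_branch_on_def)
  qed
  hence "F z * deriv L z = F z * deriv L' z" using d(2)[OF L'] by (rule DERIV_unique)
  moreover have "F z \<noteq> 0" using L z by (metis exp_not_eq_zero log_branch_on_def)
  ultimately show ?thesis by simp
qed

lemma cdim_kernel_eq_0:
  assumes "0 \<in> resolvent_set A" "(0, 0) \<in> A"
  shows "cdim (kernel_of A) = 0"
proof -
  have "x = 0" if "(x, 0) \<in> A" for x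
    using resolvent_eqI[OF assms(1), of x 0] that resolvent_linear(4)[OF assms(1)] by simp
  hence "kernel_of A = {0}" using assms(2) by (auto simp: kernel_of_def)
  thus ?thesis
    by (metis card.empty cvector.dim_eq_card_independent cvector.dim_span cvector.independent_empty cvector.span_empty)
qed

theorem theorem2p16:
  fixes A\<^sub>1 A\<^sub>2 :: "'h::complex_hilbert graph"
    and \<delta>p \<rho>p \<delta>m \<rho>m :: real
    and Hp Hm :: "complex \<Rightarrow> 'h set"
    and Sp Sm :: "complex \<Rightarrow> 'h \<Rightarrow> 'h"
    and Lp Lm :: "complex \<Rightarrow> complex"
  assumes sa: "self_adjoint A\<^sub>1" "self_adjoint A\<^sub>2"
    and spec1: "\<exists>r>0. complex_of_real r \<in> spectrum A\<^sub>1" "\<exists>r<0. complex_of_real r \<in> spectrum A\<^sub>1"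
    and spec2: "\<exists>r>0. complex_of_real r \<in> spectrum A\<^sub>2" "\<exists>r<0. complex_of_real r \<in> spectrum A\<^sub>2"
    and comparable_p: "zeta_comparable (pi / 2) \<delta>p \<rho>p A\<^sub>1 A\<^sub>2 Hp Sp"
    and comparable_m: "zeta_comparable (3 * pi / 2) \<delta>m \<rho>m A\<^sub>1 A\<^sub>2 Hm Sm"
    and normalized: "fredholm_det (Hp 0) (Sp 0) = fredholm_det (Hm 0) (Sm 0)"
    and log_p: "log_branch_on (cut_sector (pi / 2) \<delta>p \<rho>p) (\<lambda>z. fredholm_det (Hp z) (Sp z)) Lp"
    and log_m: "log_branch_on (cut_sector (3 * pi / 2) \<delta>m \<rho>m) (\<lambda>z. fredholm_det (Hm z) (Sm z)) Lm"
  shows "rel_eta_tilde A\<^sub>1 A\<^sub>2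
           - (1 / (2 * complex_of_real pi * \<i>)
                * (LIM_reg (3 * pi / 2) \<delta>m \<rho>m Lm - LIM_reg (pi / 2) \<delta>p \<rho>p Lp)
              + 1 / 2 * rel_zeta_at_0 pi (A\<^sub>1 O A\<^sub>1) (A\<^sub>2 O A\<^sub>2)) \<in> \<int>"
proof -
  let ?f = "rel_resolvent_trace A\<^sub>1 A\<^sub>2" and ?pi = "complex_of_real pi"
  define Up where "Up = cut_sector (pi / 2) \<delta>p \<rho>p"
  define Um where "Um = cut_sector (3 * pi / 2) \<delta>m \<rho>m"
  have sec: "0 < \<delta>" "\<delta> \<le> pi / 2" "0 < \<rho>" "open (cut_sector \<theta> \<delta> \<rho>)"
      "cut_sector \<theta> \<delta> \<rho> \<subseteq> resolvent_set A\<^sub>1" "cut_sector \<theta> \<delta> \<rho> \<subseteq> resolvent_set A\<^sub>2"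
      "\<And>z. z \<in> cut_sector \<theta> \<delta> \<rho> \<Longrightarrow> trace_class_on UNIV (\<lambda>x. resolvent A\<^sub>1 z x - resolvent A\<^sub>2 z x)"
      "has_trace_expansion \<theta> \<delta> \<rho> ?f" "L holomorphic_on cut_sector \<theta> \<delta> \<rho>"
      "\<forall>z\<in>cut_sector \<theta> \<delta> \<rho>. ?f z = - deriv L z"
    if cmp: "zeta_comparable \<theta> \<delta> \<rho> A\<^sub>1 A\<^sub>2 H S" and \<theta>: "\<theta> = pi / 2 \<or> \<theta> = 3 * pi / 2"
      and L: "log_branch_on (cut_sector \<theta> \<delta> \<rho>) (\<lambda>z. fredholm_det (H z) (S z)) L"
    for \<theta> \<delta> \<rho> H L and S :: "complex \<Rightarrow> 'h \<Rightarrow> 'h"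
  proof -
    show pos: "0 < \<delta>" "0 < \<rho>" and sub: "cut_sector \<theta> \<delta> \<rho> \<subseteq> resolvent_set A\<^sub>1" "cut_sector \<theta> \<delta> \<rho> \<subseteq> resolvent_set A\<^sub>2"
      using cmp by (simp_all add: zeta_comparable_def spectral_cut_def)
    show "trace_class_on UNIV (\<lambda>x. resolvent A\<^sub>1 z x - resolvent A\<^sub>2 z x)" if "z \<in> cut_sector \<theta> \<delta> \<rho>" for z
      using cmp that by (simp add: zeta_comparable_def)
    show "has_trace_expansion \<theta> \<delta> \<rho> ?f" using cmp by (simp add: zeta_comparable_def)
    show "L holomorphic_on cut_sector \<theta> \<delta> \<rho>" using L by (simp add: log_branch_on_def)
    obtain r where r: "r > 0" "complex_of_real r \<in> spectrum A\<^sub>1" using spec1(1) by blast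
    show "\<delta> \<le> pi / 2" by (rule sector_half_angle_bound[OF sub(1) r \<theta>])
    thus op: "open (cut_sector \<theta> \<delta> \<rho>)" by (rule open_cut_sector[OF _ pos(2)])
    obtain K where K: "log_branch_on (cut_sector \<theta> \<delta> \<rho>) (\<lambda>z. fredholm_det (H z) (S z)) K"
        "\<forall>z\<in>cut_sector \<theta> \<delta> \<rho>. ?f z = - deriv K z"
      using cmp unfolding zeta_comparable_def by (elim conjE exE) (rule that)
    show "\<forall>z\<in>cut_sector \<theta> \<delta> \<rho>. ?f z = - deriv L z"
      using K(2) log_branch_deriv_eq[OF op K(1) L] by simp
  qed
  note secp = sec[OF comparable_p disjI1[OF refl] log_p] and secm = sec[OF comparable_m disjI2[OF refl] log_m]
  define \<rho> where "\<rho> = min \<rho>p \<rho>m"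
  have rho: "\<rho> > 0" using secp(3) secm(3) by (simp add: \<rho>_def)
  have ball_p: "ball 0 \<rho> \<subseteq> cut_sector (pi / 2) \<delta>p \<rho>p" and ball_m: "ball 0 \<rho> \<subseteq> cut_sector (3 * pi / 2) \<delta>m \<rho>m"
    by (auto simp: cut_sector_def \<rho>_def)
  have W: "z \<in> cut_sector (pi / 2) \<delta>p \<rho>p \<or> z \<in> cut_sector (3 * pi / 2) \<delta>m \<rho>m" if "z \<in> axis_disc \<rho>" for z
  proof (cases "norm z < \<rho>")
    case True
    thus ?thesis using ball_p by auto
  next
    case False
    hence re: "Re z = 0" using that by (simp add: axis_disc_def)
    show ?thesis
    proof (cases "Im z \<ge> 0")
      case True
      hence "z = complex_of_real (norm z) * cis (pi / 2)" using re by (simp add: complex_eq_iff cmod_eq_Im)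
      hence "z \<in> cut_sector (pi / 2) \<delta>p \<rho>p"
        unfolding cut_sector_def using secp(1) by (intro CollectI disjI1 exI[of _ "pi / 2"]) simp
      thus ?thesis ..
    next
      case False
      have "cis (3 * pi / 2) = - \<i>"
        using cis_mult[of pi "pi / 2"] by (simp add: add_divide_distrib[symmetric] field_simps)
      hence "z = complex_of_real (norm z) * cis (3 * pi / 2)" using re False by (simp add: complex_eq_iff cmod_eq_Im)
      hence "z \<in> cut_sector (3 * pi / 2) \<delta>m \<rho>m"
        unfolding cut_sector_def using secm(1) by (intro CollectI disjI1 exI[of _ "3 * pi / 2"]) simp
      thus ?thesis ..
    qed
  qed
  interpret nuclear_pair A\<^sub>1 A\<^sub>2 \<rho>
  proof
    show "axis_disc \<rho> \<subseteq> resolvent_set A\<^sub>1" using W secp(5) secm(5) by blast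
    show "axis_disc \<rho> \<subseteq> resolvent_set A\<^sub>2" using W secp(6) secm(6) by blast
    show "trace_class_on UNIV (\<lambda>x. resolvent A\<^sub>1 z x - resolvent A\<^sub>2 z x)" if "z \<in> axis_disc \<rho>" for z
      using W[OF that] secp(7) secm(7) by (elim disjE) simp_all
  qed (use sa rho in simp_all)

  have Dp: "(Lp has_field_derivative - ?f z) (at z)" if "z \<in> ball 0 \<rho>" for z
    using holomorphic_derivI[OF secp(9) secp(4) subsetD[OF ball_p that]] bspec[OF secp(10) subsetD[OF ball_p that]] by simp
  have Dm: "(Lm has_field_derivative - ?f z) (at z)" if "z \<in> ball 0 \<rho>" for z
    using holomorphic_derivI[OF secm(9) secm(4) subsetD[OF ball_m that]] bspec[OF secm(10) subsetD[OF ball_m that]] by simp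
  \<comment> \<open>Near \<open>0\<close> both logarithms are primitives of minus the trace; the normalization at \<open>0\<close> makes their difference a multiple of \<open>2\<pi>i\<close>, the source of the integer ambiguity.\<close>
  obtain n :: int where n: "\<And>z. z \<in> ball 0 \<rho> \<Longrightarrow> Lp z = Lm z + 2 * of_int n * ?pi * \<i>"
  proof -
    have "exp (Lp 0) = exp (Lm 0)"
      using log_p log_m normalized subsetD[OF ball_p, of 0] subsetD[OF ball_m, of 0] rho
      by (simp add: log_branch_on_def)
    then obtain n :: int where n: "Lp 0 = Lm 0 + complex_of_real (real_of_int (2 * n) * pi) * \<i>"
      unfolding exp_eq by blast
    have "\<exists>k. \<forall>z\<in>ball 0 \<rho>. Lp z - Lm z = k"
    proof (rule has_field_derivative_zero_constant[OF convex_ball])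
      show "((\<lambda>z. Lp z - Lm z) has_field_derivative 0) (at z within ball 0 \<rho>)" if "z \<in> ball 0 \<rho>" for z
        using DERIV_diff[OF Dp[OF that] Dm[OF that]] by (auto intro: has_field_derivative_at_within)
    qed
    then obtain k where k: "\<And>z. z \<in> ball 0 \<rho> \<Longrightarrow> Lp z - Lm z = k" by blast
    have "k = 2 * of_int n * ?pi * \<i>" using k[of 0] n rho by simp
    hence "Lp z = Lm z + 2 * of_int n * ?pi * \<i>" if "z \<in> ball 0 \<rho>" for z using k[OF that] by (simp add: algebra_simps)
    thus ?thesis by (rule that)
  qed

  define c where "c = \<rho> / 2"
  have c: "0 < c" "c < \<rho>" using rho by (simp_all add: c_def)
  have d: "c\<^sup>2 > 0" using c by simp
  have cis3: "cis (3 * pi / 2) = - \<i>"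
    using cis_mult[of pi "pi / 2"] by (simp add: add_divide_distrib[symmetric] field_simps)
  obtain \<beta> p q J m where ep: "log_expansion \<beta> p q (\<lambda>r. Lp (complex_of_real (sqrt r) * cis (pi / 2)))" "\<beta> J = 0"
    "p J = LIM_reg (pi / 2) \<delta>p \<rho>p Lp + m * (\<i> * complex_of_real (pi / 2 - pi))" "q J = m / 2"
    using LIM_reg_log_expansion[OF secp(1-3,9,10,8)] by (elim exE conjE) (rule that)
  obtain \<beta>' p' q' J' m' where em: "log_expansion \<beta>' p' q' (\<lambda>r. Lm (complex_of_real (sqrt r) * cis (3 * pi / 2)))" "\<beta>' J' = 0"
    "p' J' = LIM_reg (3 * pi / 2) \<delta>m \<rho>m Lm + m' * (\<i> * complex_of_real (3 * pi / 2 - pi))" "q' J' = m' / 2"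
    using LIM_reg_log_expansion[OF secm(1-3,9,10,8)] by (elim exE conjE) (rule that)
  define \<phi> where "\<phi> = (\<lambda>r. cis (pi / 2) * complex_of_real (1 / (2 * sqrt r)) * deriv Lp (complex_of_real (sqrt r) * cis (pi / 2)))"
  define \<psi> where "\<psi> = (\<lambda>r. cis (3 * pi / 2) * complex_of_real (1 / (2 * sqrt r)) * deriv Lm (complex_of_real (sqrt r) * cis (3 * pi / 2)))"
  have "\<exists>M. M meromorphic_on UNIV \<and>
    (\<forall>s. Re s > 1 - \<beta> 0 \<longrightarrow> ((\<lambda>r. exp (- s * complex_of_real (ln r)) * \<phi> r) has_integral M s) {c\<^sup>2..}) \<and>
    ((\<lambda>s. M s - q J / s) \<longlongrightarrow> p J - Lp (complex_of_real (sqrt (c\<^sup>2)) * cis (pi / 2))) (at 0)"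
    unfolding \<phi>_def
    by (rule mellin_transform_of_derivative[OF ep(1) d ep(2) sector_ray_derivative(1)[OF secp(9,1,2,3) d]
          sector_ray_derivative(2)[OF secp(9,1,2,3) d]])
  then obtain P where P: "P meromorphic_on UNIV"
    "\<forall>s. Re s > 1 - \<beta> 0 \<longrightarrow> ((\<lambda>r. exp (- s * complex_of_real (ln r)) * \<phi> r) has_integral P s) {c\<^sup>2..}"
    "((\<lambda>s. P s - q J / s) \<longlongrightarrow> p J - Lp (complex_of_real (sqrt (c\<^sup>2)) * cis (pi / 2))) (at 0)"
    by (elim exE conjE) (rule that)
  have "\<exists>M. M meromorphic_on UNIV \<and>
    (\<forall>s. Re s > 1 - \<beta>' 0 \<longrightarrow> ((\<lambda>r. exp (- s * complex_of_real (ln r)) * \<psi> r) has_integral M s) {c\<^sup>2..}) \<and>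
    ((\<lambda>s. M s - q' J' / s) \<longlongrightarrow> p' J' - Lm (complex_of_real (sqrt (c\<^sup>2)) * cis (3 * pi / 2))) (at 0)"
    unfolding \<psi>_def
    by (rule mellin_transform_of_derivative[OF em(1) d em(2) sector_ray_derivative(1)[OF secm(9,1,2,3) d]
          sector_ray_derivative(2)[OF secm(9,1,2,3) d]])
  then obtain Q where Q: "Q meromorphic_on UNIV"
    "\<forall>s. Re s > 1 - \<beta>' 0 \<longrightarrow> ((\<lambda>r. exp (- s * complex_of_real (ln r)) * \<psi> r) has_integral Q s) {c\<^sup>2..}"
    "((\<lambda>s. Q s - q' J' / s) \<longlongrightarrow> p' J' - Lm (complex_of_real (sqrt (c\<^sup>2)) * cis (3 * pi / 2))) (at 0)"
    by (elim exE conjE) (rule that)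
  have sc: "complex_of_real (sqrt (c\<^sup>2)) * cis (pi / 2) = \<i> * complex_of_real c"
      "complex_of_real (sqrt (c\<^sup>2)) * cis (3 * pi / 2) = - (\<i> * complex_of_real c)"
    using c by (simp_all add: cis3)
  have \<phi>: "\<phi> r = - \<i> * ?f (\<i> * complex_of_real (sqrt r)) / (2 * complex_of_real (sqrt r))" if r: "r > 0" for r
  proof -
    have "complex_of_real (sqrt r) * cis (pi / 2) \<in> cut_sector (pi / 2) \<delta>p \<rho>p"
      unfolding ray_exp[OF r] by (rule exp_in_cut_sector) (use secp(1) in simp)
    from bspec[OF secp(10) this] have "deriv Lp (complex_of_real (sqrt r) * \<i>) = - ?f (complex_of_real (sqrt r) * \<i>)" by simp
    thus ?thesis by (simp add: \<phi>_def mult.commute)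
  qed
  have \<psi>: "\<psi> r = \<i> * ?f (- (\<i> * complex_of_real (sqrt r))) / (2 * complex_of_real (sqrt r))" if r: "r > 0" for r
  proof -
    have "complex_of_real (sqrt r) * cis (3 * pi / 2) \<in> cut_sector (3 * pi / 2) \<delta>m \<rho>m"
      unfolding ray_exp[OF r] by (rule exp_in_cut_sector) (use secm(1) in simp)
    from bspec[OF secm(10) this] have "deriv Lm (- (complex_of_real (sqrt r) * \<i>)) = - ?f (- (complex_of_real (sqrt r) * \<i>))"
      by (simp add: cis3)
    thus ?thesis unfolding \<psi>_def cis3 by (simp add: mult.commute)
  qed
  have vals: "rel_zeta_at_0 pi (A\<^sub>1 O A\<^sub>1) (A\<^sub>2 O A\<^sub>2) = q J + q' J'"
    "rel_eta A\<^sub>1 A\<^sub>2 = \<i> / ?pi * ((p J - Lp (\<i> * complex_of_real c)) - (p' J' - Lm (- (\<i> * complex_of_real c)))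
        + Lm (\<i> * complex_of_real c) - Lm (- (\<i> * complex_of_real c)))"
    by (rule zeta_eta_values[where \<sigma>="max (1 - \<beta> 0) (1 - \<beta>' 0)", OF c P(1) P(3)[unfolded sc] _ Q(1) Q(3)[unfolded sc] _ \<phi> \<psi> Dm];
        use P(2) Q(2) in simp)+
  have kernels: "cdim (kernel_of A\<^sub>1) = 0" "cdim (kernel_of A\<^sub>2) = 0"
    using zero_in_axis_disc res1 res2 sa by (auto intro!: cdim_kernel_eq_0 simp: self_adjoint_def linear_operator_def)
  have "\<i> * complex_of_real c \<in> ball 0 \<rho>" using c by (simp add: norm_mult)
  from n[OF this]
  have eta: "rel_eta A\<^sub>1 A\<^sub>2 = \<i> / ?pi * (p J - p' J' - 2 * of_int n * ?pi * \<i>)"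
    unfolding vals(2) by simp
  \<comment> \<open>The phases \<open>-\<pi>/2\<close> and \<open>\<pi>/2\<close> of \<open>-\<lambda>\<close> on the two half-axes produce \<open>(m + m')/4\<close>, half the zeta value.\<close>
  have "rel_eta_tilde A\<^sub>1 A\<^sub>2
           - (1 / (2 * ?pi * \<i>) * (LIM_reg (3 * pi / 2) \<delta>m \<rho>m Lm - LIM_reg (pi / 2) \<delta>p \<rho>p Lp)
              + 1 / 2 * rel_zeta_at_0 pi (A\<^sub>1 O A\<^sub>1) (A\<^sub>2 O A\<^sub>2)) = of_int n"
    unfolding rel_eta_tilde_def kernels eta vals(1) ep(3,4) em(3,4)
    by (simp add: field_simps)
  thus ?thesis by simp
qed

end
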